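(* There is no quantum commitment scheme in the CRQS model that, for every polynomial $t$, satisfies both $t$-copy statistical hiding and $t$-copy statistical sum-binding.
   Context: A (non-interactive) quantum commitment scheme in the CRQS model consists of uniform QPT algorithms $\mathsf{Setup}$, $C$, $R$: $\mathsf{Setup}(1^\lambda)$ samples a classical key $k\gets\mathcal{K}_\lambda$ uniformly and gives one copy each of a pure state $\ket{\psi_k}$ to $C$ and $R$; in the commit phase $C$ on input $b\in\{0,1\}$ and $\ket{\psi_k}$ prepares a state on registers $\mathbf{C},\mathbf{R}$ and sends $\mathbf{C}$; in the reveal phase $C$ sends $b$ and $\mathbf{R}$, and $R$ (using its copy of $\ket{\psi_k}$) outputs $b$ or $\bot$. Correctness: honest runs are accepted with probability 1. $t$-copy statistical hiding: for every non-uniform unbounded-time $\mathcal{A}$, the advantage of distinguishing $(\ket{\psi_k}^{\otimes t},\mathrm{Tr}_{\mathbf{R}}\sigma^{(0)})$ from $(\ket{\psi_k}^{\otimes t},\mathrm{Tr}_{\mathbf{R}}\sigma^{(1)})$, for $k\gets\mathcal{K}_\lambda$ and $\sigma^{(b)}$ the honest commit state on $\ket{\psi_k}$ and $b$, is $\mathsf{negl}(\lambda)$. $t$-copy statistical sum-binding: for any pair of non-uniform unbounded-time malicious committers $C_0^*,C_1^*$ that receive $t$ copies of $\ket{\psi_k}$ (for $k\gets\mathcal{K}_\lambda$) and act identically in the commit phase, letting $p_b$ be the probability that the honest $R$ (holding its own copy of $\ket{\psi_k}$) accepts the revealed bit $b$ when interacting with $C_b^*$, we have $p_0+p_1\le1+\mathsf{negl}(\lambda)$.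 *)

theory Defs
  imports "Jordan_Normal_Form.Matrix" "HOL-Computational_Algebra.Polynomial"
begin

definition dag :: "complex mat \<Rightarrow> complex mat" where
  "dag A = mat (dim_col A) (dim_row A) (\<lambda>(i,j). cnj (A $$ (j,i)))"

definition qtr :: "complex mat \<Rightarrow> complex" where
  "qtr A = (\<Sum>i<dim_row A. A $$ (i,i))"

definition kron :: "complex mat \<Rightarrow> complex mat \<Rightarrow> complex mat" where
  "kron A B = mat (dim_row A * dim_row B) (dim_col A * dim_col B)
     (\<lambda>(i,j). A $$ (i div dim_row B, j div dim_col B) * B $$ (i mod dim_row B, j mod dim_col B))"

fun kpow :: "complex mat \<Rightarrow> nat \<Rightarrow> complex mat" where
  "kpow A 0 = 1\<^sub>m 1"
| "kpow A (Suc n) = kron A (kpow A n)"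

definition ptrace2 :: "nat \<Rightarrow> nat \<Rightarrow> complex mat \<Rightarrow> complex mat" where
  "ptrace2 dA dB \<rho> = mat dA dA (\<lambda>(i,j). \<Sum>l<dB. \<rho> $$ (i*dB + l, j*dB + l))"

definition psd :: "nat \<Rightarrow> complex mat \<Rightarrow> bool" where
  "psd n A \<longleftrightarrow> A \<in> carrier_mat n n \<and>
     (\<forall>v \<in> carrier_vec n. Im ((A *\<^sub>v v) \<bullet>c v) = 0 \<and> Re ((A *\<^sub>v v) \<bullet>c v) \<ge> 0)"

definition povm_elem :: "nat \<Rightarrow> complex mat \<Rightarrow> bool" where
  "povm_elem n M \<longleftrightarrow> psd n M \<and> psd n (1\<^sub>m n - M)"

definition unit_state :: "nat \<Rightarrow> complex vec \<Rightarrow> bool" where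
  "unit_state d v \<longleftrightarrow> v \<in> carrier_vec d \<and> v \<bullet>c v = 1"

definition proj :: "complex vec \<Rightarrow> complex mat" where
  "proj v = mat (dim_vec v) (dim_vec v) (\<lambda>(i,j). v $ i * cnj (v $ j))"

definition kraus :: "nat \<Rightarrow> nat \<Rightarrow> complex mat list \<Rightarrow> bool" where
  "kraus din dout Ks \<longleftrightarrow> (\<forall>K \<in> set Ks. K \<in> carrier_mat dout din) \<and>
     foldr (\<lambda>K acc. dag K * K + acc) Ks (0\<^sub>m din din) = 1\<^sub>m din"

definition apply_kraus :: "nat \<Rightarrow> complex mat list \<Rightarrow> complex mat \<Rightarrow> complex mat" where
  "apply_kraus dout Ks \<rho> = foldr (\<lambda>K acc. K * \<rho> * dag K + acc) Ks (0\<^sub>m dout dout)"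

definition negligible :: "(nat \<Rightarrow> real) \<Rightarrow> bool" where
  "negligible f \<longleftrightarrow> (\<forall>c::nat. \<exists>N. \<forall>n\<ge>N. \<bar>f n\<bar> \<le> 1 / real n ^ c)"

definition is_poly :: "(nat \<Rightarrow> nat) \<Rightarrow> bool" where
  "is_poly t \<longleftrightarrow> (\<exists>p :: nat poly. \<forall>n. t n = poly p n)"

text \<open>Per security parameter lam: key set, qubit counts of the common state and of the
  commitment/reveal registers, the common states psi_k, the honest committer's channel
  (on input bit b, from one copy of psi_k to registers C (x) R) and the honest receiver's
  acceptance effect for revealed bit b (on C (x) R (x) its own copy of psi_k).\<close>
record crqs_scheme =
  keys :: "nat \<Rightarrow> bool list set"
  nPsi :: "nat \<Rightarrow> nat"
  nC   :: "nat \<Rightarrow> nat"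
  nR   :: "nat \<Rightarrow> nat"
  psi  :: "nat \<Rightarrow> bool list \<Rightarrow> complex vec"
  com  :: "nat \<Rightarrow> bool \<Rightarrow> complex mat list"
  ver  :: "nat \<Rightarrow> bool \<Rightarrow> complex mat"

abbreviation dPsi where "dPsi S lam \<equiv> (2::nat) ^ nPsi S lam"
abbreviation dC where "dC S lam \<equiv> (2::nat) ^ nC S lam"
abbreviation dR where "dR S lam \<equiv> (2::nat) ^ nR S lam"

text \<open>Well-formedness, with the polynomial size bounds implied by QPT algorithms
  (key length and all register sizes polynomially bounded).\<close>
definition wf_scheme :: "crqs_scheme \<Rightarrow> bool" where
  "wf_scheme S \<longleftrightarrow> (\<exists>p. is_poly p \<and> (\<forall>lam.
      finite (keys S lam) \<and> keys S lam \<noteq> {} \<and>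
      (\<forall>k \<in> keys S lam. length k \<le> p lam) \<and>
      nPsi S lam \<le> p lam \<and> nC S lam \<le> p lam \<and> nR S lam \<le> p lam \<and>
      (\<forall>k \<in> keys S lam. unit_state (dPsi S lam) (psi S lam k)) \<and>
      (\<forall>b. kraus (dPsi S lam) (dC S lam * dR S lam) (com S lam b)) \<and>
      (\<forall>b. povm_elem (dC S lam * dR S lam * dPsi S lam) (ver S lam b))))"

definition avg_key :: "crqs_scheme \<Rightarrow> nat \<Rightarrow> (bool list \<Rightarrow> real) \<Rightarrow> real" where
  "avg_key S lam f = (\<Sum>k \<in> keys S lam. f k) / real (card (keys S lam))"

definition commit_state :: "crqs_scheme \<Rightarrow> nat \<Rightarrow> bool list \<Rightarrow> bool \<Rightarrow> complex mat" where
  "commit_state S lam k b = apply_kraus (dC S lam * dR S lam) (com S lam b) (proj (psi S lam k))"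

definition correct :: "crqs_scheme \<Rightarrow> bool" where
  "correct S \<longleftrightarrow> (\<forall>lam. \<forall>k \<in> keys S lam. \<forall>b.
     qtr (ver S lam b * kron (commit_state S lam k b) (proj (psi S lam k))) = 1)"

definition hide_prob :: "crqs_scheme \<Rightarrow> nat \<Rightarrow> nat \<Rightarrow> complex mat \<Rightarrow> bool \<Rightarrow> real" where
  "hide_prob S t lam D b = avg_key S lam (\<lambda>k.
     Re (qtr (D * kron (kpow (proj (psi S lam k)) t)
                        (ptrace2 (dC S lam) (dR S lam) (commit_state S lam k b)))))"

definition stat_hiding :: "crqs_scheme \<Rightarrow> (nat \<Rightarrow> nat) \<Rightarrow> bool" where
  "stat_hiding S t \<longleftrightarrow> (\<forall>D :: nat \<Rightarrow> complex mat.
     (\<forall>lam. povm_elem (dPsi S lam ^ t lam * dC S lam) (D lam)) \<longrightarrow>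
     negligible (\<lambda>lam. \<bar>hide_prob S (t lam) lam (D lam) False - hide_prob S (t lam) lam (D lam) True\<bar>))"

text \<open>Malicious committers: a common commit channel Phi from t copies of psi_k to C (x) E
  (E an arbitrary finite-dimensional private register), then for revealed bit b a channel
  Rev b from E to the reveal register R.  Acceptance probability of revealed bit b.\<close>
definition bind_prob :: "crqs_scheme \<Rightarrow> nat \<Rightarrow> nat \<Rightarrow> nat \<Rightarrow> complex mat list
     \<Rightarrow> complex mat list \<Rightarrow> bool \<Rightarrow> real" where
  "bind_prob S t lam dE Phi Rev b = avg_key S lam (\<lambda>k.
     Re (qtr (ver S lam b *
       kron (apply_kraus (dC S lam * dR S lam) (map (\<lambda>K. kron (1\<^sub>m (dC S lam)) K) Rev)
               (apply_kraus (dC S lam * dE) Phi (kpow (proj (psi S lam k)) t)))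
            (proj (psi S lam k)))))"

definition stat_sum_binding :: "crqs_scheme \<Rightarrow> (nat \<Rightarrow> nat) \<Rightarrow> bool" where
  "stat_sum_binding S t \<longleftrightarrow> (\<forall>(dE :: nat \<Rightarrow> nat) (Phi :: nat \<Rightarrow> complex mat list)
       (Rev0 :: nat \<Rightarrow> complex mat list) (Rev1 :: nat \<Rightarrow> complex mat list).
     (\<forall>lam. kraus (dPsi S lam ^ t lam) (dC S lam * dE lam) (Phi lam) \<and>
            kraus (dE lam) (dR S lam) (Rev0 lam) \<and> kraus (dE lam) (dR S lam) (Rev1 lam)) \<longrightarrow>
     (\<exists>\<nu>. negligible \<nu> \<and> (\<forall>lam.
        bind_prob S (t lam) lam (dE lam) (Phi lam) (Rev0 lam) False
      + bind_prob S (t lam) lam (dE lam) (Phi lam) (Rev1 lam) True \<le> 1 + \<nu> lam)))"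

end

theory Submission
  imports Defs "Jordan_Normal_Form.Spectral_Radius" "HOL-Analysis.L2_Norm"
begin

text \<open>
  A malicious committer with polynomially many copies of the common state guesses the key.
  Ball growing splits all but a small fraction of the keys into clusters of tiny diameter whose
  mutual distance is still inverse polynomial; with enough copies, states from different clusters
  become almost orthogonal, so the pretty good measurement (the square root of the Gram matrix)
  returns a key k' whose state is close to the true one, and k' is uniform over the remaining keys.
  By the hiding property, tested with the same measurement followed by an optimal measurement on
  the commitment, the honest commitments to 0 and 1 under k' are close on average.  The committer
  therefore sends the C-part of a canonical purification of the commitment to 0 under k', and opens
  it to either bit by the isometry of Uhlmann's theorem.  Both openings succeed almost surely, so
  p0 + p1 is close to 2.  Uhlmann's theorem and the analysis of the pretty good measurement both
  rest on the Powers-Stoermer inequality for matrix square roots.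
\<close>

section \<open>Isometries and eigenbases\<close>

text \<open>The key itself cannot be identified, since distinct keys may have arbitrarily close
  states; a plain distance threshold gives no clusters either, because close pairs can form long
  chains. The way out is that there are fewer than \<open>2 ^ q\<close> keys with \<open>q\<close>
  polynomial: a ball gaining a factor 1001/1000 at each of \<open>1000 * q\<close> radii would
  outgrow the key set. So clusters of constant diameter with gaps of order 1/q exist, and
  polynomially many copies resolve such gaps. Uniformity of the guess matters because hiding holds
  only on average over the keys: it lets an average over true keys be read as an average over
  guessed keys. For each guess, the test from the Powers-Stoermer inequality has a signed advantage
  at the guessed key of at least half the squared distance of the two purifications, hence
  nonnegative, so different guesses cannot cancel in the total advantage. The receiver checks with
  the state of the true key, not of the guessed one; the cluster diameter controls this loss too.
  Any sum p0 + p1 bounded away from 1 contradicts binding, so all errors are fixed fractions,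
  generously rounded to leave 14/10.\<close>

definition ip :: "nat \<Rightarrow> (nat \<Rightarrow> complex) \<Rightarrow> (nat \<Rightarrow> complex) \<Rightarrow> complex" where
  "ip n u v = (\<Sum>i<n. cnj (u i) * v i)"

definition nsq :: "nat \<Rightarrow> (nat \<Rightarrow> complex) \<Rightarrow> real" where
  "nsq n v = (\<Sum>i<n. (cmod (v i))\<^sup>2)"

text \<open>Vectors and matrices are total functions with the dimension passed separately, so that
  padding, slicing and tensoring are mere reindexing. Here \<open>n\<close> counts the columns; the
  row index is free, and entries beyond the dimension are junk, hence the side conditions
  \<open>i < n\<close> in equations below.\<close>

definition mvp :: "nat \<Rightarrow> (nat \<Rightarrow> nat \<Rightarrow> complex) \<Rightarrow> (nat \<Rightarrow> complex) \<Rightarrow> nat \<Rightarrow> complex" where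
  "mvp n A v = (\<lambda>i. \<Sum>j<n. A i j * v j)"

definition adj :: "(nat \<Rightarrow> nat \<Rightarrow> complex) \<Rightarrow> nat \<Rightarrow> nat \<Rightarrow> complex" where
  "adj A = (\<lambda>i j. cnj (A j i))"

definition isom :: "nat \<Rightarrow> nat \<Rightarrow> (nat \<Rightarrow> nat \<Rightarrow> complex) \<Rightarrow> bool" where
  "isom n m U \<longleftrightarrow> (\<forall>i<n. \<forall>j<n. (\<Sum>k<m. cnj (U k i) * U k j) = of_bool (i = j))"

definition herm :: "nat \<Rightarrow> (nat \<Rightarrow> nat \<Rightarrow> complex) \<Rightarrow> bool" where
  "herm n A \<longleftrightarrow> (\<forall>i<n. \<forall>j<n. A i j = cnj (A j i))"

abbreviation (input) delta :: "nat \<Rightarrow> nat \<Rightarrow> complex" where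
  "delta a \<equiv> (\<lambda>i. of_bool (i = a))"

lemma nsq_nonneg [simp]: "0 \<le> nsq n v"
  by (simp add: nsq_def sum_nonneg)

lemma ip_self: "ip n v v = of_real (nsq n v)"
  by (simp add: ip_def nsq_def complex_norm_square mult.commute del: of_real_power)

lemma ip_cnj: "cnj (ip n u v) = ip n v u"
  by (simp add: ip_def mult.commute)

lemma ip_cong: "(\<And>i. i < n \<Longrightarrow> u i = u' i) \<Longrightarrow> (\<And>i. i < n \<Longrightarrow> v i = v' i) \<Longrightarrow> ip n u v = ip n u' v'"
  by (simp add: ip_def)

lemma mvp_cong: "(\<And>i. i < n \<Longrightarrow> v i = v' i) \<Longrightarrow> mvp n A v = mvp n A v'"
  by (simp add: mvp_def)

lemma ip_diff_right: "ip n u (\<lambda>i. v i - w i) = ip n u v - ip n u w"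
  by (simp add: ip_def algebra_simps sum_subtractf)

lemma ip_diff_left: "ip n (\<lambda>i. v i - w i) u = ip n v u - ip n w u"
  by (simp add: ip_def algebra_simps sum_subtractf)

lemma ip_scale_right: "ip n u (\<lambda>i. c * v i) = c * ip n u v"
  by (simp add: ip_def algebra_simps sum_distrib_left)

lemma ip_scale_left: "ip n (\<lambda>i. c * v i) u = cnj c * ip n v u"
  by (simp add: ip_def algebra_simps sum_distrib_left)

lemma sum_delta_left: "a < (n::nat) \<Longrightarrow> (\<Sum>j<n. of_bool (j = a) * f j) = (f a :: complex)"
  by (subst sum.remove[of _ a]) auto

lemma sum_delta_right: "a < (n::nat) \<Longrightarrow> (\<Sum>j<n. f j * of_bool (j = a)) = (f a :: complex)"
  by (subst sum.remove[of _ a]) auto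

lemma cnj_of_bool: "cnj (of_bool b) = of_bool b"
  by (cases b) auto

lemma ip_delta: "a < n \<Longrightarrow> ip n (delta a) v = v a"
  by (simp add: ip_def sum_delta_left cnj_of_bool del: sum_of_bool_mult_eq)

lemma mvp_delta: "a < n \<Longrightarrow> mvp n A (delta a) = (\<lambda>i. A i a)"
  by (simp add: mvp_def sum_delta_right del: sum_mult_of_bool_eq)

lemma nsq_eq_0: "nsq n v = 0 \<longleftrightarrow> (\<forall>i<n. v i = 0)"
  by (auto simp: nsq_def sum_nonneg_eq_0_iff)

lemma ip_mvp_adj: "ip m u (mvp n A v) = ip n (mvp m (adj A) u) v"
proof -
  have "ip m u (mvp n A v) = (\<Sum>i<m. \<Sum>j<n. cnj (u i) * A i j * v j)"
    by (simp add: ip_def mvp_def sum_distrib_left mult.assoc)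
  also have "\<dots> = (\<Sum>j<n. \<Sum>i<m. cnj (u i) * A i j * v j)"
    by (rule sum.swap)
  also have "\<dots> = ip n (mvp m (adj A) u) v"
    by (simp add: ip_def mvp_def adj_def sum_distrib_right sum_distrib_left mult_ac)
  finally show ?thesis .
qed

lemma isom_iff: "isom n m U \<longleftrightarrow> (\<forall>u v. ip m (mvp n U u) (mvp n U v) = ip n u v)"
proof
  assume U: "isom n m U"
  have "ip m (mvp n U u) (mvp n U v) = ip n u v" for u v
  proof -
    have "ip m (mvp n U u) (mvp n U v) = (\<Sum>k<m. \<Sum>i<n. \<Sum>j<n. cnj (u i) * v j * (cnj (U k i) * U k j))"
      unfolding ip_def mvp_def cnj_sum sum_product by (intro sum.cong refl) simp
    also have "\<dots> = (\<Sum>i<n. \<Sum>k<m. \<Sum>j<n. cnj (u i) * v j * (cnj (U k i) * U k j))"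
      by (rule sum.swap)
    also have "\<dots> = (\<Sum>i<n. \<Sum>j<n. \<Sum>k<m. cnj (u i) * v j * (cnj (U k i) * U k j))"
      by (intro sum.cong[OF refl] sum.swap)
    also have "\<dots> = (\<Sum>i<n. \<Sum>j<n. cnj (u i) * v j * of_bool (i = j))"
      using U by (simp add: isom_def sum_distrib_left[symmetric])
    also have "\<dots> = (\<Sum>i<n. \<Sum>j<n. (cnj (u i) * v j) * of_bool (j = i))"
      by (intro sum.cong refl) (simp add: of_bool_def)
    also have "\<dots> = ip n u v"
      unfolding ip_def by (intro sum.cong refl) (simp add: sum_delta_right del: sum_mult_of_bool_eq)
    finally show ?thesis .
  qed
  then show "\<forall>u v. ip m (mvp n U u) (mvp n U v) = ip n u v" by blast
next
  assume *: "\<forall>u v. ip m (mvp n U u) (mvp n U v) = ip n u v"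
  show "isom n m U"
    unfolding isom_def
  proof (intro allI impI)
    fix i j assume "i < n" "j < n"
    then show "(\<Sum>k<m. cnj (U k i) * U k j) = of_bool (i = j)"
      using *[rule_format, of "delta i" "delta j"] unfolding ip_delta[OF \<open>i < n\<close>] mvp_delta[OF \<open>i < n\<close>] mvp_delta[OF \<open>j < n\<close>]
      by (simp add: ip_def)
  qed
qed

lemma isom_nsq: "isom n m U \<Longrightarrow> nsq m (mvp n U v) = nsq n v"
  by (metis isom_iff ip_self of_real_eq_iff)

text \<open>Finite dimension enters here: a left inverse of a square matrix is also a right
  inverse.\<close>

lemma isom_adj:
  assumes "isom n n U"
  shows "isom n n (adj U)"
proof -
  define A where "A = mat n n (\<lambda>(i,j). cnj (U j i))"
  define B where "B = mat n n (\<lambda>(i,j). U i j)"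
  have A: "A \<in> carrier_mat n n" and B: "B \<in> carrier_mat n n" by (auto simp: A_def B_def)
  have "A * B = 1\<^sub>m n"
    using assms
    by (intro eq_matI) (auto simp: A_def B_def scalar_prod_def isom_def lessThan_atLeast0)
  then have BA: "B * A = 1\<^sub>m n"
    using mat_mult_left_right_inverse[OF A B] by simp
  show ?thesis
    unfolding isom_def
  proof (intro allI impI)
    fix i j assume ij: "i < n" "j < n"
    have "(B * A) $$ (i, j) = (\<Sum>k<n. U i k * cnj (U j k))"
      using ij by (simp add: A_def B_def scalar_prod_def lessThan_atLeast0)
    then show "(\<Sum>k<n. cnj (adj U k i) * adj U k j) = of_bool (i = j)"
      using BA ij by (auto simp: adj_def)
  qed
qed

lemma isom_adj_inv:
  assumes "isom n n U" "i < n"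
  shows "mvp n U (mvp n (adj U) v) i = v i"
proof -
  have "ip n (delta i) (mvp n U (mvp n (adj U) v)) = ip n (mvp n (adj U) (delta i)) (mvp n (adj U) v)"
    by (rule ip_mvp_adj)
  also have "\<dots> = ip n (delta i) v"
    using isom_adj[OF assms(1)] by (simp add: isom_iff)
  finally show ?thesis using assms(2) by (simp add: ip_delta)
qed

lemma mvp_mat_mult: "mvp n (\<lambda>i j. \<Sum>k<m. A i k * B k j) v = mvp m A (mvp n B v)"
proof
  fix i
  have "mvp n (\<lambda>i j. \<Sum>k<m. A i k * B k j) v i = (\<Sum>j<n. \<Sum>k<m. A i k * (B k j * v j))"
    by (simp add: mvp_def sum_distrib_right mult.assoc)
  also have "\<dots> = (\<Sum>k<m. \<Sum>j<n. A i k * (B k j * v j))" by (rule sum.swap)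
  finally show "mvp n (\<lambda>i j. \<Sum>k<m. A i k * B k j) v i = mvp m A (mvp n B v) i"
    by (simp add: mvp_def sum_distrib_left)
qed

lemma isom_comp:
  assumes "isom n m U" "isom m l V"
  shows "isom n l (\<lambda>i j. \<Sum>k<m. V i k * U k j)"
  using assms by (simp add: isom_iff mvp_mat_mult)

lemma isom_id: "isom n n (\<lambda>i j. of_bool (i = j))"
  and mvp_id: "i < n \<Longrightarrow> mvp n (\<lambda>i j. of_bool (i = j)) v i = v i"
proof -
  have *: "mvp n (\<lambda>i j. of_bool (i = j)) v i = v i" if "i < n" for i v
    using that by (simp add: mvp_def eq_commute[of i] sum_delta_left del: sum_of_bool_mult_eq)
  show "isom n n (\<lambda>i j. of_bool (i = j))"
    unfolding isom_iff by (intro allI ip_cong) (auto simp: *)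
  show "i < n \<Longrightarrow> mvp n (\<lambda>i j. of_bool (i = j)) v i = v i" by (rule *)
qed

text \<open>A vector x is mapped to y of the same norm by the complex Householder map
  v - (w, v) / (w, x) w with w = x - y, which fixes everything orthogonal to w.\<close>
lemma householder:
  assumes "nsq n x = nsq n y"
  obtains V where "isom n n V" "\<And>i. i < n \<Longrightarrow> mvp n V x i = y i"
    "\<And>z i. ip n z x = ip n z y \<Longrightarrow> i < n \<Longrightarrow> mvp n V z i = z i"
proof (cases "nsq n (\<lambda>i. x i - y i) = 0")
  case True
  then have "x i = y i" if "i < n" for i using that by (simp add: nsq_eq_0)
  then show ?thesis using that[OF isom_id] by (simp add: mvp_id)
next
  case False
  define w where "w = (\<lambda>i. x i - y i)"
  define a where "a = ip n w x"
  define V where "V = (\<lambda>i j. of_bool (i = j) - w i * cnj (w j) / a)"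
  have Vv: "mvp n V v i = v i - ip n w v / a * w i" if "i < n" for v i
  proof -
    have "mvp n V v i = mvp n (\<lambda>i j. of_bool (i = j)) v i - (\<Sum>j<n. w i * cnj (w j) / a * v j)"
      by (simp add: mvp_def V_def left_diff_distrib sum_subtractf)
    also have "(\<Sum>j<n. w i * cnj (w j) / a * v j) = ip n w v / a * w i"
      by (simp add: ip_def sum_distrib_left sum_distrib_right sum_divide_distrib algebra_simps)
    finally show ?thesis using that by (simp add: mvp_id)
  qed
  \<comment> \<open>The only use of equal norms. This identity is exactly what makes
    \<open>V\<close> an isometry, and it shows \<open>a\<close> to be nonzero.\<close>
  have nw: "of_real (nsq n w) = a + cnj a"
  proof -
    have "of_real (nsq n w) = ip n w w" by (simp add: ip_self)
    also have "\<dots> = ip n x x - ip n x y - ip n y x + ip n y y"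
      by (simp add: w_def ip_diff_right ip_diff_left)
    also have "ip n y y = ip n x x" using assms by (simp add: ip_self)
    also have "ip n x x - ip n x y - ip n y x + ip n x x = a + cnj a"
      by (simp add: a_def w_def ip_diff_left ip_cnj ip_diff_right)
    finally show ?thesis .
  qed
  have a0: "a \<noteq> 0" using False nw by (auto simp: w_def)
  have "isom n n V"
    unfolding isom_iff
  proof (intro allI)
    fix u v
    define p where "p = ip n w u"
    define q where "q = ip n w v"
    have exp: "ip n (\<lambda>i. u i - s * w i) (\<lambda>i. v i - t * w i)
        = ip n u v - t * ip n u w - cnj s * ip n w v + cnj s * t * ip n w w" for s t
      by (simp add: ip_diff_left ip_diff_right ip_scale_left ip_scale_right algebra_simps)
    have "ip n (mvp n V u) (mvp n V v) = ip n (\<lambda>i. u i - p / a * w i) (\<lambda>i. v i - q / a * w i)"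
      by (intro ip_cong) (auto simp: Vv p_def q_def)
    also have "\<dots> = ip n u v - q / a * cnj p - cnj (p / a) * q + cnj (p / a) * (q / a) * (a + cnj a)"
      unfolding exp ip_self[of n w] nw by (simp add: p_def q_def ip_cnj)
    also have "\<dots> = ip n u v"
    proof -
      have "cnj (p / a) * (q / a) * (a + cnj a) = q / a * cnj p + cnj (p / a) * q"
        if "cnj a \<noteq> 0" using a0 that unfolding complex_cnj_divide
        by (simp add: add_divide_distrib ring_distribs)
      then show ?thesis using a0 by simp
    qed
    finally show "ip n (mvp n V u) (mvp n V v) = ip n u v" .
  qed
  moreover have "mvp n V x i = y i" if "i < n" for i
    using a0 that by (simp add: Vv a_def[symmetric]) (simp add: w_def)
  moreover have "mvp n V z i = z i" if "ip n z x = ip n z y" "i < n" for z i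
  proof -
    have "ip n z w = 0" using that by (simp add: w_def ip_diff_right)
    then have "ip n w z = 0" using ip_cnj[of n z w] by simp
    then show ?thesis using that by (simp add: Vv)
  qed
  ultimately show ?thesis using that by blast
qed

text \<open>Families with equal Gram matrices differ by a unitary. Each new vector costs one
  Householder map, which fixes the earlier \<open>y i\<close> because their inner products with the
  old and the new image agree. Linearly dependent vectors need no separate treatment, unlike with
  Gram-Schmidt.\<close>

lemma unitary_align:
  fixes m :: nat
  assumes "\<And>i j. i < m \<Longrightarrow> j < m \<Longrightarrow> ip n (x i) (x j) = ip n (y i) (y j)"
  shows "\<exists>U. isom n n U \<and> (\<forall>i<m. \<forall>r<n. mvp n U (x i) r = y i r)"
  using assms
proof (induction m)
  case 0
  then show ?case using isom_id by auto
next
  case (Suc m)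
  then obtain U where U: "isom n n U" "\<And>i r. i < m \<Longrightarrow> r < n \<Longrightarrow> mvp n U (x i) r = y i r"
    by (metis less_Suc_eq)
  have ipU: "ip n (mvp n U u) (mvp n U v) = ip n u v" for u v using U(1) by (simp add: isom_iff)
  have "nsq n (mvp n U (x m)) = nsq n (y m)"
    using isom_nsq[OF U(1)] Suc.prems[of m m] by (simp add: ip_self)
  from householder[OF this] obtain V where V: "isom n n V"
    "\<And>i. i < n \<Longrightarrow> mvp n V (mvp n U (x m)) i = y m i"
    "\<And>z i. ip n z (mvp n U (x m)) = ip n z (y m) \<Longrightarrow> i < n \<Longrightarrow> mvp n V z i = z i" by metis
  have *: "mvp n V (mvp n U (x i)) r = y i r" if "i < Suc m" "r < n" for i r
  proof (cases "i = m")
    case True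
    then show ?thesis using V(2) that by simp
  next
    case False
    then have i: "i < m" using that by simp
    have "ip n (y i) (mvp n U (x m)) = ip n (mvp n U (x i)) (mvp n U (x m))"
      by (intro ip_cong) (auto simp: U(2)[OF i])
    also have "\<dots> = ip n (y i) (y m)" using Suc.prems[of i m] i by (simp add: ipU)
    finally have "mvp n V (y i) r = y i r" using V(3) that by blast
    moreover have "mvp n V (mvp n U (x i)) = mvp n V (y i)"
      by (rule mvp_cong) (simp add: U(2)[OF i])
    ultimately show ?thesis by simp
  qed
  show ?case
    using isom_comp[OF U(1) V(1)] * by (intro exI[of _ "\<lambda>i j. \<Sum>k<n. V i k * U k j"]) (auto simp: mvp_mat_mult)
qed

text \<open>Columns of both matrices are padded with zeros to dimension \<open>m\<close>, aligned by
  a unitary, and the unitary is cut down to its first \<open>b\<close> columns. Both the pretty good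
  measurement and Uhlmann's isometries arise this way.\<close>

lemma isometry_align:
  fixes n :: nat
  assumes gram: "\<And>i j. i < n \<Longrightarrow> j < n \<Longrightarrow>
      (\<Sum>r<a. cnj (X r i) * X r j) = (\<Sum>r<b. cnj (Z r i) * Z r j)"
    and m: "a \<le> m" "b \<le> m"
  shows "\<exists>W. isom b m W \<and>
    (\<forall>i<n. \<forall>r<m. mvp b W (\<lambda>s. Z s i) r = (if r < a then X r i else 0))"
proof -
  define x where "x = (\<lambda>i r. if r < b then Z r i else 0)"
  define y where "y = (\<lambda>i r. if r < a then X r i else (0::complex))"
  have cut: "(\<Sum>r<m. if r < c then f r else 0) = (\<Sum>r<c. f r)" if "c \<le> m" for c and f :: "nat \<Rightarrow> complex"
    using that by (intro sum.mono_neutral_cong_right) auto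
  have "ip m (x i) (x j) = ip m (y i) (y j)" if "i < n" "j < n" for i j
  proof -
    have "ip m (x i) (x j) = (\<Sum>r<m. if r < b then cnj (Z r i) * Z r j else 0)"
      by (auto simp: ip_def x_def intro!: sum.cong)
    moreover have "ip m (y i) (y j) = (\<Sum>r<m. if r < a then cnj (X r i) * X r j else 0)"
      by (auto simp: ip_def y_def intro!: sum.cong)
    ultimately show ?thesis using gram[OF that] by (simp only: cut[OF m(1)] cut[OF m(2)])
  qed
  then obtain U where U: "isom m m U"
    "\<And>i r. i < n \<Longrightarrow> r < m \<Longrightarrow> mvp m U (x i) r = y i r"
    using unitary_align[of n m x y] by blast
  have "isom b m U" using U(1) m(2) by (auto simp: isom_def)
  moreover have "mvp b U (\<lambda>s. Z s i) r = mvp m U (x i) r" for i r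
  proof -
    have "mvp m U (x i) r = (\<Sum>s<m. if s < b then U r s * Z s i else 0)"
      by (auto simp: mvp_def x_def intro!: sum.cong)
    then show ?thesis by (simp add: cut[OF m(2)] mvp_def)
  qed
  ultimately show ?thesis using U(2) by (intro exI[of _ U]) (simp add: y_def)
qed

section \<open>Spectral theorem for Hermitian matrices\<close>

lemma eigenvector_exists:
  assumes "0 < n"
  obtains w \<mu> where "0 < nsq n w" "\<And>i. i < n \<Longrightarrow> mvp n A w i = \<mu> * w i"
proof -
  define M where "M = mat n n (\<lambda>(i,j). A i j)"
  have M: "M \<in> carrier_mat n n" by (simp add: M_def)
  from spectrum_non_empty[OF M assms] obtain \<mu> where "eigenvalue M \<mu>"
    by (auto simp: spectrum_def)
  then obtain v where v: "v \<in> carrier_vec n" "v \<noteq> 0\<^sub>v n" "M *\<^sub>v v = \<mu> \<cdot>\<^sub>v v"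
    using M by (auto simp: eigenvalue_def eigenvector_def)
  define w where "w = (\<lambda>i. v $ i)"
  have "\<not> (\<forall>i<n. w i = 0)"
  proof
    assume "\<forall>i<n. w i = 0"
    then have "v = 0\<^sub>v n" using v(1) by (intro eq_vecI) (auto simp: w_def)
    then show False using v(2) by simp
  qed
  then have "nsq n w \<noteq> 0" by (simp add: nsq_eq_0)
  then have "0 < nsq n w" using nsq_nonneg[of n w] by linarith
  moreover have "mvp n A w i = \<mu> * w i" if "i < n" for i
  proof -
    have "(M *\<^sub>v v) $ i = mvp n A w i"
      using that v(1) M by (simp add: scalar_prod_def mvp_def w_def M_def lessThan_atLeast0)
    moreover have "(\<mu> \<cdot>\<^sub>v v) $ i = \<mu> * w i" using that v(1) by (simp add: w_def)
    ultimately show ?thesis using v(3) by simp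
  qed
  ultimately show ?thesis by (rule that[of w \<mu>])
qed

lemma herm_ip: "herm n A \<Longrightarrow> ip n u (mvp n A v) = ip n (mvp n A u) v"
proof -
  assume A: "herm n A"
  have "mvp n (adj A) u i = mvp n A u i" if "i < n" for i
    unfolding mvp_def
  proof (intro sum.cong refl)
    fix j assume "j \<in> {..<n}"
    then have "adj A i j = A i j" using A that unfolding adj_def herm_def by (metis lessThan_iff)
    then show "adj A i j * u j = A i j * u j" by simp
  qed
  then show ?thesis unfolding ip_mvp_adj by (intro ip_cong) auto
qed

lemma sum_lessThan_add: "(\<Sum>j<m + d. f j) = (\<Sum>j<m. f j) + (\<Sum>j<d. f (m + j))"
  for f :: "nat \<Rightarrow> 'a::comm_monoid_add"
  by (induct d) (auto simp: add.assoc)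

text \<open>One eigenvector is added at a time: it is an eigenvector of the compression of A to the
  orthogonal complement of those already found, a complement that A preserves because it is
  Hermitian.\<close>

lemma herm_partial_eigenbasis:
  assumes A: "herm n A" and "m \<le> n"
  shows "\<exists>e \<mu>. (\<forall>i<m. \<forall>j<m. ip n (e i) (e j) = of_bool (i = j)) \<and>
     (\<forall>k<m. \<forall>i<n. mvp n A (e k) i = \<mu> k * e k i)"
  using assms(2)
proof (induction m)
  case 0
  then show ?case by simp
next
  case (Suc m)
  then obtain e \<mu> where e: "\<And>i j. i < m \<Longrightarrow> j < m \<Longrightarrow> ip n (e i) (e j) = of_bool (i = j)"
    and ev: "\<And>k i. k < m \<Longrightarrow> i < n \<Longrightarrow> mvp n A (e k) i = \<mu> k * e k i"
    using Suc_leD by blast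
  \<comment> \<open>Aligning standard basis vectors with the \<open>e i\<close> gives a unitary
    whose first \<open>m\<close> columns are the \<open>e i\<close>; its other columns span the
    complement.\<close>
  have "ip n (delta i) (delta j) = ip n (e i) (e j)" if "i < m" "j < m" for i j
    using that Suc.prems e by (simp add: ip_delta)
  then obtain U where U: "isom n n U"
    "\<And>i r. i < m \<Longrightarrow> r < n \<Longrightarrow> mvp n U (delta i) r = e i r"
    using unitary_align[of m n "\<lambda>i. delta i" e] by blast
  define d where "d = n - m"
  have d: "0 < d" "n = m + d" using Suc.prems by (auto simp: d_def)
  define u where "u = (\<lambda>j r. U r j)"
  have ue: "u i r = e i r" if "i < m" "r < n" for i r
    using U(2)[OF that] that Suc.prems by (simp add: mvp_delta u_def)
  have uu: "ip n (u i) (u j) = of_bool (i = j)" if "i < n" "j < n" for i j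
    using U(1) that by (simp add: isom_def ip_def u_def)
  obtain w \<nu> where w: "0 < nsq d w"
    "\<And>i. i < d \<Longrightarrow> mvp d (\<lambda>i j. ip n (u (m + i)) (mvp n A (u (m + j)))) w i = \<nu> * w i"
    by (rule eigenvector_exists[OF d(1)]) blast
  define w' where "w' = (\<lambda>j. if j < m then 0 else w (j - m))"
  define v where "v = mvp n U w'"
  have split: "(\<Sum>j<n. f j) = (\<Sum>j<m. f j) + (\<Sum>j<d. f (m + j))" for f :: "nat \<Rightarrow> complex"
    unfolding d(2) by (rule sum_lessThan_add)
  have nv: "nsq n v = nsq d w"
  proof -
    have "nsq n v = nsq n w'" unfolding v_def by (rule isom_nsq[OF U(1)])
    moreover have "complex_of_real (nsq n w') = complex_of_real (nsq d w)"
      unfolding nsq_def of_real_sum by (subst split) (simp add: w'_def)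
    ultimately show ?thesis by simp
  qed
  have uv: "ip n (u i) v = w' i" if "i < n" for i
  proof -
    have "u i = mvp n U (delta i)" using that by (simp add: mvp_delta u_def)
    then show ?thesis using U(1) that by (simp add: v_def isom_iff ip_delta)
  qed
  have vs: "v r = (\<Sum>j<d. w j * u (m + j) r)" for r
    unfolding v_def mvp_def by (subst split) (simp add: w'_def u_def mult.commute)
  \<comment> \<open>Compares coefficients in the basis \<open>u\<close>: below \<open>m\<close>, A
    is moved onto an eigenvector orthogonal to \<open>v\<close>; from \<open>m\<close> on, this is
    the eigenvalue equation of the compression.\<close>
  have uAv: "ip n (u i) (mvp n A v) = \<nu> * w' i" if "i < n" for i
  proof (cases "i < m")
    case True
    have "ip n (u i) (mvp n A v) = ip n (mvp n A (u i)) v" by (rule herm_ip[OF A])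
    also have "\<dots> = ip n (\<lambda>r. \<mu> i * u i r) v"
    proof (rule ip_cong)
      have "mvp n A (u i) = mvp n A (e i)" by (rule mvp_cong) (simp add: ue True)
      then show "mvp n A (u i) r = \<mu> i * u i r" if "r < n" for r using that True ev ue by simp
    qed simp
    also have "\<dots> = 0" using uv[OF that] True by (simp add: ip_scale_left w'_def)
    finally show ?thesis using True by (simp add: w'_def)
  next
    case False
    define j where "j = i - m"
    have j: "i = m + j" "j < d" using False that by (auto simp: j_def d_def)
    have Av: "mvp n A v r = (\<Sum>k<d. w k * mvp n A (u (m + k)) r)" for r
    proof -
      have "mvp n A v r = (\<Sum>j<n. \<Sum>k<d. w k * (A r j * u (m + k) j))"
        unfolding mvp_def vs sum_distrib_left by (intro sum.cong refl) simp
      also have "\<dots> = (\<Sum>k<d. \<Sum>j<n. w k * (A r j * u (m + k) j))" by (rule sum.swap)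
      finally show ?thesis by (simp add: mvp_def sum_distrib_left)
    qed
    have "ip n (u i) (mvp n A v) = (\<Sum>r<n. \<Sum>k<d. w k * (cnj (u i r) * mvp n A (u (m + k)) r))"
      unfolding ip_def Av sum_distrib_left by (intro sum.cong refl) simp
    also have "\<dots> = (\<Sum>k<d. \<Sum>r<n. w k * (cnj (u i r) * mvp n A (u (m + k)) r))" by (rule sum.swap)
    also have "\<dots> = mvp d (\<lambda>i j. ip n (u (m + i)) (mvp n A (u (m + j)))) w j"
      unfolding ip_def mvp_def[of d] j(1) sum_distrib_right by (intro sum.cong refl) simp
    finally show ?thesis using w(2)[OF j(2)] j by (simp add: w'_def)
  qed
  have Av: "mvp n A v r = \<nu> * v r" if "r < n" for r
  proof -
    define z where "z = (\<lambda>r. mvp n A v r - \<nu> * v r)"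
    have "mvp n (adj U) z i = 0" if "i < n" for i
    proof -
      have "mvp n (adj U) z i = ip n (u i) z" by (simp add: mvp_def adj_def ip_def u_def)
      also have "\<dots> = 0" unfolding z_def ip_diff_right ip_scale_right
        using uAv[OF that] uv[OF that] by simp
      finally show ?thesis .
    qed
    then have "mvp n U (mvp n (adj U) z) r = 0" unfolding mvp_def[of n U] by simp
    then have "z r = 0" unfolding isom_adj_inv[OF U(1) that] .
    then show ?thesis by (simp add: z_def)
  qed
  define c where "c = complex_of_real (1 / sqrt (nsq n v))"
  define e' where "e' = (\<lambda>i. if i < m then e i else (\<lambda>r. c * v r))"
  define \<mu>' where "\<mu>' = (\<lambda>i. if i < m then \<mu> i else \<nu>)"
  have ev0: "ip n (e i) v = 0" if "i < m" for i
  proof -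
    have "ip n (e i) v = ip n (u i) v" by (rule ip_cong) (auto simp: ue that)
    then show ?thesis using uv[of i] that d by (simp add: w'_def)
  qed
  have v0e: "ip n v (e i) = 0" if "i < m" for i
    using ev0[OF that] ip_cnj[of n "e i" v] by simp
  have cvv: "cnj c * (c * ip n v v) = 1"
  proof -
    have "cnj c * (c * ip n v v) = complex_of_real ((1 / sqrt (nsq n v)) * (1 / sqrt (nsq n v)) * nsq n v)"
      unfolding c_def ip_self complex_cnj_complex_of_real of_real_mult by (simp only: mult.assoc)
    also have "(1 / sqrt (nsq n v)) * (1 / sqrt (nsq n v)) * nsq n v = 1"
    proof -
      have "0 < nsq n v" using w(1) nv by simp
      then have "sqrt (nsq n v) \<noteq> 0" "nsq n v = sqrt (nsq n v) * sqrt (nsq n v)" by auto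
      moreover have "(1 / s) * (1 / s) * t = 1" if "s \<noteq> 0" "t = s * s" for s t :: real
        using that by simp
      ultimately show ?thesis by blast
    qed
    finally show ?thesis by simp
  qed
  have "ip n (e' i) (e' j) = of_bool (i = j)" if "i < Suc m" "j < Suc m" for i j
    using that e ev0 v0e cvv unfolding e'_def
    by (cases "i < m"; cases "j < m") (simp_all add: ip_scale_left ip_scale_right)
  moreover have "mvp n A (e' k) i = \<mu>' k * e' k i" if "k < Suc m" "i < n" for k i
  proof (cases "k < m")
    case True
    then show ?thesis using ev that by (simp add: e'_def \<mu>'_def)
  next
    case False
    have "mvp n A (\<lambda>r. c * v r) i = c * mvp n A v i"
      by (simp add: mvp_def sum_distrib_left algebra_simps)
    then show ?thesis using False Av[OF that(2)] by (simp add: e'_def \<mu>'_def)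
  qed
  ultimately show ?case by blast
qed

lemma herm_eigenbasis:
  assumes A: "herm n A"
  obtains E :: "nat \<Rightarrow> nat \<Rightarrow> complex" and \<mu> :: "nat \<Rightarrow> real"
  where "isom n n E" "\<And>k i. k < n \<Longrightarrow> i < n \<Longrightarrow> mvp n A (\<lambda>r. E r k) i = of_real (\<mu> k) * E i k"
proof -
  obtain e \<mu> where e: "\<And>i j. i < n \<Longrightarrow> j < n \<Longrightarrow> ip n (e i) (e j) = of_bool (i = j)"
    and ev: "\<And>k i. k < n \<Longrightarrow> i < n \<Longrightarrow> mvp n A (e k) i = \<mu> k * e k i"
    using herm_partial_eigenbasis[OF A order_refl] by blast
  have real: "\<mu> k = of_real (Re (\<mu> k))" if "k < n" for k
  proof -
    have 1: "ip n (e k) (mvp n A (e k)) = \<mu> k"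
    proof -
      have "ip n (e k) (mvp n A (e k)) = ip n (e k) (\<lambda>i. \<mu> k * e k i)"
        by (intro ip_cong) (auto simp: ev that)
      then show ?thesis using e[OF that that] by (simp add: ip_scale_right)
    qed
    have "cnj (\<mu> k) = ip n (mvp n A (e k)) (e k)" by (metis 1 ip_cnj)
    also have "\<dots> = \<mu> k" using herm_ip[OF A, of "e k" "e k"] 1 by simp
    finally show ?thesis by (simp add: complex_eq_iff)
  qed
  have "isom n n (\<lambda>r k. e k r)" using e by (simp add: isom_def ip_def)
  moreover have "mvp n A (\<lambda>r. e k r) i = of_real (Re (\<mu> k)) * e k i" if "k < n" "i < n" for k i
    using ev[OF that] real[OF that(1)] by simp
  ultimately show ?thesis by (rule that[of "\<lambda>r k. e k r" "\<lambda>k. Re (\<mu> k)"])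
qed

section \<open>Square roots and effects\<close>

definition qf :: "nat \<Rightarrow> (nat \<Rightarrow> nat \<Rightarrow> complex) \<Rightarrow> (nat \<Rightarrow> complex) \<Rightarrow> complex" where
  "qf n M v = ip n v (mvp n M v)"

definition psdf :: "nat \<Rightarrow> (nat \<Rightarrow> nat \<Rightarrow> complex) \<Rightarrow> bool" where
  "psdf n M \<longleftrightarrow> (\<forall>v. Im (qf n M v) = 0 \<and> 0 \<le> Re (qf n M v))"

definition effect :: "nat \<Rightarrow> (nat \<Rightarrow> nat \<Rightarrow> complex) \<Rightarrow> bool" where
  "effect n M \<longleftrightarrow> psdf n M \<and> (\<forall>v. Re (qf n M v) \<le> nsq n v)"

text \<open>Functional calculus: the eigenvectors are the columns of \<open>E\<close>, and
  \<open>f\<close> gives the new eigenvalues.\<close>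

definition spec :: "nat \<Rightarrow> (nat \<Rightarrow> nat \<Rightarrow> complex) \<Rightarrow> (nat \<Rightarrow> real) \<Rightarrow> nat \<Rightarrow> nat \<Rightarrow> complex" where
  "spec n E f = (\<lambda>i j. \<Sum>k<n. E i k * of_real (f k) * cnj (E j k))"

lemma qf_sum: "qf n M v = (\<Sum>i<n. \<Sum>j<n. cnj (v i) * M i j * v j)"
  by (simp add: qf_def ip_def mvp_def sum_distrib_left mult.assoc)

lemma mvp_sum: "mvp n A (\<lambda>i. \<Sum>k\<in>S. f k i) = (\<lambda>i. \<Sum>k\<in>S. mvp n A (f k) i)"
  unfolding mvp_def sum_distrib_left by (subst sum.swap) simp

lemma mvp_scale: "mvp n A (\<lambda>i. c * v i) = (\<lambda>i. c * mvp n A v i)"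
  by (simp add: mvp_def sum_distrib_left mult_ac)

lemma mvp_mat_diff: "mvp n (\<lambda>i j. A i j - B i j) v = (\<lambda>i. mvp n A v i - mvp n B v i)"
  by (simp add: mvp_def sum_subtractf algebra_simps)

lemma isom_adj_left:
  assumes "isom n m U" "i < n"
  shows "mvp m (adj U) (mvp n U v) i = v i"
proof -
  have "ip n (delta i) (mvp m (adj U) (mvp n U v)) = ip m (mvp n (adj (adj U)) (delta i)) (mvp n U v)"
    by (rule ip_mvp_adj)
  also have "adj (adj U) = U" by (simp add: adj_def)
  also have "ip m (mvp n U (delta i)) (mvp n U v) = ip n (delta i) v"
    using assms(1) by (simp add: isom_iff)
  finally show ?thesis using assms(2) by (simp add: ip_delta)
qed

lemma mvp_spec: "mvp n (spec n E f) v = mvp n E (\<lambda>k. of_real (f k) * mvp n (adj E) v k)"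
proof
  fix i
  have "mvp n (spec n E f) v i = (\<Sum>j<n. \<Sum>k<n. E i k * (of_real (f k) * (cnj (E j k) * v j)))"
    by (simp add: mvp_def spec_def sum_distrib_right mult.assoc)
  also have "\<dots> = (\<Sum>k<n. \<Sum>j<n. E i k * (of_real (f k) * (cnj (E j k) * v j)))" by (rule sum.swap)
  also have "\<dots> = mvp n E (\<lambda>k. of_real (f k) * mvp n (adj E) v k) i"
    by (simp add: mvp_def adj_def sum_distrib_left)
  finally show "mvp n (spec n E f) v i = mvp n E (\<lambda>k. of_real (f k) * mvp n (adj E) v k) i" .
qed

lemma qf_spec: "qf n (spec n E f) v = of_real (\<Sum>k<n. f k * (cmod (mvp n (adj E) v k))\<^sup>2)"
proof -
  have "qf n (spec n E f) v = ip n (mvp n (adj E) v) (\<lambda>k. of_real (f k) * mvp n (adj E) v k)"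
    unfolding qf_def mvp_spec by (rule ip_mvp_adj)
  also have "\<dots> = (\<Sum>k<n. of_real (f k) * (mvp n (adj E) v k * cnj (mvp n (adj E) v k)))"
    by (simp add: ip_def mult_ac)
  also have "\<dots> = of_real (\<Sum>k<n. f k * (cmod (mvp n (adj E) v k))\<^sup>2)"
    by (simp add: complex_norm_square[symmetric])
  finally show ?thesis .
qed

lemma herm_spec: "herm n (spec n E f)"
  by (simp add: herm_def spec_def mult_ac)

lemma effect_spec:
  assumes "isom n n E" "\<And>k. k < n \<Longrightarrow> 0 \<le> f k" "\<And>k. k < n \<Longrightarrow> f k \<le> 1"
  shows "effect n (spec n E f)"
proof -
  have "(\<Sum>k<n. f k * (cmod (mvp n (adj E) v k))\<^sup>2) \<le> nsq n v" for v
  proof -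
    have "(\<Sum>k<n. f k * (cmod (mvp n (adj E) v k))\<^sup>2) \<le> nsq n (mvp n (adj E) v)"
      unfolding nsq_def using assms by (intro sum_mono mult_left_le_one_le) auto
    then show ?thesis using isom_nsq[OF isom_adj[OF assms(1)]] by simp
  qed
  then show ?thesis
    using assms by (auto simp: effect_def psdf_def qf_spec intro!: sum_nonneg)
qed

lemma psdf_spec: "(\<And>k. k < n \<Longrightarrow> 0 \<le> f k) \<Longrightarrow> psdf n (spec n E f)"
  by (auto simp: psdf_def qf_spec intro!: sum_nonneg)

lemma eigenbasis_mvp:
  assumes E: "isom n n E"
    and ev: "\<And>k i. k < n \<Longrightarrow> i < n \<Longrightarrow> mvp n A (\<lambda>r. E r k) i = of_real (\<mu> k) * E i k"
    and "i < n"
  shows "mvp n A v i = mvp n (spec n E \<mu>) v i"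
proof -
  define c where "c = mvp n (adj E) v"
  have "mvp n A v i = mvp n A (mvp n E c) i"
    unfolding c_def by (rule fun_cong[OF mvp_cong]) (simp add: isom_adj_inv[OF E])
  also have "mvp n E c = (\<lambda>i. \<Sum>k<n. c k * E i k)" by (simp add: mvp_def mult.commute)
  also have "mvp n A \<dots> i = (\<Sum>k<n. c k * mvp n A (\<lambda>i. E i k) i)"
    by (simp add: mvp_sum mvp_scale)
  also have "\<dots> = mvp n (spec n E \<mu>) v i"
    unfolding mvp_spec mvp_def[of n E] by (intro sum.cong refl) (simp add: ev \<open>i < n\<close> c_def)
  finally show ?thesis .
qed

lemma sqrt_exists:
  assumes A: "herm n A" "psdf n A"
  obtains X where "herm n X" "psdf n X"
    "\<And>i j. i < n \<Longrightarrow> j < n \<Longrightarrow> (\<Sum>k<n. X i k * X k j) = A i j"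
proof -
  obtain E \<mu> where E: "isom n n E"
    and ev: "\<And>k i. k < n \<Longrightarrow> i < n \<Longrightarrow> mvp n A (\<lambda>r. E r k) i = of_real (\<mu> k) * E i k"
    by (rule herm_eigenbasis[OF A(1)]) blast
  have pos: "0 \<le> \<mu> k" if "k < n" for k
  proof -
    have "qf n A (\<lambda>r. E r k) = ip n (\<lambda>r. E r k) (\<lambda>r. of_real (\<mu> k) * E r k)"
      unfolding qf_def by (intro ip_cong) (auto simp: ev that)
    also have "\<dots> = of_real (\<mu> k)"
      using E that unfolding ip_scale_right by (simp add: ip_def isom_def)
    finally show ?thesis using A(2) by (metis psdf_def Re_complex_of_real)
  qed
  define X where "X = spec n E (\<lambda>k. sqrt (\<mu> k))"
  have "(\<Sum>k<n. X i k * X k j) = A i j" if ij: "i < n" "j < n" for i j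
  proof -
    have "(\<Sum>k<n. X i k * X k j) = mvp n X (mvp n X (delta j)) i"
      using ij by (simp add: mvp_delta) (simp add: mvp_def)
    also have "\<dots> = mvp n E (\<lambda>k. of_real (sqrt (\<mu> k)) * mvp n (adj E) (mvp n X (delta j)) k) i"
      unfolding X_def mvp_spec[of n E _ "mvp n _ _"] ..
    also have "\<dots> = mvp n E (\<lambda>k. of_real (\<mu> k) * mvp n (adj E) (delta j) k) i"
    proof (rule fun_cong[OF mvp_cong])
      fix k assume k: "k < n"
      have "mvp n (adj E) (mvp n X (delta j)) k = of_real (sqrt (\<mu> k)) * mvp n (adj E) (delta j) k"
        unfolding X_def mvp_spec isom_adj_left[OF E k] ..
      moreover have "complex_of_real (sqrt (\<mu> k)) * of_real (sqrt (\<mu> k)) = of_real (\<mu> k)"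
        using pos[OF k] by (simp flip: of_real_mult)
      ultimately show "of_real (sqrt (\<mu> k)) * mvp n (adj E) (mvp n X (delta j)) k =
          of_real (\<mu> k) * mvp n (adj E) (delta j) k"
        by (metis mult.assoc)
    qed
    also have "\<dots> = mvp n A (delta j) i"
      unfolding eigenbasis_mvp[OF E ev ij(1), simplified] mvp_spec ..
    finally show ?thesis using ij by (simp add: mvp_delta)
  qed
  then show ?thesis
    using that[of X] pos by (simp add: X_def herm_spec psdf_spec)
qed

text \<open>The trace of a product, evaluated in the eigenbasis of its first factor.\<close>

lemma sum_spec:
  "(\<Sum>i<n. \<Sum>j<n. spec n E f i j * M j i) = (\<Sum>k<n. of_real (f k) * qf n M (\<lambda>r. E r k))"
proof -
  have "(\<Sum>i<n. \<Sum>j<n. spec n E f i j * M j i)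
      = (\<Sum>i<n. \<Sum>j<n. \<Sum>k<n. of_real (f k) * (cnj (E j k) * M j i * E i k))"
    unfolding spec_def sum_distrib_right by (intro sum.cong refl) simp
  also have "\<dots> = (\<Sum>i<n. \<Sum>k<n. \<Sum>j<n. of_real (f k) * (cnj (E j k) * M j i * E i k))"
    by (intro sum.cong[OF refl] sum.swap)
  also have "\<dots> = (\<Sum>k<n. \<Sum>i<n. \<Sum>j<n. of_real (f k) * (cnj (E j k) * M j i * E i k))"
    by (rule sum.swap)
  also have "\<dots> = (\<Sum>k<n. \<Sum>j<n. \<Sum>i<n. of_real (f k) * (cnj (E j k) * M j i * E i k))"
    by (intro sum.cong[OF refl] sum.swap)
  finally show ?thesis by (simp add: qf_sum sum_distrib_left)
qed

lemma frobenius_isom: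
  assumes E: "isom n n E"
  shows "(\<Sum>i<n. \<Sum>j<n. (cmod (M i j))\<^sup>2) = (\<Sum>k<n. nsq n (mvp n M (\<lambda>r. E r k)))"
proof -
  have "(\<Sum>j<n. (cmod (M i j))\<^sup>2) = (\<Sum>k<n. (cmod (mvp n M (\<lambda>r. E r k) i))\<^sup>2)" for i
  proof -
    have "(\<Sum>j<n. (cmod (M i j))\<^sup>2) = nsq n (\<lambda>j. cnj (M i j))" by (simp add: nsq_def)
    also have "\<dots> = nsq n (mvp n (adj E) (\<lambda>j. cnj (M i j)))"
      using isom_nsq[OF isom_adj[OF E]] by simp
    also have "mvp n (adj E) (\<lambda>j. cnj (M i j)) = (\<lambda>k. cnj (mvp n M (\<lambda>r. E r k) i))"
      by (simp add: mvp_def adj_def mult.commute)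
    finally show ?thesis by (simp add: nsq_def)
  qed
  then show ?thesis unfolding nsq_def by (subst sum.swap) simp
qed

text \<open>The Powers--Stoermer inequality; D is the positive spectral projection of X - Y.\<close>
lemma powers_stormer:
  fixes X Y :: "nat \<Rightarrow> nat \<Rightarrow> complex"
  assumes X: "herm n X" "psdf n X" and Y: "herm n Y" "psdf n Y"
  defines "M \<equiv> (\<lambda>i j. (\<Sum>k<n. X i k * X k j) - (\<Sum>k<n. Y i k * Y k j))"
  obtains D where "effect n D"
    "(\<Sum>i<n. \<Sum>j<n. (cmod (X i j - Y i j))\<^sup>2)
       \<le> 2 * Re (\<Sum>i<n. \<Sum>j<n. D i j * M j i) - Re (\<Sum>i<n. M i i)"
proof -
  define \<Delta> where "\<Delta> = (\<lambda>i j. X i j - Y i j)"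
  have "herm n \<Delta>" using X(1) Y(1) unfolding herm_def \<Delta>_def by (metis complex_cnj_diff)
  then obtain E \<mu> where E: "isom n n E"
    and ev: "\<And>k i. k < n \<Longrightarrow> i < n \<Longrightarrow> mvp n \<Delta> (\<lambda>r. E r k) i = of_real (\<mu> k) * E i k"
    by (rule herm_eigenbasis) blast
  \<comment> \<open>The bound to prove has right side tr((2D - 1)(X^2 - Y^2)), and 2D - 1 is the
    sign of X - Y. Eigenvalue 0 may count as positive, as it contributes nothing.\<close>
  define D where "D = spec n E (\<lambda>k. of_bool (0 \<le> \<mu> k))"
  define e where "e = (\<lambda>k r. E r k)"
  have nsqe: "nsq n (e k) = 1" if "k < n" for k
  proof -
    have "ip n (e k) (e k) = 1" using E that by (simp add: isom_def ip_def e_def)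
    then show ?thesis by (simp add: ip_self)
  qed
  have id: "spec n E (\<lambda>k. 1) i j = of_bool (i = j)" if "i < n" "j < n" for i j
    using isom_adj[OF E] that by (simp add: spec_def isom_def adj_def)
  have tr: "(\<Sum>i<n. M i i) = (\<Sum>k<n. qf n M (e k))"
  proof -
    have "(\<Sum>k<n. qf n M (e k)) = (\<Sum>i<n. \<Sum>j<n. spec n E (\<lambda>k. 1) i j * M j i)"
      unfolding sum_spec by (simp add: e_def)
    also have "\<dots> = (\<Sum>i<n. \<Sum>j<n. of_bool (j = i) * M j i)"
      by (intro sum.cong refl) (simp add: id eq_commute)
    also have "\<dots> = (\<Sum>i<n. M i i)"
      by (intro sum.cong refl) (simp add: sum_delta_left del: sum_of_bool_mult_eq)
    finally show ?thesis ..
  qed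
  have trD: "(\<Sum>i<n. \<Sum>j<n. D i j * M j i) = (\<Sum>k<n. of_real (of_bool (0 \<le> \<mu> k)) * qf n M (e k))"
    unfolding D_def sum_spec e_def ..
  \<comment> \<open>In an eigenvector of X - Y the form of X^2 - Y^2 equals
    \<open>\<mu> k * (x + y)\<close>, where \<open>\<mu> k = x - y\<close> with \<open>x\<close> and
    \<open>y\<close> nonnegative; hence \<open>x + y\<close> dominates the absolute value of
    \<open>\<mu> k\<close>.\<close>
  have key: "\<bar>\<mu> k\<bar>\<^sup>2 \<le> (2 * of_bool (0 \<le> \<mu> k) - 1) * Re (qf n M (e k))" if k: "k < n" for k
  proof -
    define x where "x = Re (qf n X (e k))"
    define y where "y = Re (qf n Y (e k))"
    have xy: "0 \<le> x" "0 \<le> y" using X(2) Y(2) by (auto simp: psdf_def x_def y_def)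
    have Ye: "mvp n Y (e k) i = mvp n X (e k) i - of_real (\<mu> k) * e k i" if "i < n" for i
      using ev[OF k that] unfolding \<Delta>_def mvp_mat_diff e_def by (simp add: algebra_simps)
    have qX: "ip n (e k) (mvp n X (e k)) = of_real x"
      using X(2) by (simp add: x_def psdf_def qf_def complex_eq_iff)
    have qX': "ip n (mvp n X (e k)) (e k) = of_real x" using herm_ip[OF X(1)] qX by simp
    have "ip n (e k) (mvp n Y (e k)) = ip n (e k) (\<lambda>i. mvp n X (e k) i - of_real (\<mu> k) * e k i)"
      by (intro ip_cong) (auto simp: Ye)
    also have "\<dots> = of_real (x - \<mu> k)"
      unfolding ip_diff_right ip_scale_right qX ip_self nsqe[OF k] by simp
    finally have yx: "y = x - \<mu> k" by (simp add: y_def qf_def)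
    have "qf n M (e k) = ip n (mvp n X (e k)) (mvp n X (e k)) - ip n (mvp n Y (e k)) (mvp n Y (e k))"
      unfolding qf_def M_def mvp_mat_diff mvp_mat_mult ip_diff_right herm_ip[OF X(1)] herm_ip[OF Y(1)] ..
    also have "ip n (mvp n Y (e k)) (mvp n Y (e k)) =
        ip n (\<lambda>i. mvp n X (e k) i - of_real (\<mu> k) * e k i) (\<lambda>i. mvp n X (e k) i - of_real (\<mu> k) * e k i)"
      by (intro ip_cong) (auto simp: Ye)
    also have "\<dots> = ip n (mvp n X (e k)) (mvp n X (e k)) - of_real (2 * \<mu> k * x - (\<mu> k)\<^sup>2)"
      unfolding ip_diff_right ip_diff_left ip_scale_left ip_scale_right qX qX' ip_self[of n "e k"] nsqe[OF k]
      by (simp add: power2_eq_square algebra_simps)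
    finally have "Re (qf n M (e k)) = 2 * \<mu> k * x - (\<mu> k)\<^sup>2" by simp
    then have *: "Re (qf n M (e k)) = \<mu> k * (x + y)" unfolding yx by (simp add: power2_eq_square algebra_simps)
    show ?thesis
    proof (cases "0 \<le> \<mu> k")
      case True
      then have "\<mu> k * \<mu> k \<le> \<mu> k * (x + y)" using yx xy by (intro mult_left_mono) auto
      then show ?thesis using True * by (simp add: power2_eq_square)
    next
      case False
      then have "\<mu> k * (x + y) \<le> \<mu> k * (- \<mu> k)" using yx xy by (intro mult_left_mono_neg) auto
      then show ?thesis using False * by (simp add: power2_eq_square)
    qed
  qed
  have "(\<Sum>i<n. \<Sum>j<n. (cmod (X i j - Y i j))\<^sup>2) = (\<Sum>k<n. nsq n (mvp n \<Delta> (\<lambda>r. E r k)))"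
    using frobenius_isom[OF E, of \<Delta>] by (simp add: \<Delta>_def)
  also have "\<dots> = (\<Sum>k<n. \<bar>\<mu> k\<bar>\<^sup>2)"
  proof (intro sum.cong refl)
    fix k assume "k \<in> {..<n}"
    then have k: "k < n" by simp
    have "nsq n (mvp n \<Delta> (\<lambda>r. E r k)) = (\<Sum>i<n. \<bar>\<mu> k\<bar>\<^sup>2 * (cmod (e k i))\<^sup>2)"
      unfolding nsq_def by (intro sum.cong refl) (simp add: ev k norm_mult power_mult_distrib e_def)
    also have "\<dots> = \<bar>\<mu> k\<bar>\<^sup>2 * nsq n (e k)" by (simp add: nsq_def sum_distrib_left)
    finally show "nsq n (mvp n \<Delta> (\<lambda>r. E r k)) = \<bar>\<mu> k\<bar>\<^sup>2" by (simp add: nsqe[OF k])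
  qed
  also have "\<dots> \<le> (\<Sum>k<n. (2 * of_bool (0 \<le> \<mu> k) - 1) * Re (qf n M (e k)))"
    by (intro sum_mono key) simp
  also have "\<dots> = 2 * Re (\<Sum>i<n. \<Sum>j<n. D i j * M j i) - Re (\<Sum>i<n. M i i)"
    unfolding tr trD by (simp add: sum_subtractf sum_distrib_left left_diff_distrib mult.assoc
        del: sum_of_bool_mult_eq sum_mult_of_bool_eq)
  finally show ?thesis
    using that[of D] effect_spec[OF E] by (simp add: D_def)
qed

text \<open>Polarisation: a form that is real on e_i + c e_j for c = 1 and c = i forces the two
  off-diagonal entries to be conjugate.\<close>

lemma psdf_herm:
  assumes "psdf n M"
  shows "herm n M"
  unfolding herm_def
proof (intro allI impI)
  fix i j assume ij: "i < n" "j < n"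
  have q: "qf n M (\<lambda>k. of_bool (k = i) + c * of_bool (k = j)) =
     M i i + c * M i j + cnj c * M j i + cnj c * c * M j j" for c
  proof -
    have *: "mvp n M (\<lambda>k. of_bool (k = i) + c * of_bool (k = j)) = (\<lambda>r. M r i + c * M r j)"
    proof -
      have "mvp n M (\<lambda>k. of_bool (k = i) + c * of_bool (k = j)) =
          (\<lambda>r. mvp n M (delta i) r + c * mvp n M (delta j) r)"
        by (simp add: mvp_def sum_distrib_left ring_distribs sum.distrib mult_ac
            del: sum_of_bool_mult_eq sum_mult_of_bool_eq)
      then show ?thesis using ij by (simp add: mvp_delta)
    qed
    have "ip n (\<lambda>k. of_bool (k = i) + c * of_bool (k = j)) v = ip n (delta i) v + cnj c * ip n (delta j) v" for v
      by (simp add: ip_def sum_distrib_left ring_distribs sum.distrib mult_ac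
          del: sum_of_bool_mult_eq sum_mult_of_bool_eq)
    then show ?thesis using ij unfolding qf_def * by (simp add: ip_delta algebra_simps)
  qed
  have q0: "Im (M k k) = 0" if "k < n" for k
    using assms that unfolding psdf_def qf_def by (metis ip_delta mvp_delta)
  have "Im (M i i + 1 * M i j + cnj 1 * M j i + cnj 1 * 1 * M j j) = 0"
    using assms unfolding psdf_def q[symmetric] by blast
  moreover have "Im (M i i + \<i> * M i j + cnj \<i> * M j i + cnj \<i> * \<i> * M j j) = 0"
    using assms unfolding psdf_def q[symmetric] by blast
  ultimately show "M i j = cnj (M j i)" using q0 ij by (simp add: complex_eq_iff)
qed

text \<open>With D = X^2 and X Hermitian, an entry of D is an inner product of two columns of X,
  whose squared norms are diagonal entries of D and so at most 1.\<close>

lemma effect_entry: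
  assumes D: "effect n D" and ij: "i < n" "j < n"
  shows "cmod (D i j) \<le> 1"
proof -
  have h: "herm n D" using D psdf_herm effect_def by blast

  from D have "psdf n D" by (simp add: effect_def)
  from sqrt_exists[OF h this] obtain X where X: "herm n X"
    "\<And>i j. i < n \<Longrightarrow> j < n \<Longrightarrow> (\<Sum>k<n. X i k * X k j) = D i j" by metis
  have col: "nsq n (\<lambda>k. X k j) \<le> 1" if "j < n" for j
  proof -
    have "of_real (nsq n (\<lambda>k. X k j)) = (\<Sum>k<n. cnj (X k j) * X k j)"
      by (simp add: ip_self[symmetric] ip_def)
    also have "\<dots> = (\<Sum>k<n. X j k * X k j)"
    proof (intro sum.cong refl)
      fix k assume "k \<in> {..<n}"
      then have "X j k = cnj (X k j)" using X(1) that unfolding herm_def by blast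
      then show "cnj (X k j) * X k j = X j k * X k j" by simp
    qed
    also have "\<dots> = qf n D (delta j)" using that X(2) by (simp add: qf_def mvp_delta ip_delta)
    finally have "nsq n (\<lambda>k. X k j) = Re (qf n D (delta j))" by (metis Re_complex_of_real)
    also have "\<dots> \<le> nsq n (delta j)" using D by (simp add: effect_def)
    also have "nsq n (delta j) = 1"
    proof -
      have "complex_of_real (nsq n (delta j)) = 1" using that unfolding ip_self[symmetric] by (subst ip_delta) auto
      then show ?thesis by simp
    qed
    finally show ?thesis .
  qed
  have "cmod (D i j) \<le> (\<Sum>k<n. cmod (X i k) * cmod (X k j))"
    unfolding X(2)[OF ij, symmetric] by (rule order_trans[OF norm_sum]) (simp add: norm_mult)
  also have "\<dots> = (\<Sum>k<n. cmod (X k i) * cmod (X k j))"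
  proof (intro sum.cong refl)
    fix k assume "k \<in> {..<n}"
    then have "X i k = cnj (X k i)" using X(1) ij(1) unfolding herm_def by blast
    then show "cmod (X i k) * cmod (X k j) = cmod (X k i) * cmod (X k j)" by simp
  qed
  also have "\<dots> \<le> (\<Sum>k<n. ((cmod (X k i))\<^sup>2 + (cmod (X k j))\<^sup>2) / 2)"
  proof (intro sum_mono)
    fix k
    show "cmod (X k i) * cmod (X k j) \<le> ((cmod (X k i))\<^sup>2 + (cmod (X k j))\<^sup>2) / 2"
      using sum_squares_bound[of "cmod (X k i)" "cmod (X k j)"] by simp
  qed
  also have "\<dots> = (nsq n (\<lambda>k. X k i) + nsq n (\<lambda>k. X k j)) / 2"
    by (simp add: nsq_def sum.distrib sum_divide_distrib[symmetric])
  also have "\<dots> \<le> 1" using col[OF ij(1)] col[OF ij(2)] by simp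
  finally show ?thesis .
qed

text \<open>With w = v - u, the cross terms are bounded by evaluating the nonnegative form at
  \<open>sqrt s\<close> u - w / \<open>sqrt s\<close>. The free weight \<open>s\<close> trades a
  constant loss against the factor on the squared distance.\<close>

lemma effect_perturb:
  assumes M: "effect n M" and s: "0 < s"
  shows "Re (qf n M v) \<le> Re (qf n M u) + s * nsq n u + (1 + 1 / s) * nsq n (\<lambda>i. v i - u i)"
proof -
  define w where "w = (\<lambda>i. v i - u i)"
  have bil: "qf n M (\<lambda>i. a * x i + b * y i) = cnj a * a * qf n M x + cnj b * b * qf n M y
     + (cnj a * b * ip n x (mvp n M y) + cnj b * a * ip n y (mvp n M x))" for a b x y
  proof -
    have 1: "mvp n M (\<lambda>i. a * x i + b * y i) = (\<lambda>i. a * mvp n M x i + b * mvp n M y i)"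
      by (simp add: mvp_def sum_distrib_left ring_distribs sum.distrib mult_ac)
    have 2: "ip n p (\<lambda>i. a * q i + b * r i) = a * ip n p q + b * ip n p r" for p q r
      by (simp add: ip_def sum_distrib_left ring_distribs sum.distrib mult_ac)
    have 3: "ip n (\<lambda>i. a * q i + b * r i) p = cnj a * ip n q p + cnj b * ip n r p" for p q r
      by (simp add: ip_def sum_distrib_left ring_distribs sum.distrib mult_ac)
    show ?thesis unfolding qf_def 1 2 3 by (simp add: algebra_simps)
  qed
  define C where "C = ip n u (mvp n M w) + ip n w (mvp n M u)"
  have "v = (\<lambda>i. 1 * u i + 1 * w i)" by (simp add: w_def)
  then have qv: "qf n M v = qf n M u + qf n M w + C" using bil[of 1 u 1 w] by (simp add: C_def)
  define r where "r = sqrt s"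
  have r: "0 < r" "r * r = s" using s by (auto simp: r_def)
  have "0 \<le> Re (qf n M (\<lambda>i. of_real r * u i + of_real (- (1 / r)) * w i))"
    using M by (simp add: effect_def psdf_def)
  also have "\<dots> = s * Re (qf n M u) + Re (qf n M w) / s - Re C"
    unfolding bil C_def using r by (simp add: field_simps flip: r(2))
  finally have "Re C \<le> s * Re (qf n M u) + Re (qf n M w) / s" by simp
  then have "Re (qf n M v) \<le> Re (qf n M u) + s * Re (qf n M u) + (1 + 1 / s) * Re (qf n M w)"
    using qv by (simp add: algebra_simps)
  moreover have "s * Re (qf n M u) \<le> s * nsq n u" using M s by (simp add: effect_def)
  moreover have "(1 + 1 / s) * Re (qf n M w) \<le> (1 + 1 / s) * nsq n w"
    using M s by (intro mult_left_mono) (auto simp: effect_def)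
  ultimately show ?thesis unfolding w_def by linarith
qed

section \<open>Pretty good measurement, purifications and clusters\<close>

text \<open>Compare X with Y = SXS for the diagonal sign matrix S of the cut \<open>c\<close>. X - Y
  is 2X across the cut and 0 elsewhere, and since S^2 = 1 the difference of squares is 2G across the
  cut and 0 elsewhere, so its trace vanishes. Powers-Stoermer with entries of D bounded by 1 gives
  the claim.\<close>

lemma split_frobenius_bound:
  fixes X :: "nat \<Rightarrow> nat \<Rightarrow> complex" and c :: "nat \<Rightarrow> bool"
  assumes X: "herm n X" "psdf n X"
    and G: "\<And>i j. i < n \<Longrightarrow> j < n \<Longrightarrow> (\<Sum>k<n. X i k * X k j) = G i j"
  shows "(\<Sum>i<n. \<Sum>j<n. of_bool (c i \<noteq> c j) * (cmod (X i j))\<^sup>2)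
       \<le> (\<Sum>i<n. \<Sum>j<n. of_bool (c i \<noteq> c j) * cmod (G i j))"
proof -
  define s :: "nat \<Rightarrow> complex" where "s = (\<lambda>i. if c i then 1 else -1)"
  have ss: "s i * s i = 1" "cnj (s i) = s i" for i by (auto simp: s_def)
  define Y where "Y = (\<lambda>i j. s i * s j * X i j)"
  have "herm n Y" using X(1) unfolding herm_def Y_def by (metis complex_cnj_mult mult.commute ss(2))
  have "qf n Y v = qf n X (\<lambda>i. s i * v i)" for v
    unfolding qf_sum Y_def complex_cnj_mult ss(2) by (intro sum.cong refl) (simp add: mult_ac)
  then have "psdf n Y" using X(2) by (simp add: psdf_def)
  define M where "M = (\<lambda>i j. (\<Sum>k<n. X i k * X k j) - (\<Sum>k<n. Y i k * Y k j))"
  obtain D where D: "effect n D"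
    "(\<Sum>i<n. \<Sum>j<n. (cmod (X i j - Y i j))\<^sup>2)
       \<le> 2 * Re (\<Sum>i<n. \<Sum>j<n. D i j * M j i) - Re (\<Sum>i<n. M i i)"
    unfolding M_def by (rule powers_stormer[OF X \<open>herm n Y\<close> \<open>psdf n Y\<close>]) blast
  have M: "M i j = of_bool (c i \<noteq> c j) * (2 * G i j)" if "i < n" "j < n" for i j
  proof -
    have "(\<Sum>k<n. Y i k * Y k j) = (\<Sum>k<n. s i * s j * ((s k * s k) * (X i k * X k j)))"
      by (simp add: Y_def mult_ac)
    also have "\<dots> = s i * s j * G i j"
      unfolding ss mult_1 sum_distrib_left[symmetric] G[OF that] ..
    finally show ?thesis using G[OF that] by (simp add: M_def s_def)
  qed
  have XY: "(cmod (X i j - Y i j))\<^sup>2 = 4 * (of_bool (c i \<noteq> c j) * (cmod (X i j))\<^sup>2)" for i j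
  proof (cases "c i = c j")
    case True
    then have "Y i j = X i j" by (simp add: Y_def s_def)
    then show ?thesis using True by simp
  next
    case False
    then have "X i j - Y i j = 2 * X i j" by (auto simp: Y_def s_def)
    then show ?thesis using False by (simp only:) (simp add: norm_mult power_mult_distrib)
  qed
  have "4 * (\<Sum>i<n. \<Sum>j<n. of_bool (c i \<noteq> c j) * (cmod (X i j))\<^sup>2)
      = (\<Sum>i<n. \<Sum>j<n. (cmod (X i j - Y i j))\<^sup>2)"
    unfolding XY by (simp only: sum_distrib_left)
  also have "\<dots> \<le> 2 * Re (\<Sum>i<n. \<Sum>j<n. D i j * M j i) - Re (\<Sum>i<n. M i i)" by (rule D(2))
  also have "(\<Sum>i<n. M i i) = 0" by (intro sum.neutral) (simp add: M)
  also have "2 * Re (\<Sum>i<n. \<Sum>j<n. D i j * M j i) - Re 0 \<le> 2 * (\<Sum>i<n. \<Sum>j<n. cmod (D i j * M j i))"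
  proof -
    have "Re (\<Sum>i<n. \<Sum>j<n. D i j * M j i) \<le> cmod (\<Sum>i<n. \<Sum>j<n. D i j * M j i)"
      by (rule complex_Re_le_cmod)
    also have "\<dots> \<le> (\<Sum>i<n. cmod (\<Sum>j<n. D i j * M j i))" by (rule norm_sum)
    also have "\<dots> \<le> (\<Sum>i<n. \<Sum>j<n. cmod (D i j * M j i))" by (intro sum_mono norm_sum)
    finally show ?thesis by simp
  qed
  also have "(\<Sum>i<n. \<Sum>j<n. cmod (D i j * M j i)) \<le> (\<Sum>i<n. \<Sum>j<n. 2 * (of_bool (c j \<noteq> c i) * cmod (G j i)))"
  proof (intro sum_mono)
    fix i j assume "i \<in> {..<n}" "j \<in> {..<n}"
    then have ij: "i < n" "j < n" by auto
    have "cmod (D i j * M j i) \<le> 1 * cmod (M j i)"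
      unfolding norm_mult by (intro mult_right_mono effect_entry[OF D(1) ij]) simp
    then show "cmod (D i j * M j i) \<le> 2 * (of_bool (c j \<noteq> c i) * cmod (G j i))"
      by (cases "c j = c i") (simp_all add: M ij norm_mult)
  qed
  also have "\<dots> = 2 * (\<Sum>i<n. \<Sum>j<n. of_bool (c i \<noteq> c j) * cmod (G i j))"
    by (subst sum.swap) (simp only: sum_distrib_left)
  finally show ?thesis by simp
qed

text \<open>A pair with different labels is separated by exactly two of the cuts "label is l",
  namely those of its own two labels.\<close>

lemma sum_label_split:
  fixes f :: "nat \<Rightarrow> nat \<Rightarrow> real"
  shows "(\<Sum>l\<in>lab ` {..<n}. \<Sum>i<n. \<Sum>j<n. of_bool ((lab i = l) \<noteq> (lab j = l)) * f i j)
     = 2 * (\<Sum>i<n. \<Sum>j<n. of_bool (lab i \<noteq> lab j) * f i j)"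
proof -
  have *: "(\<Sum>l\<in>lab ` {..<n}. of_bool ((lab i = l) \<noteq> (lab j = l)) :: real) = 2 * of_bool (lab i \<noteq> lab j)"
    if "i < n" "j < n" for i j
  proof -
    have "(\<Sum>l\<in>lab ` {..<n}. of_bool ((lab i = l) \<noteq> (lab j = l)) :: real)
        = real (card {l \<in> lab ` {..<n}. (lab i = l) \<noteq> (lab j = l)})"
      by (simp add: Int_def)
    also have "{l \<in> lab ` {..<n}. (lab i = l) \<noteq> (lab j = l)} = (if lab i = lab j then {} else {lab i, lab j})"
      using that by auto
    finally show ?thesis by auto
  qed
  have "(\<Sum>l\<in>lab ` {..<n}. \<Sum>i<n. \<Sum>j<n. of_bool ((lab i = l) \<noteq> (lab j = l)) * f i j)
      = (\<Sum>i<n. \<Sum>l\<in>lab ` {..<n}. \<Sum>j<n. of_bool ((lab i = l) \<noteq> (lab j = l)) * f i j)"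
    by (rule sum.swap)
  also have "\<dots> = (\<Sum>i<n. \<Sum>j<n. \<Sum>l\<in>lab ` {..<n}. of_bool ((lab i = l) \<noteq> (lab j = l)) * f i j)"
    by (intro sum.cong[OF refl] sum.swap)
  also have "\<dots> = (\<Sum>i<n. \<Sum>j<n. 2 * (of_bool (lab i \<noteq> lab j) * f i j))"
    unfolding sum_distrib_right[symmetric] by (intro sum.cong refl) (simp only: * lessThan_iff mult.assoc)
  finally show ?thesis by (simp only: sum_distrib_left)
qed

text \<open>The entries of the square root X of a Gram matrix G are the amplitudes of the
  pretty good measurement.\<close>
lemma label_frobenius_bound:
  fixes X :: "nat \<Rightarrow> nat \<Rightarrow> complex"
  assumes X: "herm n X" "psdf n X"
    and G: "\<And>i j. i < n \<Longrightarrow> j < n \<Longrightarrow> (\<Sum>k<n. X i k * X k j) = G i j"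
  shows "(\<Sum>i<n. \<Sum>j<n. of_bool (lab i \<noteq> lab j) * (cmod (X i j))\<^sup>2)
       \<le> (\<Sum>i<n. \<Sum>j<n. of_bool (lab i \<noteq> lab j) * cmod (G i j))"
proof -
  \<comment> \<open>The two-block bound is summed over all cuts "label is l"; the resulting factor 2
    appears on both sides and cancels, so the number of clusters does not enter.\<close>
  have "(\<Sum>l\<in>lab ` {..<n}. \<Sum>i<n. \<Sum>j<n. of_bool ((lab i = l) \<noteq> (lab j = l)) * (cmod (X i j))\<^sup>2)
     \<le> (\<Sum>l\<in>lab ` {..<n}. \<Sum>i<n. \<Sum>j<n. of_bool ((lab i = l) \<noteq> (lab j = l)) * cmod (G i j))"
    by (intro sum_mono split_frobenius_bound[OF X G])
  then show ?thesis unfolding sum_label_split by simp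
qed

lemma gram_qf: "qf n (\<lambda>i j. \<Sum>r<a. cnj (X r i) * X r j) c = of_real (nsq a (mvp n X c))"
proof -
  have "of_real (nsq a (mvp n X c)) = ip n c (mvp a (adj X) (mvp n X c))"
    unfolding ip_self[symmetric] using ip_cnj ip_mvp_adj by metis
  also have "mvp a (adj X) (mvp n X c) = mvp n (\<lambda>i j. \<Sum>r<a. cnj (X r i) * X r j) c"
    unfolding mvp_mat_mult[symmetric] adj_def ..
  finally show ?thesis by (simp add: qf_def)
qed

lemma gram_psdf: "psdf n (\<lambda>i j. \<Sum>r<a. cnj (X r i) * X r j)"
  for X :: "nat \<Rightarrow> nat \<Rightarrow> complex"
  by (simp add: psdf_def gram_qf)

lemma gram_herm: "herm n (\<lambda>i j. \<Sum>r<a. cnj (X r i) * X r j)"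
  by (simp add: herm_def mult.commute)

text \<open>The two product formulas serve different ends: the square \<open>Z Z\<close> feeds
  Powers-Stoermer, and the Gram form says that the columns of Z have the Gram matrix that
  \<open>isometry_align\<close> requires.\<close>

lemma gram_sqrt:
  fixes X :: "nat \<Rightarrow> nat \<Rightarrow> complex"
  shows "\<exists>Z. herm n Z \<and> psdf n Z \<and>
    (\<forall>i<n. \<forall>j<n. (\<Sum>k<n. Z i k * Z k j) = (\<Sum>r<a. cnj (X r i) * X r j) \<and>
      (\<Sum>k<n. cnj (Z k i) * Z k j) = (\<Sum>r<a. cnj (X r i) * X r j))"
proof -
  obtain Z where Z: "herm n Z" "psdf n Z"
    "\<And>i j. i < n \<Longrightarrow> j < n \<Longrightarrow> (\<Sum>k<n. Z i k * Z k j) = (\<Sum>r<a. cnj (X r i) * X r j)"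
    using sqrt_exists[OF gram_herm[of n X a] gram_psdf[of n X a]] by metis
  have "(\<Sum>k<n. cnj (Z k i) * Z k j) = (\<Sum>k<n. Z i k * Z k j)" if "i < n" for i j
  proof (intro sum.cong refl)
    fix k assume "k \<in> {..<n}"
    then have "Z i k = cnj (Z k i)" using Z(1) that unfolding herm_def by blast
    then show "cnj (Z k i) * Z k j = Z i k * Z k j" by simp
  qed
  then show ?thesis using Z by (intro exI[of _ Z]) simp
qed

text \<open>The states and the columns of the root X of their Gram matrix have the same Gram matrix,
  so an isometry maps state k to column k. As X is Hermitian, its rows are normalised like its
  columns, which makes the guess uniform when k is uniform. Overlaps enter the error to the first
  power only.\<close>

lemma pretty_good_measurement:
  fixes v :: "nat \<Rightarrow> nat \<Rightarrow> complex"
  assumes unit: "\<And>k. k < N \<Longrightarrow> nsq d (v k) = 1" and m: "N \<le> m" "d \<le> m"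
  obtains U where "isom d m U"
    "\<And>k r. k < N \<Longrightarrow> N \<le> r \<Longrightarrow> r < m \<Longrightarrow> mvp d U (v k) r = 0"
    "\<And>r. r < N \<Longrightarrow> (\<Sum>k<N. (cmod (mvp d U (v k) r))\<^sup>2) = 1"
    "(\<Sum>k<N. \<Sum>r<N. of_bool (lab k \<noteq> lab r) * (cmod (mvp d U (v k) r))\<^sup>2)
       \<le> (\<Sum>k<N. \<Sum>r<N. of_bool (lab k \<noteq> lab r) * cmod (ip d (v k) (v r)))"
proof -
  define V where "V = (\<lambda>i k. v k i)"
  have ipV: "(\<Sum>r<d. cnj (V r i) * V r j) = ip d (v i) (v j)" for i j by (simp add: V_def ip_def)
  obtain X where X: "herm N X" "psdf N X"
    "\<And>i j. i < N \<Longrightarrow> j < N \<Longrightarrow> (\<Sum>k<N. X i k * X k j) = ip d (v i) (v j)"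
    "\<And>i j. i < N \<Longrightarrow> j < N \<Longrightarrow> (\<Sum>k<N. cnj (X k i) * X k j) = ip d (v i) (v j)"
    using gram_sqrt[of N V d] unfolding ipV by blast
  have X4: "(\<Sum>k<N. cnj (X k i) * X k j) = (\<Sum>r<d. cnj (V r i) * V r j)" if "i < N" "j < N" for i j
    unfolding X(4)[OF that] ipV ..
  obtain U where U: "isom d m U"
    "\<And>i r. i < N \<Longrightarrow> r < m \<Longrightarrow> mvp d U (\<lambda>s. V s i) r = (if r < N then X r i else 0)"
    using isometry_align[where n=N and a=N and X=X and b=d and Z=V and m=m, OF X4 m] by blast
  have U': "mvp d U (v k) r = (if r < N then X r k else 0)" if "k < N" "r < m" for k r
    using U(2)[OF that] by (simp add: V_def)
  have abs: "cmod (X r k) = cmod (X k r)" if "r < N" "k < N" for r k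
    using X(1) that unfolding herm_def by (metis complex_mod_cnj)
  have row: "(\<Sum>k<N. (cmod (mvp d U (v k) r))\<^sup>2) = 1" if r: "r < N" for r
  proof -
    have "(\<Sum>k<N. (cmod (mvp d U (v k) r))\<^sup>2) = nsq N (\<lambda>k. X k r)"
      unfolding nsq_def using r m by (intro sum.cong refl) (simp add: U' abs)
    moreover have "complex_of_real (nsq N (\<lambda>k. X k r)) = ip d (v r) (v r)"
      unfolding X(4)[OF r r, symmetric] ip_self[symmetric] by (simp add: ip_def)
    ultimately show ?thesis using unit[OF r] by (simp add: ip_self)
  qed
  have "(\<Sum>k<N. \<Sum>r<N. of_bool (lab k \<noteq> lab r) * (cmod (mvp d U (v k) r))\<^sup>2)
      = (\<Sum>k<N. \<Sum>r<N. of_bool (lab k \<noteq> lab r) * (cmod (X k r))\<^sup>2)"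
    using m by (intro sum.cong refl) (simp add: U' abs)
  also have "\<dots> \<le> (\<Sum>k<N. \<Sum>r<N. of_bool (lab k \<noteq> lab r) * cmod (ip d (v k) (v r)))"
    by (rule label_frobenius_bound[OF X(1,2,3)])
  finally show ?thesis using that[OF U(1) _ row] U' m by simp
qed

text \<open>A form of Uhlmann's theorem: the square roots Z of the two Gram matrices are canonical
  purifications, mapped to the given ones by isometries W, and their distance is bounded by the bias
  of a two-outcome measurement D.\<close>
lemma canonical_purifications:
  fixes X :: "bool \<Rightarrow> nat \<Rightarrow> nat \<Rightarrow> complex"
  assumes norm: "\<And>b. (\<Sum>c<n. \<Sum>r<a. (cmod (X b r c))\<^sup>2) = 1" and m: "a \<le> m" "n \<le> m"
  obtains Z W :: "bool \<Rightarrow> nat \<Rightarrow> nat \<Rightarrow> complex" and D where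
    "\<And>b. isom n m (W b)"
    "\<And>b c r. c < n \<Longrightarrow> r < m \<Longrightarrow> mvp n (W b) (\<lambda>s. Z b s c) r = (if r < a then X b r c else 0)"
    "\<And>b. (\<Sum>c<n. \<Sum>s<n. (cmod (Z b s c))\<^sup>2) = 1"
    "effect n D"
    "(\<Sum>c<n. \<Sum>s<n. (cmod (Z False s c - Z True s c))\<^sup>2)
       \<le> 2 * (Re (\<Sum>r<a. qf n D (\<lambda>c. cnj (X False r c))) - Re (\<Sum>r<a. qf n D (\<lambda>c. cnj (X True r c))))"
proof -
  define R where "R = (\<lambda>b i j. \<Sum>r<a. cnj (X b r i) * X b r j)"
  have "\<exists>Z. herm n Z \<and> psdf n Z \<and> (\<forall>i<n. \<forall>j<n. (\<Sum>k<n. Z i k * Z k j) = R b i j \<and>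
      (\<Sum>k<n. cnj (Z k i) * Z k j) = R b i j)" for b
    unfolding R_def by (rule gram_sqrt)
  then have "\<exists>Z. \<forall>b. herm n (Z b) \<and> psdf n (Z b) \<and> (\<forall>i<n. \<forall>j<n. (\<Sum>k<n. Z b i k * Z b k j) = R b i j \<and>
      (\<Sum>k<n. cnj (Z b k i) * Z b k j) = R b i j)"
    by (intro choice allI)
  then obtain Z where Z: "\<And>b. herm n (Z b)" "\<And>b. psdf n (Z b)"
    "\<And>b i j. i < n \<Longrightarrow> j < n \<Longrightarrow> (\<Sum>k<n. Z b i k * Z b k j) = R b i j"
    "\<And>b i j. i < n \<Longrightarrow> j < n \<Longrightarrow> (\<Sum>k<n. cnj (Z b k i) * Z b k j) = R b i j" by blast
  have "\<exists>W. isom n m W \<and> (\<forall>c<n. \<forall>r<m. mvp n W (\<lambda>s. Z b s c) r = (if r < a then X b r c else 0))" for b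
  proof -
    have "(\<Sum>r<a. cnj (X b r i) * X b r j) = (\<Sum>k<n. cnj (Z b k i) * Z b k j)" if "i < n" "j < n" for i j
      using Z(4)[OF that, where b=b] by (simp add: R_def)
    then show ?thesis by (rule isometry_align[OF _ m])
  qed
  then have "\<exists>W. \<forall>b. isom n m (W b) \<and>
      (\<forall>c<n. \<forall>r<m. mvp n (W b) (\<lambda>s. Z b s c) r = (if r < a then X b r c else 0))"
    by (intro choice allI)
  then obtain W where W: "\<And>b. isom n m (W b)"
    "\<And>b c r. c < n \<Longrightarrow> r < m \<Longrightarrow> mvp n (W b) (\<lambda>s. Z b s c) r = (if r < a then X b r c else 0)" by blast
  have trR: "R b c c = of_real (\<Sum>r<a. (cmod (X b r c))\<^sup>2)" for b c
    by (simp add: R_def complex_norm_square mult.commute del: of_real_power)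
  have Znorm: "(\<Sum>c<n. \<Sum>s<n. (cmod (Z b s c))\<^sup>2) = 1" for b
  proof -
    have "(\<Sum>s<n. (cmod (Z b s c))\<^sup>2) = (\<Sum>r<a. (cmod (X b r c))\<^sup>2)" if "c < n" for c
    proof -
      have "complex_of_real (\<Sum>s<n. (cmod (Z b s c))\<^sup>2) = R b c c"
        using Z(4)[OF that that, where b=b]
        by (simp add: complex_norm_square mult.commute del: of_real_power)
      then show ?thesis unfolding trR of_real_eq_iff .
    qed
    then show ?thesis using norm[of b] by simp
  qed
  define M where "M = (\<lambda>i j. (\<Sum>k<n. Z False i k * Z False k j) - (\<Sum>k<n. Z True i k * Z True k j))"
  have M: "M i j = R False i j - R True i j" if "i < n" "j < n" for i j
    using that by (simp add: M_def Z(3))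
  obtain D where D: "effect n D"
    "(\<Sum>i<n. \<Sum>j<n. (cmod (Z False i j - Z True i j))\<^sup>2)
       \<le> 2 * Re (\<Sum>i<n. \<Sum>j<n. D i j * M j i) - Re (\<Sum>i<n. M i i)"
    unfolding M_def by (rule powers_stormer[OF Z(1,2) Z(1,2)]) blast
  \<comment> \<open>Both reduced states have trace 1, so the trace term of Powers-Stoermer
    disappears and only the advantage of \<open>D\<close> remains.\<close>
  have "(\<Sum>i<n. M i i) = (\<Sum>i<n. R False i i) - (\<Sum>i<n. R True i i)"
    by (simp add: M sum_subtractf)
  also have "\<dots> = 0" unfolding trR of_real_sum[symmetric] norm by simp
  finally have tr0: "(\<Sum>i<n. M i i) = 0" .
  have RD: "(\<Sum>i<n. \<Sum>j<n. D i j * R b j i) = (\<Sum>r<a. qf n D (\<lambda>c. cnj (X b r c)))" for b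
  proof -
    have "(\<Sum>i<n. \<Sum>j<n. D i j * R b j i) = (\<Sum>i<n. \<Sum>j<n. \<Sum>r<a. X b r i * D i j * cnj (X b r j))"
      by (simp add: R_def sum_distrib_left mult_ac)
    also have "\<dots> = (\<Sum>i<n. \<Sum>r<a. \<Sum>j<n. X b r i * D i j * cnj (X b r j))"
      by (intro sum.cong[OF refl] sum.swap)
    also have "\<dots> = (\<Sum>r<a. \<Sum>i<n. \<Sum>j<n. X b r i * D i j * cnj (X b r j))"
      by (rule sum.swap)
    finally show ?thesis by (simp add: qf_sum)
  qed
  have "(\<Sum>i<n. \<Sum>j<n. D i j * M j i) = (\<Sum>i<n. \<Sum>j<n. D i j * R False j i) - (\<Sum>i<n. \<Sum>j<n. D i j * R True j i)"
    by (simp add: M sum_subtractf right_diff_distrib)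
  then have MD: "Re (\<Sum>i<n. \<Sum>j<n. D i j * M j i) = Re (\<Sum>r<a. qf n D (\<lambda>c. cnj (X False r c)))
      - Re (\<Sum>r<a. qf n D (\<lambda>c. cnj (X True r c)))" unfolding RD by simp
  have "(\<Sum>c<n. \<Sum>s<n. (cmod (Z False s c - Z True s c))\<^sup>2) = (\<Sum>i<n. \<Sum>j<n. (cmod (Z False i j - Z True i j))\<^sup>2)"
    by (rule sum.swap)
  also note D(2)
  finally show ?thesis
    using that[OF W Znorm D(1)] unfolding tr0 MD by simp
qed

text \<open>Ball growing: grow a ball around a point until its next shell is relatively small,
  turn the ball into a cluster, discard the shell, and continue with the rest.\<close>
lemma ball_growing:
  fixes dist :: "'k \<Rightarrow> 'k \<Rightarrow> real"
  assumes "finite K"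
    and refl: "\<And>x. x \<in> K \<Longrightarrow> dist x x = 0"
    and sym: "\<And>x y. x \<in> K \<Longrightarrow> y \<in> K \<Longrightarrow> dist x y = dist y x"
    and tri: "\<And>x y z. x \<in> K \<Longrightarrow> y \<in> K \<Longrightarrow> z \<in> K \<Longrightarrow> dist x z \<le> dist x y + dist y z"
    and \<epsilon>: "0 < \<epsilon>" and \<theta>: "0 < \<theta>" and I: "real (card K) < (1 + \<epsilon>) ^ I"
  shows "\<exists>A lab. A \<subseteq> K \<and> lab ` A \<subseteq> K \<and> real (card (K - A)) \<le> \<epsilon> * real (card K) \<and>
     (\<forall>x\<in>A. \<forall>y\<in>A. if lab x = lab y then dist x y \<le> 2 * real I * \<theta> else \<theta> \<le> dist x y)"
  using assms(1-4) I
proof (induction "card K" arbitrary: K rule: less_induct)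
  case less
  show ?case
  proof (cases "K = {}")
    case True
    then show ?thesis by auto
  next
    case False
    then obtain v where v: "v \<in> K" by auto
    define B where "B = (\<lambda>i::nat. {x \<in> K. dist v x \<le> real i * \<theta>})"
    have finB: "finite (B i)" for i using less.prems(1) by (simp add: B_def)
    have vB: "v \<in> B i" for i using v less.prems(2) \<theta> by (simp add: B_def)
    \<comment> \<open>Otherwise all \<open>I\<close> shells multiply the ball, which starts with at
      least its centre, by more than 1 + \<open>\<epsilon>\<close>, and the last ball has at least
      (1 + \<open>\<epsilon>\<close>)^\<open>I\<close> points, more than \<open>K\<close>.\<close>
    have "\<exists>i<I. real (card (B (Suc i))) \<le> (1 + \<epsilon>) * real (card (B i))"
    proof (rule ccontr)
      assume "\<not> ?thesis"
      then have gr: "(1 + \<epsilon>) * real (card (B i)) \<le> real (card (B (Suc i)))" if "i < I" for i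
        using that by (meson linear)
      have "(1 + \<epsilon>) ^ i \<le> real (card (B i))" if "i \<le> I" for i
        using that
      proof (induction i)
        case 0
        have "card (B 0) \<noteq> 0" using vB[of 0] finB[of 0] by auto
        then show ?case by simp
      next
        case (Suc i)
        have "(1 + \<epsilon>) * (1 + \<epsilon>) ^ i \<le> (1 + \<epsilon>) * real (card (B i))"
          using Suc \<epsilon> by (intro mult_left_mono) auto
        then show ?case using gr[of i] Suc by simp
      qed
      moreover have "card (B I) \<le> card K" using less.prems(1) by (intro card_mono) (auto simp: B_def)
      ultimately show False using less.prems(5) by (meson leD le_refl of_nat_mono order_trans)
    qed
    then obtain i where i: "i < I" "real (card (B (Suc i))) \<le> (1 + \<epsilon>) * real (card (B i))" by auto
    have sub: "B i \<subseteq> B (Suc i)" "B (Suc i) \<subseteq> K" 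
    proof -
      have "real i * \<theta> \<le> real (Suc i) * \<theta>" using \<theta> by (intro mult_right_mono) auto
      then show "B i \<subseteq> B (Suc i)" by (auto simp: B_def)
      show "B (Suc i) \<subseteq> K" by (auto simp: B_def)
    qed
    define K' where "K' = K - B (Suc i)"
    have K': "K' \<subseteq> K" "v \<notin> K'" using vB by (auto simp: K'_def)
    have card': "card K' < card K"
      using K' v less.prems(1) by (intro psubset_card_mono) auto
    have "\<exists>A lab. A \<subseteq> K' \<and> lab ` A \<subseteq> K' \<and> real (card (K' - A)) \<le> \<epsilon> * real (card K') \<and>
     (\<forall>x\<in>A. \<forall>y\<in>A. if lab x = lab y then dist x y \<le> 2 * real I * \<theta> else \<theta> \<le> dist x y)"
    proof (rule less.hyps[OF card'])
      show "finite K'" using less.prems(1) K'(1) finite_subset by blast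
      show "real (card K') < (1 + \<epsilon>) ^ I" using card' less.prems(5) by simp
    qed (use less.prems(2-4) K'(1) in \<open>auto simp: subset_iff\<close>)
    then obtain A' lab' where A': "A' \<subseteq> K'" "lab' ` A' \<subseteq> K'" "real (card (K' - A')) \<le> \<epsilon> * real (card K')"
     "\<And>x y. x \<in> A' \<Longrightarrow> y \<in> A' \<Longrightarrow> if lab' x = lab' y then dist x y \<le> 2 * real I * \<theta> else \<theta> \<le> dist x y"
      by blast
    define A where "A = B i \<union> A'"
    \<comment> \<open>The ball is labelled by its centre. The claim that labels lie in the set
      itself is carried through the induction so that later labels, lying in \<open>K'\<close>,
      differ from \<open>v\<close>.\<close>
    define lab where "lab = (\<lambda>x. if x \<in> B i then v else lab' x)"
    have disj: "x \<notin> B i" if "x \<in> A'" for x using that A'(1) sub by (auto simp: K'_def)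
    have far: "\<theta> \<le> dist x y" if "x \<in> B i" "y \<in> A'" for x y
    proof -
      have y: "y \<in> K" "real (Suc i) * \<theta> < dist v y" using that A'(1) by (auto simp: K'_def B_def)
      have x: "x \<in> K" "dist v x \<le> real i * \<theta>" using that by (auto simp: B_def)
      have "dist v y \<le> dist v x + dist x y" using less.prems(4) v x y by blast
      then show ?thesis using x y by (simp add: algebra_simps)
    qed
    have near: "dist x y \<le> 2 * real I * \<theta>" if "x \<in> B i" "y \<in> B i" for x y
    proof -
      have xy: "x \<in> K" "y \<in> K" "dist v x \<le> real i * \<theta>" "dist v y \<le> real i * \<theta>"
        using that by (auto simp: B_def)
      have "dist x y \<le> dist x v + dist v y" using less.prems(4) v xy by blast
      also have "dist x v = dist v x" using less.prems(3) v xy by blast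
      finally have "dist x y \<le> 2 * (real i * \<theta>)" using xy by simp
      also have "real i * \<theta> \<le> real I * \<theta>" using i \<theta> by (intro mult_right_mono) auto
      finally show ?thesis by simp
    qed
    have "K - A = (B (Suc i) - B i) \<union> (K' - A')"
      using sub A'(1) by (auto simp: A_def K'_def)
    then have "card (K - A) \<le> card (B (Suc i) - B i) + card (K' - A')" by (simp add: card_Un_le)
    moreover have "real (card (B (Suc i) - B i)) \<le> \<epsilon> * real (card (B i))"
      using i(2) finB sub card_mono[OF finB sub(1)] by (simp add: card_Diff_subset algebra_simps of_nat_diff)
    \<comment> \<open>The discarded shell is charged to the ball \<open>B i\<close>, which is
      disjoint from the rest \<open>K'\<close>, so the charges of all rounds add up to at most a
      fraction \<open>\<epsilon>\<close> of \<open>K\<close>.\<close>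
    moreover have "\<epsilon> * real (card (B i)) + \<epsilon> * real (card K') \<le> \<epsilon> * real (card K)"
    proof -
      have "card (B i) \<le> card (B (Suc i))" by (rule card_mono[OF finB sub(1)])
      moreover have "card K' = card K - card (B (Suc i))" unfolding K'_def by (rule card_Diff_subset[OF finB sub(2)])
      moreover have "card (B (Suc i)) \<le> card K" by (rule card_mono[OF less.prems(1) sub(2)])
      ultimately have "real (card (B i)) + real (card K') \<le> real (card K)" by linarith
      then show ?thesis using \<epsilon> by (simp add: distrib_left[symmetric])
    qed
    ultimately have "real (card (K - A)) \<le> \<epsilon> * real (card K)" using A'(3) by linarith
    moreover have "A \<subseteq> K" using sub A'(1) K'(1) by (auto simp: A_def)
    moreover have "lab ` A \<subseteq> K" using A'(1,2) K'(1) v by (auto simp: A_def lab_def)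
    moreover have "if lab x = lab y then dist x y \<le> 2 * real I * \<theta> else \<theta> \<le> dist x y"
      if xy: "x \<in> A" "y \<in> A" for x y
    proof -
      have l': "lab' x \<noteq> v" if "x \<in> A'" for x using that A'(2) K'(2) by blast
      consider "x \<in> B i" "y \<in> B i" | "x \<in> B i" "y \<in> A'" | "x \<in> A'" "y \<in> B i" | "x \<in> A'" "y \<in> A'"
        using xy by (auto simp: A_def)
      then show ?thesis
      proof cases
        case 1 then show ?thesis using near by (simp add: lab_def)
      next
        case 2 then show ?thesis using far disj l' by (metis lab_def)
      next
        case 3
        then have "dist x y = dist y x" using less.prems(3) xy \<open>A \<subseteq> K\<close> by blast
        then show ?thesis using 3 far disj l' by (metis lab_def)
      next
        case 4 then show ?thesis using A'(4) disj by (simp add: lab_def)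
      qed
    qed
    ultimately show ?thesis by blast
  qed
qed

section \<open>Phase-invariant distance of pure states: the Frobenius distance of their
  projectors\<close>

definition pdist :: "nat \<Rightarrow> (nat \<Rightarrow> complex) \<Rightarrow> (nat \<Rightarrow> complex) \<Rightarrow> real" where
  "pdist n u v = L2_set (\<lambda>(i,j). cmod (u i * cnj (u j) - v i * cnj (v j))) ({..<n} \<times> {..<n})"

lemma pdist_refl: "pdist n u u = 0"
  by (simp add: pdist_def L2_set_def case_prod_beta)

lemma pdist_sym: "pdist n u v = pdist n v u"
  by (simp add: pdist_def norm_minus_commute)

lemma pdist_triangle: "pdist n u w \<le> pdist n u v + pdist n v w"
proof -
  have "pdist n u w \<le> L2_set (\<lambda>p. (case p of (i,j) \<Rightarrow> cmod (u i * cnj (u j) - v i * cnj (v j)))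
      + (case p of (i,j) \<Rightarrow> cmod (v i * cnj (v j) - w i * cnj (w j)))) ({..<n} \<times> {..<n})"
    unfolding pdist_def
  proof (intro L2_set_mono)
    fix p assume "p \<in> {..<n} \<times> {..<n}"
    show "(case p of (i, j) \<Rightarrow> cmod (u i * cnj (u j) - w i * cnj (w j)))
       \<le> (case p of (i,j) \<Rightarrow> cmod (u i * cnj (u j) - v i * cnj (v j)))
      + (case p of (i,j) \<Rightarrow> cmod (v i * cnj (v j) - w i * cnj (w j)))"
      using norm_triangle_ineq[of "u (fst p) * cnj (u (snd p)) - v (fst p) * cnj (v (snd p))"
          "v (fst p) * cnj (v (snd p)) - w (fst p) * cnj (w (snd p))"]
      by (simp add: case_prod_beta)
  qed (simp add: case_prod_beta)
  also have "\<dots> \<le> pdist n u v + pdist n v w" unfolding pdist_def by (rule L2_set_triangle_ineq)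
  finally show ?thesis .
qed

lemma pdist_sq:
  assumes "nsq n u = 1" "nsq n v = 1"
  shows "(pdist n u v)\<^sup>2 = 2 - 2 * (cmod (ip n u v))\<^sup>2"
proof -
  define a where "a = ip n u v"
  have four: "(\<Sum>i<n. \<Sum>j<n. (p i * cnj (q i)) * (cnj (p j) * q j)) = ip n q p * ip n p q" for p q
    by (simp add: ip_def sum_product mult_ac)
  have "complex_of_real ((pdist n u v)\<^sup>2)
      = (\<Sum>i<n. \<Sum>j<n. complex_of_real ((cmod (u i * cnj (u j) - v i * cnj (v j)))\<^sup>2))"
    by (simp add: pdist_def L2_set_def sum_nonneg sum.cartesian_product case_prod_beta)
  also have "\<dots> = (\<Sum>i<n. \<Sum>j<n. (u i * cnj (u i)) * (cnj (u j) * u j) - (u i * cnj (v i)) * (cnj (u j) * v j)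
      - (v i * cnj (u i)) * (cnj (v j) * u j) + (v i * cnj (v i)) * (cnj (v j) * v j))"
    by (intro sum.cong refl) (simp only: complex_norm_square, simp add: algebra_simps)
  also have "\<dots> = ip n u u * ip n u u - ip n v u * ip n u v - ip n u v * ip n v u + ip n v v * ip n v v"
    unfolding sum.distrib sum_subtractf four ..
  also have "\<dots> = complex_of_real (2 - 2 * (cmod a)\<^sup>2)"
  proof -
    have "ip n v u = cnj a" by (simp add: a_def ip_cnj)
    moreover have "a * cnj a = of_real ((cmod a)\<^sup>2)" by (rule complex_norm_square[symmetric])
    ultimately show ?thesis
      unfolding ip_self assms a_def[symmetric] by (simp add: mult.commute[of "cnj a"])
  qed
  finally show ?thesis unfolding of_real_eq_iff a_def .
qed

text \<open>The phase of the overlap \<open>a\<close> is rotated away, leaving squared distance 2 -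
  2|a|, which is at most 2 - 2|a|^2 because |a| is at most 1.\<close>

lemma phase_align:
  assumes "nsq n u = 1" "nsq n v = 1"
  obtains c where "cmod c = 1" "nsq n (\<lambda>i. u i - c * v i) \<le> (pdist n u v)\<^sup>2"
proof -
  define a where "a = ip n u v"
  define c where "c = (if a = 0 then 1 else cnj a / of_real (cmod a))"
  have c1: "cmod c = 1" by (simp add: c_def norm_divide)
  have ca: "c * a = of_real (cmod a)"
  proof (cases "a = 0")
    case False
    have "cnj a * a = of_real (cmod a) * of_real (cmod a)"
      by (metis complex_norm_square mult.commute power2_eq_square of_real_power)
    then show ?thesis using False by (simp add: c_def field_simps)
  qed (simp add: c_def)
  have ca': "cnj c * cnj a = of_real (cmod a)"
    by (metis ca complex_cnj_complex_of_real complex_cnj_mult)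
  have cc: "cnj c * c = 1" using c1 by (metis complex_norm_square mult.commute of_real_1 power_one)
  have "complex_of_real (nsq n (\<lambda>i. u i - c * v i)) = ip n (\<lambda>i. u i - c * v i) (\<lambda>i. u i - c * v i)"
    by (simp add: ip_self)
  also have "\<dots> = ip n u u - c * a - cnj c * cnj a + (cnj c * c) * ip n v v"
    unfolding ip_diff_left ip_diff_right ip_scale_left ip_scale_right a_def ip_cnj by (simp add: algebra_simps)
  also have "\<dots> = of_real (2 - 2 * cmod a)" unfolding ca ca' cc ip_self assms by simp
  finally have e: "nsq n (\<lambda>i. u i - c * v i) = 2 - 2 * cmod a" unfolding of_real_eq_iff .
  have "0 \<le> (pdist n u v)\<^sup>2" by simp
  then have "(cmod a)\<^sup>2 \<le> 1\<^sup>2" unfolding pdist_sq[OF assms] a_def by simp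
  then have "cmod a \<le> 1" by (rule power2_le_imp_le) simp
  then have "(cmod a)\<^sup>2 \<le> cmod a" by (simp add: power2_eq_square mult_left_le)
  then have "nsq n (\<lambda>i. u i - c * v i) \<le> (pdist n u v)\<^sup>2"
    unfolding e pdist_sq[OF assms] a_def by simp
  then show ?thesis by (rule that[OF c1])
qed

section \<open>Density matrices as sums of projectors\<close>

definition mf :: "complex mat \<Rightarrow> nat \<Rightarrow> nat \<Rightarrow> complex" where
  "mf A = (\<lambda>i j. A $$ (i, j))"

definition tens :: "nat \<Rightarrow> (nat \<Rightarrow> complex) \<Rightarrow> (nat \<Rightarrow> complex) \<Rightarrow> nat \<Rightarrow> complex" where
  "tens b u w = (\<lambda>i. u (i div b) * w (i mod b))"

fun vpow :: "nat \<Rightarrow> (nat \<Rightarrow> complex) \<Rightarrow> nat \<Rightarrow> nat \<Rightarrow> complex" where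
  "vpow d u 0 = (\<lambda>_. 1)"
| "vpow d u (Suc t) = tens (d ^ t) u (vpow d u t)"

text \<open>A density matrix is represented by a list of unnormalised vectors whose projectors sum to it.\<close>
definition rep :: "nat \<Rightarrow> complex mat \<Rightarrow> (nat \<Rightarrow> complex) list \<Rightarrow> bool" where
  "rep n \<rho> xs \<longleftrightarrow> \<rho> \<in> carrier_mat n n \<and>
     (\<forall>i<n. \<forall>j<n. \<rho> $$ (i, j) = (\<Sum>x\<leftarrow>xs. x i * cnj (x j)))"

lemma sum_lessThan_mult: "(\<Sum>i<a * b. f i) = (\<Sum>i<a. \<Sum>j<b. f (i * b + j))"
  for f :: "nat \<Rightarrow> 'a::comm_monoid_add"
proof (induction a)
  case (Suc a)
  have "(\<Sum>i<Suc a * b. f i) = (\<Sum>i<a * b + b. f i)" by (simp add: add.commute)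
  then show ?case using Suc by (simp only: sum_lessThan_add sum.lessThan_Suc)
qed simp

lemma index_lt: "i < a \<Longrightarrow> j < b \<Longrightarrow> i * b + j < a * (b::nat)"
proof -
  assume "i < a" "j < b"
  then have "i * b + j < Suc i * b" by simp
  also have "\<dots> \<le> a * b" using \<open>i < a\<close> by (intro mult_right_mono) auto
  finally show ?thesis .
qed

lemma sum_sum_list_swap: "(\<Sum>i\<in>A. \<Sum>x\<leftarrow>xs. f i x) = (\<Sum>x\<leftarrow>xs. \<Sum>i\<in>A. f i x)"
  for f :: "'b \<Rightarrow> 'c \<Rightarrow> 'a::comm_monoid_add"
  by (induction xs) (auto simp: sum.distrib)

lemma sum_list_times: "(\<Sum>x\<leftarrow>xs. f x) * (\<Sum>y\<leftarrow>ys. g y) = (\<Sum>x\<leftarrow>xs. \<Sum>y\<leftarrow>ys. f x * g y)"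
  for f :: "'b \<Rightarrow> 'a::semiring_0"
  by (simp add: sum_list_mult_const sum_list_const_mult)

lemma sum_list_concat_map: "(\<Sum>z\<leftarrow>concat (map (\<lambda>x. map (g x) (ys x)) xs). f z) = (\<Sum>x\<leftarrow>xs. \<Sum>y\<leftarrow>ys x. f (g x y))"
  for f :: "'b \<Rightarrow> 'a::comm_monoid_add"
  by (induction xs) (auto simp: comp_def)

lemma ip_tens: "ip (a * b) (tens b u w) (tens b u' w') = ip a u u' * ip b w w'"
  by (cases "b = 0") (simp_all add: ip_def tens_def sum_lessThan_mult sum_product mult_ac)

lemma nsq_tens: "nsq (a * b) (tens b u w) = nsq a u * nsq b w"
proof -
  have "complex_of_real (nsq (a * b) (tens b u w)) = complex_of_real (nsq a u * nsq b w)"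
    unfolding ip_self[symmetric] ip_tens by (simp add: ip_self)
  then show ?thesis unfolding of_real_eq_iff .
qed

lemma ip_vpow: "ip (d ^ t) (vpow d u t) (vpow d v t) = ip d u v ^ t"
  by (induction t) (simp_all add: ip_tens, simp add: ip_def)

lemma nsq_vpow: "nsq d u = 1 \<Longrightarrow> nsq (d ^ t) (vpow d u t) = 1"
proof -
  assume "nsq d u = 1"
  then have "complex_of_real (nsq (d ^ t) (vpow d u t)) = 1"
    unfolding ip_self[symmetric] ip_vpow by (simp add: ip_self)
  then show ?thesis by simp
qed

lemma qf_cong: "(\<And>i. i < n \<Longrightarrow> u i = v i) \<Longrightarrow> qf n M u = qf n M v"
  by (simp add: qf_sum)

lemma qf_scale: "qf n M (\<lambda>i. c * v i) = of_real ((cmod c)\<^sup>2) * qf n M v"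
  unfolding qf_def mvp_scale ip_scale_left ip_scale_right
  by (simp add: complex_norm_square mult_ac del: of_real_power)

lemma nsq_scale: "nsq n (\<lambda>i. c * v i) = (cmod c)\<^sup>2 * nsq n v"
  by (simp add: nsq_def norm_mult power_mult_distrib sum_distrib_left)

lemma psd_iff: "psd n A \<longleftrightarrow> A \<in> carrier_mat n n \<and> psdf n (mf A)"
proof -
  have q: "(A *\<^sub>v v) \<bullet>c v = qf n (mf A) (($) v)" if "A \<in> carrier_mat n n" "v \<in> carrier_vec n" for v
    using that by (auto simp: scalar_prod_def qf_def ip_def mvp_def mf_def lessThan_atLeast0 mult.commute intro!: sum.cong)
  have "psdf n (mf A)" if A: "A \<in> carrier_mat n n"
    and P: "\<forall>v\<in>carrier_vec n. Im ((A *\<^sub>v v) \<bullet>c v) = 0 \<and> 0 \<le> Re ((A *\<^sub>v v) \<bullet>c v)"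
    unfolding psdf_def
  proof
    fix v
    have "qf n (mf A) v = qf n (mf A) (($) (vec n v))" by (rule qf_cong) simp
    then show "Im (qf n (mf A) v) = 0 \<and> 0 \<le> Re (qf n (mf A) v)"
      using P q[OF A, of "vec n v"] by (metis vec_carrier)
  qed
  moreover have "psd n A" if A: "A \<in> carrier_mat n n" and P: "psdf n (mf A)"
    unfolding psd_def using A P q[OF A] by (metis psdf_def)
  ultimately show ?thesis unfolding psd_def by blast
qed

lemma povm_elem_iff: "povm_elem n M \<longleftrightarrow> M \<in> carrier_mat n n \<and> effect n (mf M)"
proof (cases "M \<in> carrier_mat n n")
  case True
  have q: "qf n (mf (1\<^sub>m n - M)) v = of_real (nsq n v) - qf n (mf M) v" for v
  proof -
    have "mvp n (mf (1\<^sub>m n - M)) v i = mvp n (\<lambda>i j. of_bool (i = j) - mf M i j) v i" if "i < n" for i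
      unfolding mvp_def using True that by (intro sum.cong refl) (auto simp: mf_def)
    then have "qf n (mf (1\<^sub>m n - M)) v = ip n v (mvp n (\<lambda>i j. of_bool (i = j) - mf M i j) v)"
      unfolding qf_def by (intro ip_cong) auto
    also have "\<dots> = ip n v (mvp n (\<lambda>i j. of_bool (i = j)) v) - qf n (mf M) v"
      unfolding mvp_mat_diff ip_diff_right qf_def ..
    also have "ip n v (mvp n (\<lambda>i j. of_bool (i = j)) v) = ip n v v"
      by (intro ip_cong) (simp_all add: mvp_id)
    finally show ?thesis by (simp add: ip_self)
  qed
  show ?thesis
    unfolding povm_elem_def psd_iff effect_def psdf_def q using True by auto
next
  case False
  then show ?thesis by (auto simp: povm_elem_def psd_iff)
qed

lemma kraus_iff: "kraus din dout Ks \<longleftrightarrow> (\<forall>K\<in>set Ks. K \<in> carrier_mat dout din) \<and>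
   (\<forall>i<din. \<forall>j<din. (\<Sum>K\<leftarrow>Ks. \<Sum>r<dout. cnj (K $$ (r, i)) * K $$ (r, j)) = of_bool (i = j))"
proof (cases "\<forall>K\<in>set Ks. K \<in> carrier_mat dout din")
  case True
  then have "foldr (\<lambda>K acc. dag K * K + acc) Ks (0\<^sub>m din din) \<in> carrier_mat din din \<and>
    (\<forall>i<din. \<forall>j<din. foldr (\<lambda>K acc. dag K * K + acc) Ks (0\<^sub>m din din) $$ (i, j)
       = (\<Sum>K\<leftarrow>Ks. \<Sum>r<dout. cnj (K $$ (r, i)) * K $$ (r, j)))"
    by (induction Ks) (auto simp: dag_def scalar_prod_def lessThan_atLeast0)
  then show ?thesis
    using True unfolding kraus_def by (auto simp: mat_eq_iff)
next
  case False
  then show ?thesis by (auto simp: kraus_def)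
qed

lemma kraus_nsq:
  assumes "kraus din dout Ks"
  shows "(\<Sum>K\<leftarrow>Ks. nsq dout (mvp din (mf K) v)) = nsq din v"
proof -
  have add: "(\<Sum>K\<leftarrow>Ks. qf din (G K) v) = qf din (\<lambda>i j. \<Sum>K\<leftarrow>Ks. G K i j) v" for G Ks
    by (induction Ks) (simp_all add: qf_sum algebra_simps sum.distrib)
  have "complex_of_real (\<Sum>K\<leftarrow>Ks. nsq dout (mvp din (mf K) v))
      = (\<Sum>K\<leftarrow>Ks. qf din (\<lambda>i j. \<Sum>r<dout. cnj (mf K r i) * mf K r j) v)"
    unfolding gram_qf by (induction Ks) auto
  also have "\<dots> = (\<Sum>i<din. \<Sum>j<din. cnj (v i) * of_bool (i = j) * v j)"
    unfolding add unfolding qf_sum using assms by (intro sum.cong refl) (simp add: kraus_iff mf_def)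
  also have "\<dots> = (\<Sum>i<din. \<Sum>j<din. of_bool (j = i) * (cnj (v i) * v j))"
    by (intro sum.cong refl) (simp add: of_bool_def)
  also have "\<dots> = ip din v v"
    unfolding ip_def by (intro sum.cong refl) (simp add: sum_delta_left del: sum_of_bool_mult_eq)
  finally have "complex_of_real (\<Sum>K\<leftarrow>Ks. nsq dout (mvp din (mf K) v)) = complex_of_real (nsq din v)"
    by (simp only: ip_self)
  then show ?thesis unfolding of_real_eq_iff .
qed

lemma rep_proj: "v \<in> carrier_vec n \<Longrightarrow> rep n (proj v) [($) v]"
  by (auto simp: rep_def proj_def)

lemma rep_kron:
  assumes "rep a \<rho> xs" "rep b \<sigma> ys"
  shows "rep (a * b) (kron \<rho> \<sigma>) (concat (map (\<lambda>x. map (tens b x) ys) xs))"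
proof -
  have c: "\<rho> \<in> carrier_mat a a" "\<sigma> \<in> carrier_mat b b" using assms by (auto simp: rep_def)
  have "kron \<rho> \<sigma> $$ (i, j) = (\<Sum>z\<leftarrow>concat (map (\<lambda>x. map (tens b x) ys) xs). z i * cnj (z j))"
    if ij: "i < a * b" "j < a * b" for i j
  proof -
    have b: "0 < b" using ij by (cases b) auto
    have lt: "i div b < a" "j div b < a" "i mod b < b" "j mod b < b"
      using ij b by (auto simp: less_mult_imp_div_less)
    have "kron \<rho> \<sigma> $$ (i, j) = \<rho> $$ (i div b, j div b) * \<sigma> $$ (i mod b, j mod b)"
      using c ij by (auto simp: kron_def)
    also have "\<dots> = (\<Sum>x\<leftarrow>xs. \<Sum>y\<leftarrow>ys. (x (i div b) * cnj (x (j div b))) * (y (i mod b) * cnj (y (j mod b))))"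
      using assms lt by (simp only: rep_def sum_list_times)
    also have "\<dots> = (\<Sum>x\<leftarrow>xs. \<Sum>y\<leftarrow>ys. tens b x y i * cnj (tens b x y j))"
      by (simp add: tens_def mult_ac)
    finally show ?thesis by (simp only: sum_list_concat_map)
  qed
  then show ?thesis using c by (auto simp: rep_def kron_def)
qed

lemma rep_apply_kraus:
  assumes "\<And>K. K \<in> set Ks \<Longrightarrow> K \<in> carrier_mat dout din" and \<rho>: "rep din \<rho> xs"
  shows "rep dout (apply_kraus dout Ks \<rho>) (concat (map (\<lambda>K. map (mvp din (mf K)) xs) Ks))"
  using assms(1)
proof (induction Ks)
  case Nil
  then show ?case by (simp add: rep_def apply_kraus_def)
next
  case (Cons K Ks)
  have c: "\<rho> \<in> carrier_mat din din" using \<rho> by (simp add: rep_def)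
  have K: "K \<in> carrier_mat dout din" using Cons by simp
  have IH: "rep dout (apply_kraus dout Ks \<rho>) (concat (map (\<lambda>K. map (mvp din (mf K)) xs) Ks))"
    using Cons by simp
  have eq: "apply_kraus dout (K # Ks) \<rho> = K * \<rho> * dag K + apply_kraus dout Ks \<rho>"
    by (simp add: apply_kraus_def)
  have dK: "dag K \<in> carrier_mat din dout" using K by (auto simp: dag_def)
  have "(K * \<rho> * dag K) $$ (i, j) = (\<Sum>x\<leftarrow>xs. mvp din (mf K) x i * cnj (mvp din (mf K) x j))"
    if ij: "i < dout" "j < dout" for i j
  proof -
    have "(K * \<rho> * dag K) $$ (i, j) = (\<Sum>l<din. (\<Sum>k<din. K $$ (i, k) * \<rho> $$ (k, l)) * cnj (K $$ (j, l)))"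
      using K c ij by (simp add: scalar_prod_def dag_def lessThan_atLeast0)
    also have "\<dots> = (\<Sum>l<din. \<Sum>k<din. \<Sum>x\<leftarrow>xs. (K $$ (i, k) * x k) * cnj (K $$ (j, l) * x l))"
      unfolding sum_distrib_right
    proof (intro sum.cong refl)
      fix l k assume "l \<in> {..<din}" "k \<in> {..<din}"
      then have "\<rho> $$ (k, l) = (\<Sum>x\<leftarrow>xs. x k * cnj (x l))" using \<rho> by (simp add: rep_def)
      then show "K $$ (i, k) * \<rho> $$ (k, l) * cnj (K $$ (j, l))
          = (\<Sum>x\<leftarrow>xs. (K $$ (i, k) * x k) * cnj (K $$ (j, l) * x l))"
        by (simp add: sum_list_const_mult[symmetric] sum_list_mult_const[symmetric] mult_ac)
    qed
    also have "\<dots> = (\<Sum>x\<leftarrow>xs. \<Sum>l<din. \<Sum>k<din. (K $$ (i, k) * x k) * cnj (K $$ (j, l) * x l))"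
      unfolding sum_sum_list_swap ..
    also have "\<dots> = (\<Sum>x\<leftarrow>xs. mvp din (mf K) x i * cnj (mvp din (mf K) x j))"
      unfolding mvp_def mf_def cnj_sum sum_product by (subst sum.swap) simp
    finally show ?thesis .
  qed
  then show ?case using IH K c dK unfolding eq by (auto simp: rep_def comp_def)
qed

text \<open>Tracing out the second factor replaces each vector by its slices at fixed second
  index.\<close>

lemma rep_ptrace2:
  assumes "rep (n * q) \<rho> xs"
  shows "rep n (ptrace2 n q \<rho>) (concat (map (\<lambda>x. map (\<lambda>r c. x (c * q + r)) [0..<q]) xs))"
proof -
  have "ptrace2 n q \<rho> $$ (i, j) = (\<Sum>z\<leftarrow>concat (map (\<lambda>x. map (\<lambda>r c. x (c * q + r)) [0..<q]) xs). z i * cnj (z j))"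
    if ij: "i < n" "j < n" for i j
  proof -
    have "ptrace2 n q \<rho> $$ (i, j) = (\<Sum>l<q. \<Sum>x\<leftarrow>xs. x (i * q + l) * cnj (x (j * q + l)))"
      using assms ij by (simp add: ptrace2_def rep_def index_lt)
    also have "\<dots> = (\<Sum>x\<leftarrow>xs. \<Sum>l<q. x (i * q + l) * cnj (x (j * q + l)))" by (rule sum_sum_list_swap)
    also have "\<dots> = (\<Sum>x\<leftarrow>xs. \<Sum>l\<leftarrow>[0..<q]. x (i * q + l) * cnj (x (j * q + l)))"
      by (simp add: interv_sum_list_conv_sum_set_nat lessThan_atLeast0)
    finally show ?thesis by (simp only: sum_list_concat_map)
  qed
  then show ?thesis by (auto simp: rep_def ptrace2_def)
qed

lemma rep_kpow:
  assumes "u \<in> carrier_vec d"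
  shows "rep (d ^ t) (kpow (proj u) t) [vpow d (($) u) t]"
proof (induction t)
  case 0
  then show ?case by (simp add: rep_def)
next
  case (Suc t)
  from rep_kron[OF rep_proj[OF assms] Suc] show ?case by simp
qed

lemma qtr_rep:
  assumes "M \<in> carrier_mat n n" "rep n \<rho> xs"
  shows "qtr (M * \<rho>) = (\<Sum>x\<leftarrow>xs. qf n (mf M) x)"
proof -
  have c: "\<rho> \<in> carrier_mat n n" using assms by (simp add: rep_def)
  have "qtr (M * \<rho>) = (\<Sum>i<n. \<Sum>j<n. M $$ (i, j) * \<rho> $$ (j, i))"
    using assms(1) c by (simp add: qtr_def scalar_prod_def lessThan_atLeast0)
  also have "\<dots> = (\<Sum>i<n. \<Sum>j<n. \<Sum>x\<leftarrow>xs. cnj (x i) * mf M i j * x j)"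
    using assms(2) by (simp add: rep_def sum_list_const_mult[symmetric] mf_def mult_ac)
  also have "\<dots> = (\<Sum>x\<leftarrow>xs. qf n (mf M) x)"
    unfolding sum_sum_list_swap qf_sum ..
  finally show ?thesis .
qed

lemma mf_kron_id_mvp:
  assumes K: "K \<in> carrier_mat q e" and i: "i < n * q"
  shows "mvp (n * e) (mf (kron (1\<^sub>m n) K)) u i = (\<Sum>s<e. mf K (i mod q) s * u ((i div q) * e + s))"
proof -
  have q: "0 < q" using i by (cases q) auto
  have lt: "i div q < n" using i by (simp add: less_mult_imp_div_less)
  have "mvp (n * e) (mf (kron (1\<^sub>m n) K)) u i
      = (\<Sum>a<n. \<Sum>s<e. mf (kron (1\<^sub>m n) K) i (a * e + s) * u (a * e + s))"
    unfolding mvp_def by (rule sum_lessThan_mult)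
  also have "\<dots> = (\<Sum>a<n. \<Sum>s<e. of_bool (a = i div q) * (mf K (i mod q) s * u (a * e + s)))"
  proof (intro sum.cong refl)
    fix a s assume "a \<in> {..<n}" "s \<in> {..<e}"
    then show "mf (kron (1\<^sub>m n) K) i (a * e + s) * u (a * e + s) =
        of_bool (a = i div q) * (mf K (i mod q) s * u (a * e + s))"
      using K i lt by (auto simp: mf_def kron_def index_lt)
  qed
  also have "\<dots> = (\<Sum>a<n. of_bool (a = i div q) * (\<Sum>s<e. mf K (i mod q) s * u (a * e + s)))"
    by (simp only: sum_distrib_left)
  also have "\<dots> = (\<Sum>s<e. mf K (i mod q) s * u ((i div q) * e + s))"
    using sum_delta_left[OF lt] by simp
  finally show ?thesis .
qed

lemma unit_state_iff: "unit_state d v \<longleftrightarrow> v \<in> carrier_vec d \<and> nsq d (($) v) = 1"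
proof -
  have "v \<bullet>c v = of_real (nsq d (($) v))" if "v \<in> carrier_vec d"
    unfolding ip_self[symmetric] using that
    by (auto simp: scalar_prod_def ip_def lessThan_atLeast0 mult.commute intro!: sum.cong)
  then show ?thesis by (auto simp: unit_state_def)
qed

section \<open>The attack for a known key\<close>

text \<open>The averaging argument alone. \<open>g\<close> enumerates the clustered keys,
  \<open>w k r\<close> is the probability of guess r under key k, \<open>F k r\<close> the sum of
  both acceptance probabilities, \<open>H r k\<close> the signed advantage under key k of the test
  made for guess r, and \<open>\<Delta> r\<close> the squared distance of the two purifications for
  guess r.\<close>

lemma attack_value:
  fixes K :: "'k set" and g :: "nat \<Rightarrow> 'k" and w F :: "'k \<Rightarrow> nat \<Rightarrow> real"
    and H :: "nat \<Rightarrow> 'k \<Rightarrow> real" and \<Delta> :: "nat \<Rightarrow> real"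
  assumes K: "finite K" and g: "bij_betw g {..<N} A" and A: "A \<subseteq> K"
    and bad: "real (card (K - A)) \<le> real (card K) / 1000"
    and w0: "\<And>k r. k \<in> K \<Longrightarrow> r < m \<Longrightarrow> 0 \<le> w k r" and Nm: "N \<le> m"
    and row: "\<And>k. k \<in> K \<Longrightarrow> (\<Sum>r<m. w k r) = 1"
    and junk: "\<And>i r. i < N \<Longrightarrow> N \<le> r \<Longrightarrow> r < m \<Longrightarrow> w (g i) r = 0"
    and col: "\<And>r. r < N \<Longrightarrow> (\<Sum>i<N. w (g i) r) = 1"
    and mis: "(\<Sum>i<N. \<Sum>r<N. of_bool (lab i \<noteq> lab r) * w (g i) r) \<le> real N / 1000"
    and F0: "\<And>k r. k \<in> K \<Longrightarrow> r < m \<Longrightarrow> 0 \<le> F k r"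
    and F: "\<And>i r. i < N \<Longrightarrow> r < N \<Longrightarrow> lab i = lab r \<Longrightarrow> 184 / 100 - 21 * \<Delta> r \<le> F (g i) r"
    and \<Delta>: "\<And>r. r < N \<Longrightarrow> 0 \<le> \<Delta> r" "\<And>r. r < N \<Longrightarrow> \<Delta> r \<le> 2 * H r (g r)"
    and H1: "\<And>r k. k \<in> K \<Longrightarrow> r < N \<Longrightarrow> \<bar>H r k\<bar> \<le> 1"
    and H: "\<And>i r. i < N \<Longrightarrow> r < N \<Longrightarrow> lab i = lab r \<Longrightarrow> H r (g r) \<le> H r (g i) + 5 / 1000"
    and hide: "(\<Sum>k\<in>K. \<Sum>r<N. w k r * H r k) \<le> real (card K) / 1000"
  shows "14 / 10 * real (card K) \<le> (\<Sum>k\<in>K. \<Sum>r<m. w k r * F k r)"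
proof -
  have gK: "g i \<in> K" if "i < N" for i using g A that by (auto simp: bij_betw_def)
  have wg0: "0 \<le> w (g i) r" if "i < N" "r < N" for i r using w0 gK that Nm by simp
  have finA: "finite A" using A K finite_subset by blast
  have cardA: "card A = N" using bij_betw_same_card[OF g] by simp
  have "card (K - A) = card K - N" using card_Diff_subset[OF finA A] cardA by simp
  moreover have "N \<le> card K" using card_mono[OF K A] cardA by simp
  ultimately have N: "real N \<le> real (card K)" "999 / 1000 * real (card K) \<le> real N"
    using bad by (simp_all add: of_nat_diff)
  have split: "(\<Sum>k\<in>K. f k) = (\<Sum>i<N. f (g i)) + (\<Sum>k\<in>K - A. f k)" for f :: "'k \<Rightarrow> real"
  proof -
    have "(\<Sum>k\<in>K. f k) = (\<Sum>k\<in>K - A. f k) + (\<Sum>k\<in>A. f k)" by (rule sum.subset_diff[OF A K])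
    moreover have "(\<Sum>k\<in>A. f k) = (\<Sum>i<N. f (g i))" by (rule sum.reindex_bij_betw[OF g, symmetric])
    ultimately show ?thesis by simp
  qed
  \<comment> \<open>One part in 1000 comes from hiding; the other pays for the discarded keys, each
    of which contributes at least -1.\<close>
  have "(\<Sum>i<N. \<Sum>r<N. w (g i) r * H r (g i)) \<le> 2 / 1000 * real (card K)"
  proof -
    have "- 1 \<le> (\<Sum>r<N. w k r * H r k)" if k: "k \<in> K" for k
    proof -
      have "(\<Sum>r<N. w k r) \<le> (\<Sum>r<m. w k r)" using w0[OF k] Nm by (intro sum_mono2) auto
      then have "- 1 \<le> (\<Sum>r<N. - w k r)" using row[OF k] by (simp add: sum_negf)
      also have "\<dots> \<le> (\<Sum>r<N. w k r * H r k)"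
      proof (intro sum_mono)
        fix r assume "r \<in> {..<N}"
        then have "w k r * (- 1) \<le> w k r * H r k" using H1[OF k, of r] w0[OF k, of r] Nm
          by (intro mult_left_mono) auto
        then show "- w k r \<le> w k r * H r k" by simp
      qed
      finally show ?thesis .
    qed
    then have "- real (card (K - A)) \<le> (\<Sum>k\<in>K - A. \<Sum>r<N. w k r * H r k)"
      using sum_mono[of "K - A" "\<lambda>_. - 1" "\<lambda>k. \<Sum>r<N. w k r * H r k"] by simp
    then show ?thesis using hide bad unfolding split by simp
  qed
  \<comment> \<open>Uniformity of the guess: unit column sums insert the weights, and then the
    guessed key is exchanged for the true one. Inside a cluster this costs 5/1000; on wrong
    clusters, of weight at most N/1000, it costs at most 2.\<close>
  moreover have "(\<Sum>r<N. H r (g r)) \<le> (\<Sum>i<N. \<Sum>r<N. w (g i) r * H r (g i)) + 7 / 1000 * real N"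
  proof -
    have "(\<Sum>r<N. H r (g r)) = (\<Sum>r<N. (\<Sum>i<N. w (g i) r) * H r (g r))" by (simp add: col)
    also have "\<dots> = (\<Sum>i<N. \<Sum>r<N. w (g i) r * H r (g r))"
      unfolding sum_distrib_right by (rule sum.swap)
    also have "\<dots> \<le> (\<Sum>i<N. \<Sum>r<N. w (g i) r * H r (g i) + 5 / 1000 * w (g i) r
        + 2 * (of_bool (lab i \<noteq> lab r) * w (g i) r))"
    proof (intro sum_mono)
      fix i r assume "i \<in> {..<N}" "r \<in> {..<N}"
      then have ir: "i < N" "r < N" by auto
      have "H r (g r) \<le> H r (g i) + 5 / 1000 + 2 * of_bool (lab i \<noteq> lab r)"
        using H[OF ir] H1[OF gK[OF ir(1)] ir(2)] H1[OF gK[OF ir(2)] ir(2)] by (cases "lab i = lab r") auto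
      from mult_left_mono[OF this wg0[OF ir]]
      show "w (g i) r * H r (g r) \<le> w (g i) r * H r (g i) + 5 / 1000 * w (g i) r
        + 2 * (of_bool (lab i \<noteq> lab r) * w (g i) r)"
        by (simp add: algebra_simps del: sum_mult_of_bool_eq)
    qed
    also have "\<dots> = (\<Sum>i<N. \<Sum>r<N. w (g i) r * H r (g i)) + 5 / 1000 * (\<Sum>i<N. \<Sum>r<N. w (g i) r)
        + 2 * (\<Sum>i<N. \<Sum>r<N. of_bool (lab i \<noteq> lab r) * w (g i) r)"
      by (simp only: sum.distrib sum_distrib_left)
    also have "(\<Sum>i<N. \<Sum>r<N. w (g i) r) = real N"
      by (subst sum.swap) (simp add: col)
    finally show ?thesis using mis by simp
  qed
  \<comment> \<open>Twice the sum of 2/1000 and 7/1000.\<close>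
  ultimately have "(\<Sum>r<N. \<Delta> r) \<le> 18 / 1000 * real (card K)"
    using N sum_mono[of "{..<N}" \<Delta> "\<lambda>r. 2 * H r (g r)"] \<Delta>(2) by (simp add: sum_distrib_left[symmetric])
  \<comment> \<open>Guesses in the wrong cluster count as 0 and remove at most one part in 1000 of
    the weight; unit column sums again turn the weighted \<open>\<Delta>\<close> into a plain
    sum.\<close>
  moreover have "(\<Sum>i<N. \<Sum>r<N. w (g i) r * F (g i) r) \<ge> 184 / 100 * (999 / 1000 * real N) - 21 * (\<Sum>r<N. \<Delta> r)"
  proof -
    have "(\<Sum>i<N. \<Sum>r<N. 184 / 100 * w (g i) r - 184 / 100 * (of_bool (lab i \<noteq> lab r) * w (g i) r)
        - 21 * (w (g i) r * \<Delta> r)) \<le> (\<Sum>i<N. \<Sum>r<N. w (g i) r * F (g i) r)"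
    proof (intro sum_mono)
      fix i r assume "i \<in> {..<N}" "r \<in> {..<N}"
      then have ir: "i < N" "r < N" by auto
      have "184 / 100 - 184 / 100 * of_bool (lab i \<noteq> lab r) - 21 * \<Delta> r \<le> F (g i) r"
        using F[OF ir] F0[OF gK[OF ir(1)], of r] ir Nm \<Delta>(1)[OF ir(2)] by (cases "lab i = lab r") auto
      from mult_left_mono[OF this wg0[OF ir]]
      show "184 / 100 * w (g i) r - 184 / 100 * (of_bool (lab i \<noteq> lab r) * w (g i) r)
        - 21 * (w (g i) r * \<Delta> r) \<le> w (g i) r * F (g i) r"
        by (simp add: algebra_simps)
    qed
    also have "(\<Sum>i<N. \<Sum>r<N. 184 / 100 * w (g i) r - 184 / 100 * (of_bool (lab i \<noteq> lab r) * w (g i) r)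
        - 21 * (w (g i) r * \<Delta> r)) = 184 / 100 * (\<Sum>i<N. \<Sum>r<N. w (g i) r)
        - 184 / 100 * (\<Sum>i<N. \<Sum>r<N. of_bool (lab i \<noteq> lab r) * w (g i) r)
        - 21 * (\<Sum>i<N. \<Sum>r<N. w (g i) r * \<Delta> r)"
      by (simp only: sum_subtractf sum_distrib_left)
    also have "(\<Sum>i<N. \<Sum>r<N. w (g i) r) = real N" by (subst sum.swap) (simp add: col)
    also have "(\<Sum>i<N. \<Sum>r<N. w (g i) r * \<Delta> r) = (\<Sum>r<N. \<Delta> r)"
      by (subst sum.swap) (simp add: sum_distrib_right[symmetric] col)
    finally show ?thesis using mis by simp
  qed
  moreover have "(\<Sum>i<N. \<Sum>r<N. w (g i) r * F (g i) r) \<le> (\<Sum>k\<in>K. \<Sum>r<m. w k r * F k r)"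
  proof -
    have "(\<Sum>r<N. w (g i) r * F (g i) r) \<le> (\<Sum>r<m. w (g i) r * F (g i) r)" if "i < N" for i
      using w0 F0 gK[OF that] Nm by (intro sum_mono2) auto
    then have "(\<Sum>i<N. \<Sum>r<N. w (g i) r * F (g i) r) \<le> (\<Sum>i<N. \<Sum>r<m. w (g i) r * F (g i) r)"
      by (intro sum_mono) simp
    moreover have "0 \<le> (\<Sum>k\<in>K - A. \<Sum>r<m. w k r * F k r)"
      using w0 F0 by (intro sum_nonneg mult_nonneg_nonneg) auto
    ultimately show ?thesis unfolding split by simp
  qed
  \<comment> \<open>As N is at least 999/1000 of the number of keys, the value is at least 1.84 *
    0.999^2 - 21 * 0.018, which exceeds 1.45.\<close>
  ultimately show ?thesis using N by simp
qed

text \<open>Total acceptance of a family of linear maps that is jointly an isometry, such as Kraus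
  operators. Aligning phases first is harmless, as the forms ignore phases, and it replaces vector
  distance by projector distance.\<close>

lemma effect_functional_perturb:
  fixes B :: "'j \<Rightarrow> (nat \<Rightarrow> complex) \<Rightarrow> nat \<Rightarrow> complex"
  assumes M: "effect n M" and s: "0 < s"
    and lin: "\<And>j u v c. j \<in> J \<Longrightarrow> B j (\<lambda>i. u i - c * v i) = (\<lambda>t. B j u t - c * B j v t)"
    and iso: "\<And>u. (\<Sum>j\<in>J. nsq n (B j u)) = nsq P u"
    and u: "nsq P u = 1" "nsq P v = 1" and \<kappa>: "(pdist P u v)\<^sup>2 \<le> \<kappa>"
  shows "(\<Sum>j\<in>J. Re (qf n M (B j u))) \<le> (\<Sum>j\<in>J. Re (qf n M (B j v))) + s + (1 + 1 / s) * \<kappa>"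
proof -
  obtain c where c: "cmod c = 1" "nsq P (\<lambda>i. u i - c * v i) \<le> (pdist P u v)\<^sup>2"
    using phase_align[OF u] by blast
  have "(\<Sum>j\<in>J. Re (qf n M (B j u))) \<le> (\<Sum>j\<in>J. Re (qf n M (\<lambda>t. c * B j v t)) + s * nsq n (\<lambda>t. c * B j v t)
      + (1 + 1 / s) * nsq n (\<lambda>t. B j u t - c * B j v t))"
    by (intro sum_mono effect_perturb[OF M s])
  also have "\<dots> = (\<Sum>j\<in>J. Re (qf n M (B j v)) + s * nsq n (B j v)
      + (1 + 1 / s) * nsq n (B j (\<lambda>i. u i - c * v i)))"
    by (intro sum.cong refl) (simp add: qf_scale nsq_scale c(1) lin)
  also have "\<dots> = (\<Sum>j\<in>J. Re (qf n M (B j v))) + s * nsq P v + (1 + 1 / s) * nsq P (\<lambda>i. u i - c * v i)"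
    by (simp only: sum.distrib sum_distrib_left[symmetric] iso)
  also have "\<dots> \<le> (\<Sum>j\<in>J. Re (qf n M (B j v))) + s + (1 + 1 / s) * \<kappa>"
    using c(2) \<kappa> u(2) s by (simp add: mult_left_mono)
  finally show ?thesis .
qed

text \<open>Padding with zero vectors gives the commit channels for both bits the same Kraus index
  range, so that their purifications live in one common space.\<close>

definition hv :: "nat \<Rightarrow> complex mat list \<Rightarrow> (nat \<Rightarrow> complex) \<Rightarrow> nat \<Rightarrow> nat \<Rightarrow> complex" where
  "hv P Ks u i = (if i < length Ks then mvp P (mf (Ks ! i)) u else (\<lambda>_. 0))"

lemma sum_hv:
  assumes "length Ks \<le> M" "G (\<lambda>_. 0) = 0"
  shows "(\<Sum>i<M. G (hv P Ks u i)) = (\<Sum>K\<leftarrow>Ks. G (mvp P (mf K) u))"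
proof -
  have "(\<Sum>i<M. G (hv P Ks u i)) = (\<Sum>i<length Ks. G (mvp P (mf (Ks ! i)) u))"
    using assms by (intro sum.mono_neutral_cong_right) (auto simp: hv_def)
  then show ?thesis by (simp add: sum_list_sum_nth lessThan_atLeast0)
qed

lemma hv_lin: "hv P Ks (\<lambda>i. u i - c * v i) j = (\<lambda>t. hv P Ks u j t - c * hv P Ks v j t)"
  by (auto simp: hv_def mvp_def sum_distrib_left sum_subtractf right_diff_distrib mult_ac)

lemma hv_nsq:
  assumes "kraus P d Ks" "length Ks \<le> M"
  shows "(\<Sum>i<M. nsq d (hv P Ks u i)) = nsq P u"
  using sum_hv[OF assms(2), of "nsq d"] kraus_nsq[OF assms(1)] by (simp add: nsq_def[of d "\<lambda>_. 0"])

lemma nsq_slices: "nsq (n * q) h = (\<Sum>r<q. nsq n (\<lambda>c. h (c * q + r)))"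
  unfolding nsq_def sum_lessThan_mult by (rule sum.swap)

text \<open>A single probability: that the effect \<open>D\<close> accepts the commitment register
  after the channel \<open>Ks\<close> is applied to \<open>u\<close>. The Kraus index
  \<open>i\<close> and the reveal index \<open>r\<close> are traced out; only differences of two
  such values are advantages.\<close>

definition bias :: "nat \<Rightarrow> nat \<Rightarrow> nat \<Rightarrow> nat \<Rightarrow> (nat \<Rightarrow> nat \<Rightarrow> complex) \<Rightarrow> complex mat list \<Rightarrow> (nat \<Rightarrow> complex) \<Rightarrow> real" where
  "bias P n q M D Ks u = (\<Sum>i<M. \<Sum>r<q. Re (qf n D (\<lambda>c. hv P Ks u i (c * q + r))))"

lemma bias_bounds:
  assumes "effect n D" "kraus P (n * q) Ks" "length Ks \<le> M"
  shows "0 \<le> bias P n q M D Ks u" "bias P n q M D Ks u \<le> nsq P u"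
proof -
  show "0 \<le> bias P n q M D Ks u"
    using assms(1) by (auto simp: bias_def effect_def psdf_def intro!: sum_nonneg)
  have "bias P n q M D Ks u \<le> (\<Sum>i<M. \<Sum>r<q. nsq n (\<lambda>c. hv P Ks u i (c * q + r)))"
    unfolding bias_def using assms(1) by (intro sum_mono) (simp add: effect_def)
  also have "\<dots> = nsq P u" unfolding nsq_slices[symmetric] by (rule hv_nsq[OF assms(2,3)])
  finally show "bias P n q M D Ks u \<le> nsq P u" .
qed

lemma bias_perturb:
  assumes D: "effect n D" and Ks: "kraus P (n * q) Ks" "length Ks \<le> M" and s: "0 < s"
    and u: "nsq P u = 1" "nsq P v = 1" and \<kappa>: "(pdist P u v)\<^sup>2 \<le> \<kappa>"
  shows "bias P n q M D Ks u \<le> bias P n q M D Ks v + s + (1 + 1 / s) * \<kappa>"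
proof -
  define B where "B = (\<lambda>(i, r) u c. hv P Ks u i (c * q + r))"
  have b: "bias P n q M D Ks u = (\<Sum>j\<in>{..<M} \<times> {..<q}. Re (qf n D (B j u)))" for u
    unfolding bias_def sum.cartesian_product B_def by (simp add: case_prod_beta)
  have iso: "(\<Sum>j\<in>{..<M} \<times> {..<q}. nsq n (B j u)) = nsq P u" for u
    unfolding hv_nsq[OF Ks, symmetric] nsq_slices sum.cartesian_product B_def by (simp add: case_prod_beta)
  show ?thesis unfolding b
    by (rule effect_functional_perturb[OF D s _ iso u \<kappa>]) (auto simp: B_def hv_lin)
qed

text \<open>For a known key state u, the vectors \<zeta> purify the honest commitment to 0,
  the maps Kr turn them into the honest opening of 0 and, up to \<Delta>, into the honest opening of 1.\<close>
definition opening_attack where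
  "opening_attack P n q M C u \<zeta> Kr D \<Delta> \<longleftrightarrow>
    (\<Sum>c<n. \<Sum>s<n. (cmod (\<zeta> s c))\<^sup>2) = 1 \<and>
    (\<forall>b. \<forall>s<n. \<forall>t<n. (\<Sum>i<M. \<Sum>r<q. cnj (Kr b i r s) * Kr b i r t) = of_bool (s = t)) \<and>
    effect n D \<and> 0 \<le> \<Delta> \<and>
    (\<forall>b. (\<Sum>i<M. nsq (n * q) (\<lambda>t. \<Sum>s<n. Kr b i (t mod q) s * \<zeta> s (t div q))) = 1) \<and>
    (\<forall>i<M. \<forall>t<n * q. (\<Sum>s<n. Kr False i (t mod q) s * \<zeta> s (t div q)) = hv P (C False) u i t) \<and>
    (\<Sum>i<M. nsq (n * q) (\<lambda>t. hv P (C True) u i t - (\<Sum>s<n. Kr True i (t mod q) s * \<zeta> s (t div q)))) \<le> \<Delta> \<and>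
    \<Delta> \<le> 2 * (bias P n q M D (C False) u - bias P n q M D (C True) u)"

text \<open>Kraus index and reveal register together purify the commitment register. Uhlmann's
  isometry into this purifying space, sliced by Kraus index, becomes the Kraus operators of a
  channel to the reveal register; forgetting the index is what the honest channel does too.\<close>

lemma known_key_attack:
  fixes C :: "bool \<Rightarrow> complex mat list"
  assumes C: "\<And>b. kraus P (n * q) (C b)" "\<And>b. length (C b) \<le> M" and nM: "n \<le> M * q"
    and u: "nsq P u = 1"
  shows "\<exists>\<zeta> Kr D \<Delta>. opening_attack P n q M C u \<zeta> Kr D \<Delta>"
proof -
  \<comment> \<open>Conjugated so that the Gram matrix of the columns of \<open>X b\<close> is the
    reduced state of the commitment register itself and not its transpose.\<close>
  define X where "X = (\<lambda>b r c. cnj (hv P (C b) u (r div q) (c * q + r mod q)))"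
  have Xq: "X b (i * q + r) c = cnj (hv P (C b) u i (c * q + r))" if "r < q" for b i r c
    using that by (simp add: X_def)
  have norm: "(\<Sum>c<n. \<Sum>r<M * q. (cmod (X b r c))\<^sup>2) = 1" for b
  proof -
    have "(\<Sum>c<n. \<Sum>r<M * q. (cmod (X b r c))\<^sup>2) = (\<Sum>c<n. \<Sum>i<M. \<Sum>r<q. (cmod (hv P (C b) u i (c * q + r)))\<^sup>2)"
      unfolding sum_lessThan_mult by (intro sum.cong refl) (simp add: Xq)
    also have "\<dots> = (\<Sum>i<M. \<Sum>c<n. \<Sum>r<q. (cmod (hv P (C b) u i (c * q + r)))\<^sup>2)" by (rule sum.swap)
    also have "\<dots> = (\<Sum>i<M. nsq (n * q) (hv P (C b) u i))" by (simp add: nsq_def sum_lessThan_mult)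
    finally show ?thesis using hv_nsq[OF C] u by simp
  qed
  obtain Z W D where ZW: "\<And>b. isom n (M * q) (W b)"
    "\<And>b c r. c < n \<Longrightarrow> r < M * q \<Longrightarrow> mvp n (W b) (\<lambda>s. Z b s c) r = (if r < M * q then X b r c else 0)"
    "\<And>b. (\<Sum>c<n. \<Sum>s<n. (cmod (Z b s c))\<^sup>2) = 1"
    "effect n D" and ZW5:
    "(\<Sum>c<n. \<Sum>s<n. (cmod (Z False s c - Z True s c))\<^sup>2)
       \<le> 2 * (Re (\<Sum>r<M * q. qf n D (\<lambda>c. cnj (X False r c))) - Re (\<Sum>r<M * q. qf n D (\<lambda>c. cnj (X True r c))))"
    by (rule canonical_purifications[where n=n and a="M * q" and X=X and m="M * q", OF norm order_refl nM]) (rule that)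
  have ZW2: "mvp n (W b) (\<lambda>s. Z b s c) r = X b r c" if "c < n" "r < M * q" for b c r
    using ZW(2)[OF that] that by simp
  define \<Delta> where "\<Delta> = (\<Sum>c<n. \<Sum>s<n. (cmod (Z False s c - Z True s c))\<^sup>2)"
  \<comment> \<open>Both bits start from the purification for \<open>False\<close>, as the commit
    phase must not depend on the bit. The conjugation undoes the one in \<open>X\<close>.\<close>
  define \<zeta> where "\<zeta> = (\<lambda>s c. cnj (Z False s c))"
  define Kr where "Kr = (\<lambda>b i r s. cnj (W b (i * q + r) s))"
  define y where "y = (\<lambda>b i t. \<Sum>s<n. Kr b i (t mod q) s * \<zeta> s (t div q))"
  have y: "y b i (c * q + r) = cnj (mvp n (W b) (\<lambda>s. Z False s c) (i * q + r))" if "r < q" for b i c r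
    using that by (simp add: y_def Kr_def \<zeta>_def mvp_def)
  have tot: "(\<Sum>i<M. nsq (n * q) (f i)) = (\<Sum>c<n. nsq (M * q) (\<lambda>t. f (t div q) (c * q + t mod q)))"
    for f :: "nat \<Rightarrow> nat \<Rightarrow> complex"
  proof -
    have "(\<Sum>i<M. nsq (n * q) (f i)) = (\<Sum>c<n. \<Sum>i<M. \<Sum>r<q. (cmod (f i (c * q + r)))\<^sup>2)"
      unfolding nsq_def sum_lessThan_mult by (rule sum.swap)
    also have "\<dots> = (\<Sum>c<n. nsq (M * q) (\<lambda>t. f (t div q) (c * q + t mod q)))"
      unfolding nsq_def sum_lessThan_mult by (intro sum.cong refl) simp
    finally show ?thesis .
  qed
  have q: "t mod q < q" if "t < M * q" for t using that by (cases q) auto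
  have "(\<Sum>i<M. nsq (n * q) (y b i)) = 1" for b
  proof -
    have "(\<Sum>i<M. nsq (n * q) (y b i)) = (\<Sum>c<n. nsq (M * q) (mvp n (W b) (\<lambda>s. Z False s c)))"
      unfolding tot by (intro sum.cong refl) (simp add: nsq_def y q)
    then show ?thesis unfolding isom_nsq[OF ZW(1)] using ZW(3)[of False] by (simp add: nsq_def)
  qed
  moreover have "y False i t = hv P (C False) u i t" if "i < M" "t < n * q" for i t
  proof -
    have "0 < q" using that by (cases q) auto
    then have *: "t mod q < q" "t div q < n" using that by (auto simp: less_mult_imp_div_less)
    have "y False i (t div q * q + t mod q) = hv P (C False) u i (t div q * q + t mod q)"
      using that * by (simp only: y ZW2 index_lt Xq complex_cnj_cnj)
    then show ?thesis by simp
  qed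
  moreover have "(\<Sum>i<M. nsq (n * q) (\<lambda>t. hv P (C True) u i t - y True i t)) \<le> \<Delta>"
  proof -
    \<comment> \<open>The opening of \<open>True\<close> would be exact on the purification
      \<open>Z True\<close>; an isometry does not enlarge the error of using \<open>Z False\<close>
      instead.\<close>
    have "(\<Sum>i<M. nsq (n * q) (\<lambda>t. hv P (C True) u i t - y True i t))
       = (\<Sum>c<n. nsq (M * q) (mvp n (W True) (\<lambda>s. Z False s c - Z True s c)))"
      unfolding tot
    proof (intro sum.cong refl)
      fix c assume "c \<in> {..<n}"
      then have c: "c < n" by simp
      have "cmod (hv P (C True) u (t div q) (c * q + t mod q) - y True (t div q) (c * q + t mod q))
          = cmod (mvp n (W True) (\<lambda>s. Z False s c - Z True s c) t)" if t: "t < M * q" for t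
      proof -
        have "hv P (C True) u (t div q) (c * q + t mod q) = cnj (mvp n (W True) (\<lambda>s. Z True s c) t)"
          unfolding ZW2[OF c t] by (simp add: X_def)
        moreover have "y True (t div q) (c * q + t mod q) = cnj (mvp n (W True) (\<lambda>s. Z False s c) t)"
          using y[OF q[OF t], of True "t div q" c] by simp
        moreover have "mvp n (W True) (\<lambda>s. Z False s c - Z True s c) t
            = mvp n (W True) (\<lambda>s. Z False s c) t - mvp n (W True) (\<lambda>s. Z True s c) t"
          by (simp add: mvp_def right_diff_distrib sum_subtractf)
        ultimately show ?thesis by (metis complex_cnj_diff complex_mod_cnj norm_minus_commute)
      qed
      then show "nsq (M * q) (\<lambda>t. hv P (C True) u (t div q) (c * q + t mod q) - y True (t div q) (c * q + t mod q))
          = nsq (M * q) (mvp n (W True) (\<lambda>s. Z False s c - Z True s c))"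
        by (simp add: nsq_def)
    qed
    also have "\<dots> = \<Delta>" unfolding isom_nsq[OF ZW(1)] by (simp add: \<Delta>_def nsq_def)
    finally show ?thesis by simp
  qed
  moreover have "\<Delta> \<le> 2 * (bias P n q M D (C False) u - bias P n q M D (C True) u)"
  proof -
    have "Re (\<Sum>r<M * q. qf n D (\<lambda>c. cnj (X b r c))) = bias P n q M D (C b) u" for b
      unfolding bias_def sum_lessThan_mult Re_sum by (intro sum.cong refl) (simp add: Xq)
    then show ?thesis using ZW5 by (simp only: \<Delta>_def)
  qed
  moreover have "(\<Sum>i<M. \<Sum>r<q. cnj (Kr b i r s) * Kr b i r t) = of_bool (s = t)" if "s < n" "t < n" for b s t
  proof -
    have "(\<Sum>i<M. \<Sum>r<q. cnj (Kr b i r s) * Kr b i r t) = cnj (\<Sum>k<M * q. cnj (W b k s) * W b k t)"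
      unfolding sum_lessThan_mult by (simp add: Kr_def)
    also have "(\<Sum>k<M * q. cnj (W b k s) * W b k t) = of_bool (s = t)"
      using ZW(1)[of b] that by (simp add: isom_def)
    finally show ?thesis unfolding cnj_of_bool .
  qed
  moreover have "(\<Sum>c<n. \<Sum>s<n. (cmod (\<zeta> s c))\<^sup>2) = 1" using ZW(3)[of False] by (simp add: \<zeta>_def)
  moreover have "0 \<le> \<Delta>" by (simp add: \<Delta>_def sum_nonneg)
  ultimately have "opening_attack P n q M C u \<zeta> Kr D \<Delta>"
    unfolding opening_attack_def y_def by (intro conjI allI impI ZW(4)) auto
  then show ?thesis by blast
qed

text \<open>The number of copies that identify one of fewer than 2^q states up to distance 1/1000
  (for most states): clusters have separation 1 / (2000000 q), hence overlaps bounded by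
  1 - 1 / (8000000000000 q^2) in square.\<close>
definition copies :: "nat \<Rightarrow> nat" where
  "copies q = 2 * (8000000000000 * q\<^sup>2 * (q + 10))"

text \<open>With m the first factor of the exponent, 1 - 1/m is at most 1/(1 + 1/m), and Bernoulli's
  inequality makes the m-th power at most 1/2. The outer factor 2 in \<open>copies\<close> is absent
  because \<open>x\<close> is a squared overlap.\<close>

lemma overlap_power:
  assumes q: "0 < q" and x: "0 \<le> x" "x \<le> 1 - 1 / (8000000000000 * (real q)\<^sup>2)"
  shows "x ^ (8000000000000 * q\<^sup>2 * (q + 10)) \<le> (1 / 2) ^ (q + 10)"
proof -
  define m where "m = 8000000000000 * q\<^sup>2"
  have m: "0 < real m" "real m = 8000000000000 * (real q)\<^sup>2" using q by (auto simp: m_def)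
  have "x \<le> 1 - 1 / real m" using x m by simp
  also have "\<dots> \<le> 1 / (1 + 1 / real m)"
    using m(1) by (simp add: field_simps)
  finally have "x ^ m \<le> (1 / (1 + 1 / real m)) ^ m" using x by (intro power_mono)
  also have "\<dots> = 1 / (1 + 1 / real m) ^ m" by (simp add: power_one_over)
  also have "\<dots> \<le> 1 / 2"
  proof -
    have "1 + real m * (1 / real m) \<le> (1 + 1 / real m) ^ m"
      using m(1) by (intro Bernoulli_inequality) (simp add: divide_nonneg_pos order_trans[of _ 0])
    then have "2 \<le> (1 + 1 / real m) ^ m" using m(1) by simp
    then show ?thesis by (intro divide_left_mono) auto
  qed
  finally have "(x ^ m) ^ (q + 10) \<le> (1 / 2) ^ (q + 10)" using x by (intro power_mono) auto
  then show ?thesis by (simp only: power_mult[symmetric] m_def)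
qed

text \<open>Applies ball growing to the projector distance; the gap between clusters turns into
  exponentially small overlaps of the copies, small enough for a union bound over all pairs.\<close>

lemma clusters_exist:
  fixes u :: "'k \<Rightarrow> nat \<Rightarrow> complex"
  assumes K: "finite K" "card K < 2 ^ q" and q: "0 < q"
    and unit: "\<And>k. k \<in> K \<Longrightarrow> nsq P (u k) = 1"
  obtains N A g and lab :: "nat \<Rightarrow> 'k" where
    "A \<subseteq> K" "bij_betw g {..<N} A" "real (card (K - A)) \<le> real (card K) / 1000"
    "\<And>i j. i < N \<Longrightarrow> j < N \<Longrightarrow> lab i = lab j \<Longrightarrow> (pdist P (u (g i)) (u (g j)))\<^sup>2 \<le> 1 / 1000000"
    "(\<Sum>i<N. \<Sum>j<N. of_bool (lab i \<noteq> lab j) *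
        cmod (ip (P ^ copies q) (vpow P (u (g i)) (copies q)) (vpow P (u (g j)) (copies q)))) \<le> real N / 1000"
proof -
  \<comment> \<open>(1 + 1/1000)^1000 is at least 2, so this many shells grow beyond
    \<open>2 ^ q\<close> points.\<close>
  define I where "I = 1000 * q"
  \<comment> \<open>Chosen so that the cluster diameter \<open>2 * real I * \<theta>\<close> is
    exactly 1/1000.\<close>
  define \<theta> where "\<theta> = 1 / (2000000 * real q)"
  have \<theta>: "0 < \<theta>" using q by (simp add: \<theta>_def)
  have "(2::real) \<le> (1 + 1 / 1000) ^ 1000"
    using Bernoulli_inequality[of "1 / 1000" 1000] by simp
  then have "(2::real) ^ q \<le> ((1 + 1 / 1000) ^ 1000) ^ q" by (intro power_mono) auto
  also have "\<dots> = (1 + 1 / 1000) ^ I" by (simp only: I_def power_mult)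
  finally have "real (card K) < (1 + 1 / 1000) ^ I"
    using K(2) by (metis less_le_trans of_nat_less_iff of_nat_numeral of_nat_power)
  from ball_growing[OF K(1), of "\<lambda>x y. pdist P (u x) (u y)" "1 / 1000" \<theta> I, OF pdist_refl pdist_sym pdist_triangle _ \<theta> this]
  obtain A and lab :: "'k \<Rightarrow> 'k" where A: "A \<subseteq> K" "real (card (K - A)) \<le> 1 / 1000 * real (card K)"
    and cl0: "\<forall>x\<in>A. \<forall>y\<in>A.
      if lab x = lab y then pdist P (u x) (u y) \<le> 2 * real I * \<theta> else \<theta> \<le> pdist P (u x) (u y)"
    by auto
  note cl = cl0[rule_format]
  have finA: "finite A" using A(1) K(1) finite_subset by blast
  define N where "N = card A"
  obtain g where g: "bij_betw g {..<N} A"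
    using ex_bij_betw_nat_finite[OF finA] by (auto simp: N_def lessThan_atLeast0)
  have gA: "g i \<in> A" if "i < N" for i using g that by (auto simp: bij_betw_def)
  have near: "(pdist P (u (g i)) (u (g j)))\<^sup>2 \<le> 1 / 1000000" if "i < N" "j < N" "lab (g i) = lab (g j)" for i j
  proof -
    have "pdist P (u (g i)) (u (g j)) \<le> 1 / 1000"
      using cl[OF gA[OF that(1)] gA[OF that(2)]] that(3) q by (simp add: I_def \<theta>_def)
    moreover have "0 \<le> pdist P (u (g i)) (u (g j))" by (simp add: pdist_def L2_set_nonneg)
    ultimately have "(pdist P (u (g i)) (u (g j)))\<^sup>2 \<le> (1 / 1000)\<^sup>2" by (intro power_mono)
    then show ?thesis by (simp add: power2_eq_square)
  qed
  have far: "cmod (ip (P ^ copies q) (vpow P (u (g i)) (copies q)) (vpow P (u (g j)) (copies q))) \<le> (1 / 2) ^ (q + 10)"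
    if "i < N" "j < N" "lab (g i) \<noteq> lab (g j)" for i j
  proof -
    have un: "nsq P (u (g i)) = 1" "nsq P (u (g j)) = 1" using unit gA that A(1) by auto
    have "\<theta> \<le> pdist P (u (g i)) (u (g j))" using cl[OF gA[OF that(1)] gA[OF that(2)]] that(3) by simp
    then have "\<theta>\<^sup>2 \<le> (pdist P (u (g i)) (u (g j)))\<^sup>2" using \<theta> by (intro power_mono) auto
    then have "(cmod (ip P (u (g i)) (u (g j))))\<^sup>2 \<le> 1 - \<theta>\<^sup>2 / 2" unfolding pdist_sq[OF un] by simp
    also have "\<theta>\<^sup>2 / 2 = 1 / (8000000000000 * (real q)\<^sup>2)" by (simp add: \<theta>_def power2_eq_square)
    finally have "((cmod (ip P (u (g i)) (u (g j))))\<^sup>2) ^ (8000000000000 * q\<^sup>2 * (q + 10)) \<le> (1 / 2) ^ (q + 10)"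
      by (intro overlap_power q) auto
    then show ?thesis unfolding ip_vpow norm_power copies_def by (simp only: power_mult)
  qed
  have "(\<Sum>i<N. \<Sum>j<N. of_bool (lab (g i) \<noteq> lab (g j)) *
        cmod (ip (P ^ copies q) (vpow P (u (g i)) (copies q)) (vpow P (u (g j)) (copies q))))
      \<le> (\<Sum>i<N. \<Sum>j<N. (1 / 2) ^ (q + 10))"
  proof (intro sum_mono)
    fix i j assume "i \<in> {..<N}" "j \<in> {..<N}"
    then show "of_bool (lab (g i) \<noteq> lab (g j)) *
        cmod (ip (P ^ copies q) (vpow P (u (g i)) (copies q)) (vpow P (u (g j)) (copies q))) \<le> (1 / 2) ^ (q + 10)"
      using far[of i j] by (cases "lab (g i) = lab (g j)") auto
  qed
  \<comment> \<open>Origin of the 10 in \<open>copies\<close>: as N is at most \<open>2 ^ q\<close>,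
    each row sum is at most 1/1024.\<close>
  also have "\<dots> = real N * (real N * (1 / 2) ^ (q + 10))" by simp
  also have "\<dots> \<le> real N * (1 / 1000)"
  proof (intro mult_left_mono)
    have "N \<le> card K" unfolding N_def by (rule card_mono[OF K(1) A(1)])
    then have "real N \<le> 2 ^ q" using K(2) by (metis less_imp_le of_nat_le_iff of_nat_numeral of_nat_power order_trans)
    then have "real N * (1 / 2) ^ (q + 10) \<le> 2 ^ q * (1 / 2) ^ (q + 10)" by (intro mult_right_mono) auto
    also have "\<dots> = 1 / 1024" by (simp add: power_add power_one_over field_simps)
    finally show "real N * (1 / 2) ^ (q + 10) \<le> 1 / 1000" by simp
  qed simp
  finally show ?thesis
    using that[OF A(1) g, of "\<lambda>i. lab (g i)"] A(2) near by simp
qed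

section \<open>Acceptance and distinguishing probabilities\<close>

lemma Re_sum_list: "Re (\<Sum>x\<leftarrow>xs. f x) = (\<Sum>x\<leftarrow>xs. Re (f x))"
  by (induction xs) auto

text \<open>Operator r is the outer product of \<open>out r\<close> with row r of U: apply U,
  measure, and prepare a fresh unit state depending on the outcome.\<close>

lemma measure_prepare_kraus:
  assumes U: "isom d m U" and out: "\<And>r. r < m \<Longrightarrow> nsq D (out r) = 1"
  shows "kraus d D (map (\<lambda>r. mat D d (\<lambda>(t, i). out r t * U r i)) [0..<m])"
  unfolding kraus_iff
proof (intro conjI ballI allI impI)
  fix i j assume ij: "i < d" "j < d"
  have "(\<Sum>t<D. cnj (out r t * U r i) * (out r t * U r j)) = cnj (U r i) * U r j" if "r < m" for r
  proof -
    have "(\<Sum>t<D. cnj (out r t * U r i) * (out r t * U r j)) = ip D (out r) (out r) * (cnj (U r i) * U r j)"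
      unfolding ip_def sum_distrib_right by (intro sum.cong refl) simp
    then show ?thesis using out[OF that] by (simp add: ip_self)
  qed
  then show "(\<Sum>K\<leftarrow>map (\<lambda>r. mat D d (\<lambda>(t, i). out r t * U r i)) [0..<m].
      \<Sum>r<D. cnj (K $$ (r, i)) * K $$ (r, j)) = of_bool (i = j)"
    using U ij by (simp add: isom_def interv_sum_list_conv_sum_set_nat comp_def lessThan_atLeast0[symmetric])
qed auto

text \<open>The private register holds a guess p (index div n) and a purifying part (index mod n);
  the channel reads p and applies the p-th family to the rest.\<close>

lemma controlled_kraus:
  assumes "\<And>p s t. p < N \<Longrightarrow> s < n \<Longrightarrow> t < n \<Longrightarrow>
    (\<Sum>i<M. \<Sum>r<q. cnj (Kr p i r s) * Kr p i r t) = of_bool (s = t)"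
  shows "kraus (N * n) q (concat (map (\<lambda>p. map (\<lambda>i. mat q (N * n)
    (\<lambda>(r, j). of_bool (j div n = p) * Kr p i r (j mod n))) [0..<M]) [0..<N]))"
  unfolding kraus_iff
proof (intro conjI ballI allI impI)
  fix a b assume ab: "a < N * n" "b < N * n"
  then have n: "0 < n" by (cases n) auto
  then have lt: "a div n < N" "b div n < N" "a mod n < n" "b mod n < n"
    using ab by (auto simp: less_mult_imp_div_less)
  have "(\<Sum>K\<leftarrow>concat (map (\<lambda>p. map (\<lambda>i. mat q (N * n)
    (\<lambda>(r, j). of_bool (j div n = p) * Kr p i r (j mod n))) [0..<M]) [0..<N]).
      \<Sum>r<q. cnj (K $$ (r, a)) * K $$ (r, b))
    = (\<Sum>p<N. \<Sum>i<M. \<Sum>r<q. cnj (of_bool (a div n = p) * Kr p i r (a mod n)) * (of_bool (b div n = p) * Kr p i r (b mod n)))"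
    unfolding sum_list_concat_map using ab
    by (simp add: interv_sum_list_conv_sum_set_nat lessThan_atLeast0[symmetric]
        del: sum_of_bool_mult_eq sum_mult_of_bool_eq)
  also have "\<dots> = (\<Sum>p<N. of_bool (p = a div n) * (of_bool (b div n = p) * (\<Sum>i<M. \<Sum>r<q. cnj (Kr p i r (a mod n)) * Kr p i r (b mod n))))"
    unfolding sum_distrib_left by (intro sum.cong refl) (simp add: cnj_of_bool of_bool_def)
  also have "\<dots> = of_bool (b div n = a div n) * of_bool (a mod n = b mod n)"
    unfolding sum_delta_left[OF lt(1)] assms[OF lt(1,3,4)] ..
  also have "\<dots> = of_bool (a = b)"
  proof -
    have "(b div n = a div n \<and> a mod n = b mod n) = (a = b)" by (metis div_mult_mod_eq)
    then show ?thesis unfolding of_bool_conj[symmetric] by simp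
  qed
  finally show "(\<Sum>K\<leftarrow>concat (map (\<lambda>p. map (\<lambda>i. mat q (N * n)
    (\<lambda>(r, j). of_bool (j div n = p) * Kr p i r (j mod n))) [0..<M]) [0..<N]).
      \<Sum>r<q. cnj (K $$ (r, a)) * K $$ (r, b)) = of_bool (a = b)" .
qed auto

text \<open>The distinguisher's effect: measure a guess p on the copies through \<open>U\<close>,
  then test the commitment with \<open>D p\<close>. Outcomes from \<open>N\<close> on
  reject.\<close>

definition ceff :: "nat \<Rightarrow> nat \<Rightarrow> (nat \<Rightarrow> nat \<Rightarrow> complex) \<Rightarrow> (nat \<Rightarrow> nat \<Rightarrow> nat \<Rightarrow> complex) \<Rightarrow> nat \<Rightarrow> nat \<Rightarrow> complex" where
  "ceff N n U D = (\<lambda>i j. \<Sum>p<N. cnj (U p (i div n)) * U p (j div n) * D p (i mod n) (j mod n))"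

lemma qf_ceff: "qf (d * n) (ceff N n U D) z = (\<Sum>p<N. qf n (D p) (\<lambda>c. \<Sum>a<d. U p a * z (a * n + c)))"
proof -
  let ?f = "\<lambda>p a c a' c'. cnj (U p a * z (a * n + c)) * D p c c' * (U p a' * z (a' * n + c'))"
  have "qf (d * n) (ceff N n U D) z = (\<Sum>a<d. \<Sum>c<n. \<Sum>a'<d. \<Sum>c'<n. \<Sum>p<N. ?f p a c a' c')"
    unfolding qf_sum sum_lessThan_mult ceff_def sum_distrib_left sum_distrib_right
    by (intro sum.cong refl) (simp add: mult_ac)
  also have "\<dots> = (\<Sum>a<d. \<Sum>c<n. \<Sum>a'<d. \<Sum>p<N. \<Sum>c'<n. ?f p a c a' c')"
    by (intro sum.cong[OF refl] sum.swap)
  also have "\<dots> = (\<Sum>a<d. \<Sum>c<n. \<Sum>p<N. \<Sum>a'<d. \<Sum>c'<n. ?f p a c a' c')"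
    by (intro sum.cong[OF refl] sum.swap)
  also have "\<dots> = (\<Sum>a<d. \<Sum>p<N. \<Sum>c<n. \<Sum>a'<d. \<Sum>c'<n. ?f p a c a' c')"
    by (intro sum.cong[OF refl] sum.swap)
  also have "\<dots> = (\<Sum>p<N. \<Sum>a<d. \<Sum>c<n. \<Sum>a'<d. \<Sum>c'<n. ?f p a c a' c')"
    by (rule sum.swap)
  also have "\<dots> = (\<Sum>p<N. \<Sum>c<n. \<Sum>a<d. \<Sum>a'<d. \<Sum>c'<n. ?f p a c a' c')"
    by (intro sum.cong[OF refl] sum.swap)
  also have "\<dots> = (\<Sum>p<N. \<Sum>c<n. \<Sum>a<d. \<Sum>c'<n. \<Sum>a'<d. ?f p a c a' c')"
    by (intro sum.cong[OF refl] sum.swap)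
  also have "\<dots> = (\<Sum>p<N. \<Sum>c<n. \<Sum>c'<n. \<Sum>a<d. \<Sum>a'<d. ?f p a c a' c')"
    by (intro sum.cong[OF refl] sum.swap)
  also have "\<dots> = (\<Sum>p<N. \<Sum>c<n. \<Sum>c'<n. \<Sum>a'<d. \<Sum>a<d. ?f p a c a' c')"
    by (intro sum.cong[OF refl] sum.swap)
  also have "\<dots> = (\<Sum>p<N. qf n (D p) (\<lambda>c. \<Sum>a<d. U p a * z (a * n + c)))"
    unfolding qf_sum cnj_sum sum_distrib_left sum_distrib_right ..
  finally show ?thesis .
qed

lemma effect_ceff:
  assumes U: "isom d m U" and N: "N \<le> m" and D: "\<And>p. p < N \<Longrightarrow> effect n (D p)"
  shows "effect (d * n) (ceff N n U D)"
proof -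
  have "(\<Sum>p<N. Re (qf n (D p) (\<lambda>c. \<Sum>a<d. U p a * z (a * n + c)))) \<le> nsq (d * n) z" for z
  proof -
    have "(\<Sum>p<N. Re (qf n (D p) (\<lambda>c. \<Sum>a<d. U p a * z (a * n + c))))
        \<le> (\<Sum>p<N. nsq n (\<lambda>c. \<Sum>a<d. U p a * z (a * n + c)))"
      using D by (intro sum_mono) (simp add: effect_def)
    also have "\<dots> \<le> (\<Sum>p<m. nsq n (\<lambda>c. \<Sum>a<d. U p a * z (a * n + c)))"
      using N by (intro sum_mono2) auto
    also have "\<dots> = (\<Sum>c<n. nsq m (mvp d U (\<lambda>a. z (a * n + c))))"
      unfolding nsq_def mvp_def by (rule sum.swap)
    also have "\<dots> = (\<Sum>c<n. nsq d (\<lambda>a. z (a * n + c)))" by (simp add: isom_nsq[OF U])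
    also have "\<dots> = nsq (d * n) z" unfolding nsq_def sum_lessThan_mult by (rule sum.swap)
    finally show ?thesis .
  qed
  then show ?thesis
    using D by (auto simp: effect_def psdf_def qf_ceff intro!: sum_nonneg sum.neutral)
qed

lemma qf_ceff_tens:
  "qf (d * n) (ceff N n U D) (tens n v y) = (\<Sum>p<N. of_real ((cmod (mvp d U v p))\<^sup>2) * qf n (D p) y)"
proof -
  have "qf n (D p) (\<lambda>c. \<Sum>a<d. U p a * tens n v y (a * n + c)) = of_real ((cmod (mvp d U v p))\<^sup>2) * qf n (D p) y" for p
  proof -
    have "qf n (D p) (\<lambda>c. \<Sum>a<d. U p a * tens n v y (a * n + c)) = qf n (D p) (\<lambda>c. mvp d U v p * y c)"
      by (intro qf_cong) (simp add: tens_def mvp_def sum_distrib_right mult.assoc)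
    then show ?thesis unfolding qf_scale .
  qed
  then show ?thesis unfolding qf_ceff by simp
qed

section \<open>Probabilities of the scheme as sums of quadratic forms\<close>

lemma rep_map: "rep n \<rho> (concat (map (\<lambda>x. map (f x) [y]) xs)) = rep n \<rho> (map (\<lambda>x. f x y) xs)"
proof -
  have "concat (map (\<lambda>x. map (f x) [y]) xs) = map (\<lambda>x. f x y) xs" by (induction xs) auto
  then show ?thesis by simp
qed

lemma rep_commit_state:
  assumes "kraus (dPsi S lam) (dC S lam * dR S lam) (com S lam b)" "psi S lam k \<in> carrier_vec (dPsi S lam)"
  shows "rep (dC S lam * dR S lam) (commit_state S lam k b)
    (map (\<lambda>K. mvp (dPsi S lam) (mf K) (($) (psi S lam k))) (com S lam b))"
  using rep_apply_kraus[OF _ rep_proj[OF assms(2)], of "com S lam b" "dC S lam * dR S lam"] assms(1)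
  unfolding commit_state_def rep_map by (simp add: kraus_def)

lemma accept_eq:
  assumes "kraus (dPsi S lam) (dC S lam * dR S lam) (com S lam b)" "psi S lam k \<in> carrier_vec (dPsi S lam)"
    "ver S lam b \<in> carrier_mat (dC S lam * dR S lam * dPsi S lam) (dC S lam * dR S lam * dPsi S lam)"
  shows "qtr (ver S lam b * kron (commit_state S lam k b) (proj (psi S lam k)))
    = (\<Sum>K\<leftarrow>com S lam b. qf (dC S lam * dR S lam * dPsi S lam) (mf (ver S lam b))
        (tens (dPsi S lam) (mvp (dPsi S lam) (mf K) (($) (psi S lam k))) (($) (psi S lam k))))"
proof -
  have "rep (dC S lam * dR S lam * dPsi S lam) (kron (commit_state S lam k b) (proj (psi S lam k)))
      (map (\<lambda>x. tens (dPsi S lam) x (($) (psi S lam k))) (map (\<lambda>K. mvp (dPsi S lam) (mf K) (($) (psi S lam k))) (com S lam b)))"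
    using rep_kron[OF rep_commit_state[OF assms(1,2)] rep_proj[OF assms(2)]] unfolding rep_map .
  from qtr_rep[OF assms(3) this] show ?thesis by (simp add: comp_def)
qed

lemma hide_prob_eq:
  assumes "kraus (dPsi S lam) (dC S lam * dR S lam) (com S lam b)"
    and psi: "\<And>k. k \<in> keys S lam \<Longrightarrow> psi S lam k \<in> carrier_vec (dPsi S lam)"
    and D: "D \<in> carrier_mat (dPsi S lam ^ t * dC S lam) (dPsi S lam ^ t * dC S lam)"
  shows "hide_prob S t lam D b = avg_key S lam (\<lambda>k. \<Sum>K\<leftarrow>com S lam b. \<Sum>r<dR S lam.
    Re (qf (dPsi S lam ^ t * dC S lam) (mf D) (tens (dC S lam) (vpow (dPsi S lam) (($) (psi S lam k)) t)
      (\<lambda>c. mvp (dPsi S lam) (mf K) (($) (psi S lam k)) (c * dR S lam + r)))))"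
proof -
  have "Re (qtr (D * kron (kpow (proj (psi S lam k)) t) (ptrace2 (dC S lam) (dR S lam) (commit_state S lam k b))))
    = (\<Sum>K\<leftarrow>com S lam b. \<Sum>r<dR S lam.
    Re (qf (dPsi S lam ^ t * dC S lam) (mf D) (tens (dC S lam) (vpow (dPsi S lam) (($) (psi S lam k)) t)
      (\<lambda>c. mvp (dPsi S lam) (mf K) (($) (psi S lam k)) (c * dR S lam + r)))))" if "k \<in> keys S lam" for k
  proof -
    note R = rep_kron[OF rep_kpow[OF psi[OF that], of t] rep_ptrace2[OF rep_commit_state[OF assms(1) psi[OF that]]]]
    have "qtr (D * kron (kpow (proj (psi S lam k)) t) (ptrace2 (dC S lam) (dR S lam) (commit_state S lam k b)))
      = (\<Sum>K\<leftarrow>com S lam b. \<Sum>r\<leftarrow>[0..<dR S lam].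
      qf (dPsi S lam ^ t * dC S lam) (mf D) (tens (dC S lam) (vpow (dPsi S lam) (($) (psi S lam k)) t)
      (\<lambda>c. mvp (dPsi S lam) (mf K) (($) (psi S lam k)) (c * dR S lam + r))))"
      unfolding qtr_rep[OF D R] sum_list_concat_map
      by (simp add: sum_list_concat_map comp_def)
    then show ?thesis
      by (simp add: Re_sum_list interv_sum_list_conv_sum_set_nat lessThan_atLeast0)
  qed
  then show ?thesis unfolding hide_prob_def avg_key_def by simp
qed

lemma bind_prob_eq:
  assumes Phi: "kraus (dPsi S lam ^ t) (dC S lam * dE) Phi" and Rev: "kraus dE (dR S lam) Rev"
    and psi: "\<And>k. k \<in> keys S lam \<Longrightarrow> psi S lam k \<in> carrier_vec (dPsi S lam)"
    and V: "ver S lam b \<in> carrier_mat (dC S lam * dR S lam * dPsi S lam) (dC S lam * dR S lam * dPsi S lam)"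
  shows "bind_prob S t lam dE Phi Rev b = avg_key S lam (\<lambda>k. \<Sum>R\<leftarrow>Rev. \<Sum>L\<leftarrow>Phi.
    Re (qf (dC S lam * dR S lam * dPsi S lam) (mf (ver S lam b))
      (tens (dPsi S lam) (mvp (dC S lam * dE) (mf (kron (1\<^sub>m (dC S lam)) R))
         (mvp (dPsi S lam ^ t) (mf L) (vpow (dPsi S lam) (($) (psi S lam k)) t))) (($) (psi S lam k)))))"
proof -
  have "Re (qtr (ver S lam b *
       kron (apply_kraus (dC S lam * dR S lam) (map (\<lambda>K. kron (1\<^sub>m (dC S lam)) K) Rev)
               (apply_kraus (dC S lam * dE) Phi (kpow (proj (psi S lam k)) t)))
            (proj (psi S lam k))))
    = (\<Sum>R\<leftarrow>Rev. \<Sum>L\<leftarrow>Phi.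
    Re (qf (dC S lam * dR S lam * dPsi S lam) (mf (ver S lam b))
      (tens (dPsi S lam) (mvp (dC S lam * dE) (mf (kron (1\<^sub>m (dC S lam)) R))
         (mvp (dPsi S lam ^ t) (mf L) (vpow (dPsi S lam) (($) (psi S lam k)) t))) (($) (psi S lam k)))))"
    if k: "k \<in> keys S lam" for k
  proof -
    let ?Phi = "apply_kraus (dC S lam * dE) Phi (kpow (proj (psi S lam k)) t)"
    let ?Rev = "map (\<lambda>K. kron (1\<^sub>m (dC S lam)) K) Rev"
    have 1: "rep (dC S lam * dE) ?Phi (map (\<lambda>L. mvp (dPsi S lam ^ t) (mf L) (vpow (dPsi S lam) (($) (psi S lam k)) t)) Phi)"
      using rep_apply_kraus[OF _ rep_kpow[OF psi[OF k]], of Phi] Phi unfolding rep_map by (simp add: kraus_def)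
    have 2: "K \<in> carrier_mat (dC S lam * dR S lam) (dC S lam * dE)" if "K \<in> set ?Rev" for K
      using that Rev by (auto simp: kraus_def kron_def)
    note R = rep_kron[OF rep_apply_kraus[OF 2 1] rep_proj[OF psi[OF k]]]
    note Q = qtr_rep[OF V R]
    have "qtr (ver S lam b *
       kron (apply_kraus (dC S lam * dR S lam) ?Rev ?Phi) (proj (psi S lam k)))
      = (\<Sum>R\<leftarrow>Rev. \<Sum>L\<leftarrow>Phi.
        qf (dC S lam * dR S lam * dPsi S lam) (mf (ver S lam b))
      (tens (dPsi S lam) (mvp (dC S lam * dE) (mf (kron (1\<^sub>m (dC S lam)) R))
         (mvp (dPsi S lam ^ t) (mf L) (vpow (dPsi S lam) (($) (psi S lam k)) t))) (($) (psi S lam k))))"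
      by (subst Q) (assumption, simp add: sum_list_concat_map comp_def)
    then show ?thesis by (simp add: Re_sum_list)
  qed
  then show ?thesis unfolding bind_prob_def avg_key_def by simp
qed

section \<open>The committer that guesses the key\<close>

text \<open>Distinguisher and committer are built from the same guess. The hiding bound is a premise
  inside the conclusion because the distinguisher must be fixed for every security parameter before
  hiding says anything about it.\<close>

lemma attack_exists:
  fixes S :: crqs_scheme and lam q :: nat
  defines "K \<equiv> keys S lam" and "P \<equiv> dPsi S lam" and "n \<equiv> dC S lam" and "r \<equiv> dR S lam"
    and "T \<equiv> copies q"
  assumes K: "finite K" "K \<noteq> {}" "card K < 2 ^ q" and q: "0 < q"
    and unit: "\<And>k. k \<in> K \<Longrightarrow> unit_state P (psi S lam k)"
    and com: "\<And>b. kraus P (n * r) (com S lam b)"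
    and ver: "\<And>b. povm_elem (n * r * P) (ver S lam b)"
    and corr: "\<And>k b. k \<in> K \<Longrightarrow> qtr (ver S lam b * kron (commit_state S lam k b) (proj (psi S lam k))) = 1"
  shows "\<exists>dE Phi Rev D. kraus (P ^ T) (n * dE) Phi \<and> (\<forall>b. kraus dE r (Rev b)) \<and> povm_elem (P ^ T * n) D \<and>
    (\<bar>hide_prob S T lam D False - hide_prob S T lam D True\<bar> \<le> 1 / 1000 \<longrightarrow>
      14 / 10 \<le> bind_prob S T lam dE Phi (Rev False) False + bind_prob S T lam dE Phi (Rev True) True)"
proof -
  define d where "d = P ^ T"
  define u where "u = (\<lambda>k. ($) (psi S lam k))"
  define v where "v = (\<lambda>k. vpow P (u k) T)"
  define C where "C = com S lam"
  define V where "V = (\<lambda>b. mf (ver S lam b))"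
  \<comment> \<open>Large enough for both Kraus lists; the summand \<open>n\<close> ensures that the
    purifying space of dimension \<open>M * r\<close> has room for an isometry from dimension
    \<open>n\<close>.\<close>
  define M where "M = length (C False) + length (C True) + n"
  have r: "1 \<le> r" by (simp add: r_def)
  have n: "1 \<le> n" by (simp add: n_def)
  have nM: "n \<le> M * r" using mult_le_mono[of n M 1 r] r by (simp add: M_def)
  have CM: "length (C b) \<le> M" for b by (cases b) (simp_all add: M_def)
  have CK: "kraus P (n * r) (C b)" for b using com by (simp add: C_def)
  have uc: "psi S lam k \<in> carrier_vec P" and u1: "nsq P (u k) = 1" if "k \<in> K" for k
    using unit[OF that] by (auto simp: unit_state_iff u_def)
  have v1: "nsq d (v k) = 1" if "k \<in> K" for k
    unfolding d_def v_def by (rule nsq_vpow[OF u1[OF that]])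
  have Vc: "ver S lam b \<in> carrier_mat (n * r * P) (n * r * P)" and Ve: "effect (n * r * P) (V b)" for b
    using ver by (auto simp: povm_elem_iff V_def)

  obtain N A g and lab :: "nat \<Rightarrow> bool list" where
    A: "A \<subseteq> K" "bij_betw g {..<N} A" "real (card (K - A)) \<le> real (card K) / 1000"
    and near: "\<And>i j. i < N \<Longrightarrow> j < N \<Longrightarrow> lab i = lab j \<Longrightarrow> (pdist P (u (g i)) (u (g j)))\<^sup>2 \<le> 1 / 1000000"
    and far: "(\<Sum>i<N. \<Sum>j<N. of_bool (lab i \<noteq> lab j) * cmod (ip d (v (g i)) (v (g j)))) \<le> real N / 1000"
    by (rule clusters_exist[OF K(1,3) q u1]) (assumption, (rule that; (unfold d_def v_def T_def)?; assumption))
  have gK: "g i \<in> K" if "i < N" for i using A that by (auto simp: bij_betw_def)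
  have "A \<noteq> {}"
  proof
    assume "A = {}"
    then have "real (card K) \<le> real (card K) / 1000" using A(3) by simp
    then show False using K by simp
  qed
  then have N0: "0 < N" using A(2) by (metis bij_betw_empty1 bot_nat_0.not_eq_extremum lessThan_0)

  \<comment> \<open>Any dimension that is at least both \<open>N\<close> and \<open>d\<close> would
    do.\<close>
  define m where "m = N + d"
  obtain U where U: "isom d m U"
    "\<And>k s. k < N \<Longrightarrow> N \<le> s \<Longrightarrow> s < m \<Longrightarrow> mvp d U (v (g k)) s = 0"
    "\<And>s. s < N \<Longrightarrow> (\<Sum>k<N. (cmod (mvp d U (v (g k)) s))\<^sup>2) = 1"
    "(\<Sum>k<N. \<Sum>s<N. of_bool (lab k \<noteq> lab s) * (cmod (mvp d U (v (g k)) s))\<^sup>2)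
       \<le> (\<Sum>k<N. \<Sum>s<N. of_bool (lab k \<noteq> lab s) * cmod (ip d (v (g k)) (v (g s))))"
    by (rule pretty_good_measurement[of N d "\<lambda>i. v (g i)" m lab]) (simp_all add: v1 gK m_def that)
  define w where "w = (\<lambda>k s. (cmod (mvp d U (v k) s))\<^sup>2)"

  have "\<exists>\<zeta> Kr D \<Delta>. p < N \<longrightarrow> opening_attack P n r M C (u (g p)) \<zeta> Kr D \<Delta>" for p
  proof (cases "p < N")
    case True
    have "\<exists>\<zeta> Kr D \<Delta>. opening_attack P n r M C (u (g p)) \<zeta> Kr D \<Delta>"
      by (rule known_key_attack[OF CK CM nM u1[OF gK[OF True]]])
    then show ?thesis by blast
  qed simp
  then obtain \<zeta> Kr D \<Delta> where att: "\<And>p. p < N \<Longrightarrow> opening_attack P n r M C (u (g p)) (\<zeta> p) (Kr p) (D p) (\<Delta> p)"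
    by metis
  have \<zeta>1: "(\<Sum>c<n. \<Sum>s<n. (cmod (\<zeta> p s c))\<^sup>2) = 1"
    and Kr1: "s < n \<Longrightarrow> t < n \<Longrightarrow> (\<Sum>i<M. \<Sum>l<r. cnj (Kr p b i l s) * Kr p b i l t) = of_bool (s = t)"
    and De: "effect n (D p)" and \<Delta>0: "0 \<le> \<Delta> p" if "p < N" for p b s t
    using att[OF that] by (auto simp: opening_attack_def)
  define y where "y = (\<lambda>p b i t. \<Sum>s<n. Kr p b i (t mod r) s * \<zeta> p s (t div r))"
  have y1: "(\<Sum>i<M. nsq (n * r) (y p b i)) = 1"
    and yF: "i < M \<Longrightarrow> t < n * r \<Longrightarrow> y p False i t = hv P (C False) (u (g p)) i t"
    and yT: "(\<Sum>i<M. nsq (n * r) (\<lambda>t. hv P (C True) (u (g p)) i t - y p True i t)) \<le> \<Delta> p"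
    and \<Delta>b: "\<Delta> p \<le> 2 * (bias P n r M (D p) (C False) (u (g p)) - bias P n r M (D p) (C True) (u (g p)))"
    if "p < N" for p b i t
    using att[OF that] by (auto simp: opening_attack_def y_def)

  define dE where "dE = N * n"
  \<comment> \<open>Outcomes from \<open>N\<close> on have probability zero for clustered keys; for
    the discarded keys they default to guess 0, which exists because \<open>N\<close> is
    positive.\<close>
  define ob where "ob = (\<lambda>p. if p < N then p else 0)"
  have ob: "ob p < N" for p using N0 by (simp add: ob_def)
  \<comment> \<open>The state sent and stored for guess p: index t splits into commitment, guess and
    purifier, with the guess register in the basis state \<open>ob p\<close> and the rest in the
    purification.\<close>
  define out where "out = (\<lambda>p t. of_bool (t mod dE div n = ob p) * \<zeta> (ob p) (t mod dE mod n) (t div dE))"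
  have out_split: "out p (c * dE + (p' * n + s)) = of_bool (p' = ob p) * \<zeta> (ob p) s c"
    if "p' < N" "s < n" for p c p' s
    using index_lt[OF that] that by (simp add: out_def dE_def)
  have out1: "nsq (n * dE) (out p) = 1" for p
  proof -
    have "nsq (n * dE) (out p) = (\<Sum>c<n. \<Sum>p'<N. \<Sum>s<n. (cmod (of_bool (p' = ob p) * \<zeta> (ob p) s c))\<^sup>2)"
      unfolding nsq_def sum_lessThan_mult[of _ n dE] unfolding dE_def sum_lessThan_mult[of _ N n]
      by (intro sum.cong refl) (simp add: out_split[unfolded dE_def])
    also have "\<dots> = (\<Sum>c<n. \<Sum>p'<N. if p' = ob p then (\<Sum>s<n. (cmod (\<zeta> (ob p) s c))\<^sup>2) else 0)"
      by (intro sum.cong refl) auto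
    also have "\<dots> = 1" using \<zeta>1[OF ob] ob by simp
    finally show ?thesis .
  qed
  define Phi where "Phi = map (\<lambda>p. mat (n * dE) d (\<lambda>(t, i). out p t * U p i)) [0..<m]"
  define Rev where "Rev = (\<lambda>b. concat (map (\<lambda>p. map (\<lambda>i. mat r dE
    (\<lambda>(l, j). of_bool (j div n = p) * Kr p b i l (j mod n))) [0..<M]) [0..<N]))"
  define Dm where "Dm = mat (d * n) (d * n) (\<lambda>(i, j). ceff N n U D i j)"
  have PhiK: "kraus d (n * dE) Phi"
    unfolding Phi_def by (rule measure_prepare_kraus[OF U(1) out1])
  have RevK: "kraus dE r (Rev b)" for b
    unfolding Rev_def dE_def by (rule controlled_kraus[OF Kr1])
  have qfD: "qf (d * n) (mf Dm) z = qf (d * n) (ceff N n U D) z" for z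
    unfolding qf_sum by (simp add: Dm_def mf_def)
  have DmP: "povm_elem (d * n) Dm"
    unfolding povm_elem_iff
  proof
    show "Dm \<in> carrier_mat (d * n) (d * n)" by (simp add: Dm_def)
    have "effect (d * n) (ceff N n U D)" by (rule effect_ceff[OF U(1) _ De]) (simp add: m_def)
    then show "effect (d * n) (mf Dm)" by (simp add: effect_def psdf_def qfD)
  qed

  \<comment> \<open>Probability that bit b opened with guess p is accepted by a receiver whose own
    copy belongs to key k.\<close>
  define f where "f = (\<lambda>p b k. \<Sum>i<M. Re (qf (n * r * P) (V b) (tens P (y p b i) (u k))))"
  define H where "H = (\<lambda>p k. bias P n r M (D p) (C False) (u k) - bias P n r M (D p) (C True) (u k))"
  define F where "F = (\<lambda>k p. f (ob p) False k + f (ob p) True k)"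

  have hide_eq: "hide_prob S T lam Dm b = avg_key S lam (\<lambda>k. \<Sum>p<N. w k p * bias P n r M (D p) (C b) (u k))" for b
  proof -
    have "(\<Sum>L\<leftarrow>C b. \<Sum>l<r. Re (qf (d * n) (mf Dm) (tens n (v k) (\<lambda>c. mvp P (mf L) (u k) (c * r + l)))))
        = (\<Sum>p<N. w k p * bias P n r M (D p) (C b) (u k))" for k
    proof -
      have "(\<Sum>L\<leftarrow>C b. \<Sum>l<r. Re (qf (d * n) (mf Dm) (tens n (v k) (\<lambda>c. mvp P (mf L) (u k) (c * r + l)))))
        = (\<Sum>L\<leftarrow>C b. \<Sum>l<r. \<Sum>p<N. w k p * Re (qf n (D p) (\<lambda>c. mvp P (mf L) (u k) (c * r + l))))"
        unfolding qfD qf_ceff_tens by (simp add: w_def)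
      also have "\<dots> = (\<Sum>L\<leftarrow>C b. \<Sum>p<N. \<Sum>l<r. w k p * Re (qf n (D p) (\<lambda>c. mvp P (mf L) (u k) (c * r + l))))"
        by (intro arg_cong[of _ _ sum_list] map_cong refl sum.swap)
      also have "\<dots> = (\<Sum>p<N. \<Sum>L\<leftarrow>C b. \<Sum>l<r. w k p * Re (qf n (D p) (\<lambda>c. mvp P (mf L) (u k) (c * r + l))))"
        by (rule sum_sum_list_swap[symmetric])
      also have "\<dots> = (\<Sum>p<N. w k p * bias P n r M (D p) (C b) (u k))"
      proof (intro sum.cong refl)
        fix p
        have "bias P n r M (D p) (C b) (u k) = (\<Sum>L\<leftarrow>C b. \<Sum>l<r. Re (qf n (D p) (\<lambda>c. mvp P (mf L) (u k) (c * r + l))))"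
          unfolding bias_def
          by (rule sum_hv[OF CM, of "\<lambda>x. \<Sum>l<r. Re (qf n (D p) (\<lambda>c. x (c * r + l)))"]) (simp add: qf_sum)
        then show "(\<Sum>L\<leftarrow>C b. \<Sum>l<r. w k p * Re (qf n (D p) (\<lambda>c. mvp P (mf L) (u k) (c * r + l))))
           = w k p * bias P n r M (D p) (C b) (u k)"
          by (simp add: sum_distrib_left[symmetric] sum_list_const_mult)
      qed
      finally show ?thesis .
    qed
    then show ?thesis
      using hide_prob_eq[of S lam b Dm T] com uc DmP
      unfolding povm_elem_iff C_def[symmetric] u_def[symmetric] K_def[symmetric] P_def[symmetric]
        n_def[symmetric] r_def[symmetric] d_def[symmetric] v_def[symmetric]
      by (simp add: C_def d_def u_def v_def)
  qed

  have bind_eq: "bind_prob S T lam dE Phi (Rev b) b = avg_key S lam (\<lambda>k. \<Sum>p<m. w k p * f (ob p) b k)" for b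
  proof -
    have R: "(\<Sum>R\<leftarrow>Rev b. G R) = (\<Sum>p'<N. \<Sum>i<M. G (mat r dE (\<lambda>(l, j). of_bool (j div n = p') * Kr p' b i l (j mod n))))"
      for G :: "complex mat \<Rightarrow> real"
      unfolding Rev_def sum_list_concat_map by (simp add: interv_sum_list_conv_sum_set_nat lessThan_atLeast0)
    have L: "(\<Sum>L\<leftarrow>Phi. G L) = (\<Sum>p<m. G (mat (n * dE) d (\<lambda>(t, i). out p t * U p i)))"
      for G :: "complex mat \<Rightarrow> real"
      unfolding Phi_def by (simp add: interv_sum_list_conv_sum_set_nat lessThan_atLeast0 comp_def)
    \<comment> \<open>An opening operator for p' sees the guess stored in the register and
      annihilates every state with another guess; what remains is the known-key opening scaled by
      the amplitude of outcome p.\<close>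
    have summand: "Re (qf (n * r * P) (V b) (tens P (mvp (n * dE)
         (mf (kron (1\<^sub>m n) (mat r dE (\<lambda>(l, j). of_bool (j div n = p') * Kr p' b i l (j mod n)))))
         (mvp d (mf (mat (n * dE) d (\<lambda>(t, i). out p t * U p i))) (v k))) (u k)))
       = of_bool (p' = ob p) * (w k p * Re (qf (n * r * P) (V b) (tens P (y p' b i) (u k))))"
      if p': "p' < N" for p p' i k
    proof -
      define a where "a = mvp d U (v k) p"
      have x: "mvp d (mf (mat (n * dE) d (\<lambda>(t, i). out p t * U p i))) (v k) t = a * out p t" if "t < n * dE" for t
        unfolding mvp_def a_def sum_distrib_right using that by (intro sum.cong refl) (simp add: mf_def)
      have z: "mvp (n * dE)
         (mf (kron (1\<^sub>m n) (mat r dE (\<lambda>(l, j). of_bool (j div n = p') * Kr p' b i l (j mod n)))))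
         (mvp d (mf (mat (n * dE) d (\<lambda>(t, i). out p t * U p i))) (v k)) t
         = of_bool (p' = ob p) * a * y p' b i t" if t: "t < n * r" for t
      proof -
        have tl: "t div r < n" "t mod r < r" using t r by (auto simp: less_mult_imp_div_less)
        let ?R = "mat r dE (\<lambda>(l, j). of_bool (j div n = p') * Kr p' b i l (j mod n))"
        have "mvp (n * dE) (mf (kron (1\<^sub>m n) ?R)) (mvp d (mf (mat (n * dE) d (\<lambda>(t, i). out p t * U p i))) (v k)) t
          = mvp (n * dE) (mf (kron (1\<^sub>m n) ?R)) (\<lambda>t. a * out p t) t"
          by (rule fun_cong[OF mvp_cong]) (rule x)
        also have "\<dots> = (\<Sum>e<dE. mf ?R (t mod r) e * (a * out p (t div r * dE + e)))"
          by (rule mf_kron_id_mvp[OF _ t]) simp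
        also have "\<dots> = (\<Sum>p''<N. \<Sum>s<n. mf ?R (t mod r) (p'' * n + s) * (a * out p (t div r * dE + (p'' * n + s))))"
          unfolding dE_def by (rule sum_lessThan_mult)
        also have "\<dots> = (\<Sum>p''<N. \<Sum>s<n. of_bool (p'' = p') * (of_bool (p' = ob p) * a * (Kr p' b i (t mod r) s * \<zeta> p' s (t div r))))"
        proof (intro sum.cong refl)
          fix p'' s assume "p'' \<in> {..<N}" "s \<in> {..<n}"
          then have ps: "p'' < N" "s < n" by auto
          have "mf ?R (t mod r) (p'' * n + s) = of_bool (p'' = p') * Kr p' b i (t mod r) s"
            using ps tl index_lt[OF ps] by (simp add: mf_def dE_def)
          then show "mf ?R (t mod r) (p'' * n + s) * (a * out p (t div r * dE + (p'' * n + s)))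
             = of_bool (p'' = p') * (of_bool (p' = ob p) * a * (Kr p' b i (t mod r) s * \<zeta> p' s (t div r)))"
            unfolding out_split[OF ps] by (cases "p'' = p'"; cases "p' = ob p") auto
        qed
        also have "\<dots> = (\<Sum>p''<N. of_bool (p'' = p') * (of_bool (p' = ob p) * a * y p' b i t))"
          unfolding y_def by (simp only: sum_distrib_left)
        also have "\<dots> = of_bool (p' = ob p) * a * y p' b i t" by (rule sum_delta_left[OF p'])
        finally show ?thesis .
      qed
      have "qf (n * r * P) (V b) (tens P (mvp (n * dE)
         (mf (kron (1\<^sub>m n) (mat r dE (\<lambda>(l, j). of_bool (j div n = p') * Kr p' b i l (j mod n)))))
         (mvp d (mf (mat (n * dE) d (\<lambda>(t, i). out p t * U p i))) (v k))) (u k))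
         = qf (n * r * P) (V b) (\<lambda>t. (of_bool (p' = ob p) * a) * tens P (y p' b i) (u k) t)"
        by (intro qf_cong) (simp add: tens_def z less_mult_imp_div_less)
      then show ?thesis unfolding qf_scale by (simp add: w_def a_def)
    qed
    have "(\<Sum>R\<leftarrow>Rev b. \<Sum>L\<leftarrow>Phi. Re (qf (n * r * P) (V b) (tens P (mvp (n * dE) (mf (kron (1\<^sub>m n) R))
         (mvp d (mf L) (v k))) (u k)))) = (\<Sum>p<m. w k p * f (ob p) b k)" for k
    proof -
      have "(\<Sum>R\<leftarrow>Rev b. \<Sum>L\<leftarrow>Phi. Re (qf (n * r * P) (V b) (tens P (mvp (n * dE) (mf (kron (1\<^sub>m n) R))
         (mvp d (mf L) (v k))) (u k))))
        = (\<Sum>p'<N. \<Sum>i<M. \<Sum>p<m. of_bool (p' = ob p) * (w k p * Re (qf (n * r * P) (V b) (tens P (y p' b i) (u k)))))"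
        unfolding R L by (intro sum.cong refl summand) simp
      also have "\<dots> = (\<Sum>p'<N. \<Sum>p<m. \<Sum>i<M. of_bool (p' = ob p) * (w k p * Re (qf (n * r * P) (V b) (tens P (y p' b i) (u k)))))"
        by (intro sum.cong[OF refl] sum.swap)
      also have "\<dots> = (\<Sum>p<m. \<Sum>p'<N. \<Sum>i<M. of_bool (p' = ob p) * (w k p * Re (qf (n * r * P) (V b) (tens P (y p' b i) (u k)))))"
        by (rule sum.swap)
      also have "\<dots> = (\<Sum>p<m. \<Sum>p'<N. if p' = ob p then w k p * f (ob p) b k else 0)"
        by (intro sum.cong refl) (auto simp: f_def sum_distrib_left)
      also have "\<dots> = (\<Sum>p<m. w k p * f (ob p) b k)" using ob by simp
      finally show ?thesis .
    qed
    then show ?thesis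
      using bind_prob_eq[of S lam T dE Phi "Rev b" b] PhiK RevK uc Vc
      unfolding u_def[symmetric] K_def[symmetric] P_def[symmetric]
        n_def[symmetric] r_def[symmetric] d_def[symmetric] v_def[symmetric]
      by (simp add: d_def u_def v_def V_def)
  qed

  have honest: "(\<Sum>i<M. Re (qf (n * r * P) (V b) (tens P (hv P (C b) (u k) i) (u k)))) = 1" if k: "k \<in> K" for k b
  proof -
    have "(\<Sum>i<M. Re (qf (n * r * P) (V b) (tens P (hv P (C b) (u k) i) (u k))))
      = (\<Sum>L\<leftarrow>C b. Re (qf (n * r * P) (V b) (tens P (mvp P (mf L) (u k)) (u k))))"
      by (rule sum_hv[OF CM, of "\<lambda>x. Re (qf (n * r * P) (V b) (tens P x (u k)))"]) (simp add: qf_sum tens_def)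
    also have "\<dots> = Re (qtr (ver S lam b * kron (commit_state S lam k b) (proj (psi S lam k))))"
      using accept_eq[of S lam b k] com uc[OF k] Vc
      by (simp add: Re_sum_list P_def n_def r_def C_def V_def u_def)
    finally show ?thesis using corr[OF k] by simp
  qed

  \<comment> \<open>Weight 1/20 gives a loss of 1/20 + 21/1000000, rounded up to 51/1000.\<close>
  have near_receiver: "(\<Sum>i<M. Re (qf (n * r * P) (V b) (tens P (z i) (u k))))
      \<le> (\<Sum>i<M. Re (qf (n * r * P) (V b) (tens P (z i) (u k')))) + 51 / 1000"
    if "(\<Sum>i<M. nsq (n * r) (z i)) = 1" "k \<in> K" "k' \<in> K" "(pdist P (u k) (u k'))\<^sup>2 \<le> 1 / 1000000" for z b k k'
  proof -
    have "(\<Sum>i<M. Re (qf (n * r * P) (V b) (tens P (z i) (u k))))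
      \<le> (\<Sum>i<M. Re (qf (n * r * P) (V b) (tens P (z i) (u k')))) + 1 / 20 + (1 + 1 / (1 / 20)) * (1 / 1000000)"
    proof (rule effect_functional_perturb[OF Ve _ _ _ u1[OF that(2)] u1[OF that(3)] that(4)])
      show "(\<Sum>i<M. nsq (n * r * P) (tens P (z i) x)) = nsq P x" for x
        unfolding nsq_tens sum_distrib_right[symmetric] that(1) by simp
    qed (auto simp: tens_def algebra_simps)
    then show ?thesis by simp
  qed

  have F_bound: "184 / 100 - 21 * \<Delta> p \<le> F (g i) p" if ip: "i < N" "p < N" and lab: "lab i = lab p" for i p
  proof -
    have pd: "(pdist P (u (g p)) (u (g i)))\<^sup>2 \<le> 1 / 1000000" using near[OF ip(2,1)] lab by simp
    have hn: "(\<Sum>i<M. nsq (n * r) (hv P (C b) (u (g p)) i)) = 1" for b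
      using hv_nsq[OF CK CM] u1[OF gK[OF ip(2)]] by simp
    \<comment> \<open>By correctness the honest opening under the guessed key is accepted with
      certainty by a receiver holding the guessed state, hence almost so by one holding the true
      state of the same cluster.\<close>
    have h: "1 \<le> (\<Sum>j<M. Re (qf (n * r * P) (V b) (tens P (hv P (C b) (u (g p)) j) (u (g i))))) + 51 / 1000" for b
      using near_receiver[OF hn gK[OF ip(2)] gK[OF ip(1)] pd] honest[OF gK[OF ip(2)]] by metis
    have "f p False (g i) = (\<Sum>j<M. Re (qf (n * r * P) (V False) (tens P (hv P (C False) (u (g p)) j) (u (g i)))))"
      unfolding f_def
    proof (intro sum.cong refl arg_cong[of _ _ Re] qf_cong)
      fix j t assume "j \<in> {..<M}" "t < n * r * P"
      then have "j < M" "t div P < n * r" by (auto simp: less_mult_imp_div_less)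
      then show "tens P (y p False j) (u (g i)) t = tens P (hv P (C False) (u (g p)) j) (u (g i)) t"
        by (simp add: tens_def yF[OF ip(2)])
    qed
    then have f0: "949 / 1000 \<le> f p False (g i)" using h[of False] by simp
    \<comment> \<open>For bit 1 the opening is only close to the honest one. Weight 1/20 makes the
      coefficient 1 + 20 = 21; the bounds 0.949 and 0.899 for the two bits give 1.84.\<close>
    have "(\<Sum>j<M. Re (qf (n * r * P) (V True) (tens P (hv P (C True) (u (g p)) j) (u (g i)))))
      \<le> (\<Sum>j<M. Re (qf (n * r * P) (V True) (tens P (y p True j) (u (g i))))
          + 1 / 20 * nsq (n * r * P) (tens P (y p True j) (u (g i)))
          + (1 + 1 / (1 / 20)) * nsq (n * r * P) (\<lambda>t. tens P (hv P (C True) (u (g p)) j) (u (g i)) t - tens P (y p True j) (u (g i)) t))"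
      by (intro sum_mono effect_perturb[OF Ve]) simp
    also have "\<dots> = f p True (g i) + 1 / 20 * (\<Sum>j<M. nsq (n * r) (y p True j))
          + 21 * (\<Sum>j<M. nsq (n * r) (\<lambda>t. hv P (C True) (u (g p)) j t - y p True j t))"
    proof -
      have "nsq (n * r * P) (\<lambda>t. tens P (hv P (C True) (u (g p)) j) (u (g i)) t - tens P (y p True j) (u (g i)) t)
         = nsq (n * r) (\<lambda>t. hv P (C True) (u (g p)) j t - y p True j t)" for j
      proof -
        have "(\<lambda>t. tens P (hv P (C True) (u (g p)) j) (u (g i)) t - tens P (y p True j) (u (g i)) t)
          = tens P (\<lambda>t. hv P (C True) (u (g p)) j t - y p True j t) (u (g i))"
          by (simp add: tens_def left_diff_distrib)
        then show ?thesis using u1[OF gK[OF ip(1)]] by (simp add: nsq_tens)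
      qed
      then show ?thesis
        using u1[OF gK[OF ip(1)]] by (simp add: sum.distrib sum_distrib_left nsq_tens f_def)
    qed
    also have "\<dots> \<le> f p True (g i) + 1 / 20 + 21 * \<Delta> p" using y1[OF ip(2)] yT[OF ip(2)] by simp
    finally have "899 / 1000 - 21 * \<Delta> p \<le> f p True (g i)" using h[of True] by simp
    then show ?thesis using f0 ip(2) by (simp add: F_def ob_def)
  qed

  have f0: "0 \<le> f p b k" for p b k
    using Ve by (auto simp: f_def effect_def psdf_def intro!: sum_nonneg)

  have bb: "0 \<le> bias P n r M (D p) (C b) (u k)" "bias P n r M (D p) (C b) (u k) \<le> 1" if "p < N" "k \<in> K" for p b k
    using bias_bounds[OF De[OF that(1)] CK CM] u1[OF that(2)] by metis+
  have H1: "\<bar>H p k\<bar> \<le> 1" if "k \<in> K" "p < N" for p k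
    using bb[OF that(2,1), of False] bb[OF that(2,1), of True] by (simp add: H_def)
  \<comment> \<open>Two perturbations, one for each bit, each costing 1/1000 + 1001/1000000 at
    weight 1/1000.\<close>
  have HH: "H p (g p) \<le> H p (g i) + 5 / 1000" if ip: "i < N" "p < N" and lab: "lab i = lab p" for i p
  proof -
    have pert: "bias P n r M (D p) (C b) (u (g x)) \<le> bias P n r M (D p) (C b) (u (g x')) + 1 / 1000 + (1 + 1 / (1 / 1000)) * (1 / 1000000)"
      if "x < N" "x' < N" "lab x = lab x'" for x x' b
      by (rule bias_perturb[OF De[OF ip(2)] CK CM _ u1 u1 near]) (use that gK in auto)
    show ?thesis
      using pert[of p i False] pert[of i p True] ip lab by (simp add: H_def)
  qed

  have cK: "0 < real (card K)" using K by (simp add: card_gt_0_iff)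
  have "14 / 10 \<le> bind_prob S T lam dE Phi (Rev False) False + bind_prob S T lam dE Phi (Rev True) True"
    if hide: "\<bar>hide_prob S T lam Dm False - hide_prob S T lam Dm True\<bar> \<le> 1 / 1000"
  proof -
    have "hide_prob S T lam Dm False - hide_prob S T lam Dm True = (\<Sum>k\<in>K. \<Sum>p<N. w k p * H p k) / real (card K)"
      unfolding hide_eq avg_key_def K_def[symmetric] H_def
      by (simp add: diff_divide_distrib[symmetric] sum_subtractf[symmetric] right_diff_distrib)
    then have "(\<Sum>k\<in>K. \<Sum>p<N. w k p * H p k) / real (card K) \<le> 1 / 1000"
      using hide by linarith
    then have bound: "(\<Sum>k\<in>K. \<Sum>p<N. w k p * H p k) \<le> real (card K) / 1000"
      unfolding pos_divide_le_eq[OF cK] by simp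
    have "14 / 10 * real (card K) \<le> (\<Sum>k\<in>K. \<Sum>p<m. w k p * F k p)"
    proof (rule attack_value[OF K(1) A(2,1,3), where lab=lab and \<Delta>=\<Delta> and H=H])
      show "0 \<le> w k p" for k p by (simp add: w_def)
      show "N \<le> m" by (simp add: m_def)
      show "w (g i) p = 0" if "i < N" "N \<le> p" "p < m" for i p using U(2)[OF that] by (simp add: w_def)
      show "(\<Sum>i<N. w (g i) p) = 1" if "p < N" for p using U(3)[OF that] by (simp add: w_def)
      show "0 \<le> F k p" for k p by (simp add: F_def f0)
      show "184 / 100 - 21 * \<Delta> p \<le> F (g i) p" if "i < N" "p < N" "lab i = lab p" for i p
        by (rule F_bound[OF that])
      show "\<Delta> p \<le> 2 * H p (g p)" if "p < N" for p using \<Delta>b[OF that] by (simp add: H_def)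
      show "H p (g p) \<le> H p (g i) + 5 / 1000" if "i < N" "p < N" "lab i = lab p" for i p
        by (rule HH[OF that])
      show "(\<Sum>p<m. w k p) = 1" if "k \<in> K" for k
        using isom_nsq[OF U(1), of "v k"] v1[OF that] by (simp add: w_def nsq_def)
      show "(\<Sum>i<N. \<Sum>p<N. of_bool (lab i \<noteq> lab p) * w (g i) p) \<le> real N / 1000"
        using U(4) far unfolding w_def by (rule order_trans)
      show "0 \<le> \<Delta> p" if "p < N" for p by (rule \<Delta>0[OF that])
      show "\<bar>H p k\<bar> \<le> 1" if "k \<in> K" "p < N" for p k by (rule H1[OF that])
      show "(\<Sum>k\<in>K. \<Sum>p<N. w k p * H p k) \<le> real (card K) / 1000" by (rule bound)
    qed
    moreover have "bind_prob S T lam dE Phi (Rev False) False + bind_prob S T lam dE Phi (Rev True) True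
        = (\<Sum>k\<in>K. \<Sum>p<m. w k p * F k p) / real (card K)"
      unfolding bind_eq avg_key_def K_def[symmetric] F_def
      by (simp add: add_divide_distrib sum.distrib distrib_left)
    ultimately show ?thesis using cK by (simp add: pos_le_divide_eq)
  qed
  then show ?thesis using PhiK RevK DmP unfolding d_def by blast
qed

section \<open>From one security parameter to the asymptotic statement\<close>

lemma is_poly_copies:
  assumes "is_poly p"
  shows "is_poly (\<lambda>lam. copies (p lam + 1))"
proof -
  obtain f :: "nat poly" where f: "\<And>lam. p lam = poly f lam" using assms by (auto simp: is_poly_def)
  have "copies (p lam + 1) = poly (2 * (8000000000000 * (f + 1)\<^sup>2 * (f + 1 + 10))) lam" for lam
    by (simp add: copies_def f)
  then show ?thesis unfolding is_poly_def by blast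
qed

text \<open>Exponent 1 already forces convergence to 0; constant thresholds suffice because the
  attack wins by a constant.\<close>

lemma negligible_le:
  assumes "negligible f" "0 < c"
  shows "\<exists>N. \<forall>lam\<ge>N. \<bar>f lam\<bar> \<le> c"
proof -
  obtain N where N: "\<And>lam. lam \<ge> N \<Longrightarrow> \<bar>f lam\<bar> \<le> 1 / real lam ^ 1"
    using assms(1) unfolding negligible_def by blast
  obtain L :: nat where L: "1 / c < real L" using reals_Archimedean2 by blast
  have "\<bar>f lam\<bar> \<le> c" if "lam \<ge> max N L" for lam
  proof -
    have "0 < 1 / c" using assms(2) by simp
    then have "1 / c < real lam" "0 < real lam" using L that by linarith+
    then have "1 / real lam \<le> c" using assms(2) by (simp add: field_simps)
    then show ?thesis using N[of lam] that by simp
  qed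
  then show ?thesis by blast
qed

text \<open>Keys may have any length up to p, so a geometric sum bounds their number; this explains
  \<open>p lam + 1\<close> as the argument of \<open>copies\<close>, which also keeps it
  positive.\<close>

lemma card_bool_lists:
  assumes "\<And>k. k \<in> K \<Longrightarrow> length k \<le> p"
  shows "card (K :: bool list set) < 2 ^ (p + 1)"
proof -
  have "card K \<le> card {xs. set xs \<subseteq> (UNIV :: bool set) \<and> length xs \<le> p}"
    using assms by (intro card_mono finite_lists_length_le) auto
  also have "\<dots> = (\<Sum>i\<le>p. 2 ^ i)" using card_lists_length_le[of "UNIV :: bool set" p] by simp
  also have "\<dots> < 2 ^ (p + 1)" by (induction p) auto
  finally show ?thesis .
qed

theorem theorem7p8:
  shows "\<not> (\<exists>S :: crqs_scheme. wf_scheme S \<and> correct S \<and>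
            (\<forall>t. is_poly t \<longrightarrow> stat_hiding S t \<and> stat_sum_binding S t))"
proof
  assume "\<exists>S :: crqs_scheme. wf_scheme S \<and> correct S \<and>
            (\<forall>t. is_poly t \<longrightarrow> stat_hiding S t \<and> stat_sum_binding S t)"
  then obtain S where wf: "wf_scheme S" and corr: "correct S"
    and sec: "\<And>t. is_poly t \<Longrightarrow> stat_hiding S t \<and> stat_sum_binding S t" by blast
  obtain p where p: "is_poly p" and wfp: "\<And>lam.
      finite (keys S lam) \<and> keys S lam \<noteq> {} \<and>
      (\<forall>k \<in> keys S lam. length k \<le> p lam) \<and>
      nPsi S lam \<le> p lam \<and> nC S lam \<le> p lam \<and> nR S lam \<le> p lam \<and>
      (\<forall>k \<in> keys S lam. unit_state (dPsi S lam) (psi S lam k)) \<and>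
      (\<forall>b. kraus (dPsi S lam) (dC S lam * dR S lam) (com S lam b)) \<and>
      (\<forall>b. povm_elem (dC S lam * dR S lam * dPsi S lam) (ver S lam b))"
    using wf unfolding wf_scheme_def by blast
  define t where "t = (\<lambda>lam. copies (p lam + 1))"
  have t: "stat_hiding S t" "stat_sum_binding S t"
    using sec[OF is_poly_copies[OF p]] by (simp_all add: t_def)
  have "\<exists>dE Phi Rev D. kraus (dPsi S lam ^ t lam) (dC S lam * dE) Phi \<and> (\<forall>b. kraus dE (dR S lam) (Rev b)) \<and>
    povm_elem (dPsi S lam ^ t lam * dC S lam) D \<and>
    (\<bar>hide_prob S (t lam) lam D False - hide_prob S (t lam) lam D True\<bar> \<le> 1 / 1000 \<longrightarrow>
      14 / 10 \<le> bind_prob S (t lam) lam dE Phi (Rev False) False + bind_prob S (t lam) lam dE Phi (Rev True) True)" for lam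
    unfolding t_def
    by (rule attack_exists) (use wfp[of lam] corr card_bool_lists[of "keys S lam" "p lam"] in \<open>auto simp: correct_def\<close>)
  then obtain dE Phi Rev D where
    Phi: "\<And>lam. kraus (dPsi S lam ^ t lam) (dC S lam * dE lam) (Phi lam)"
    and Rev: "\<And>lam b. kraus (dE lam) (dR S lam) (Rev lam b)"
    and D: "\<And>lam. povm_elem (dPsi S lam ^ t lam * dC S lam) (D lam)"
    and win: "\<And>lam. \<bar>hide_prob S (t lam) lam (D lam) False - hide_prob S (t lam) lam (D lam) True\<bar> \<le> 1 / 1000 \<Longrightarrow>
      14 / 10 \<le> bind_prob S (t lam) lam (dE lam) (Phi lam) (Rev lam False) False
        + bind_prob S (t lam) lam (dE lam) (Phi lam) (Rev lam True) True"
    by metis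
  have "negligible (\<lambda>lam. \<bar>hide_prob S (t lam) lam (D lam) False - hide_prob S (t lam) lam (D lam) True\<bar>)"
    using t(1) D unfolding stat_hiding_def by blast
  from negligible_le[OF this, of "1 / 1000"] obtain N1 where N1: "\<And>lam. lam \<ge> N1 \<Longrightarrow>
      \<bar>hide_prob S (t lam) lam (D lam) False - hide_prob S (t lam) lam (D lam) True\<bar> \<le> 1 / 1000" by auto
  obtain \<nu> where \<nu>: "negligible \<nu>" "\<And>lam.
        bind_prob S (t lam) lam (dE lam) (Phi lam) (Rev lam False) False
      + bind_prob S (t lam) lam (dE lam) (Phi lam) (Rev lam True) True \<le> 1 + \<nu> lam"
    using t(2)[unfolded stat_sum_binding_def, rule_format, of dE Phi "\<lambda>lam. Rev lam False" "\<lambda>lam. Rev lam True"]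
      Phi Rev by blast
  from negligible_le[OF \<nu>(1), of "1 / 1000"] obtain N2 where N2: "\<And>lam. lam \<ge> N2 \<Longrightarrow> \<bar>\<nu> lam\<bar> \<le> 1 / 1000" by auto
  \<comment> \<open>One parameter at which both negligible quantities are below 1/1000 already gives
    the contradiction between 14/10 and 1 + 1/1000.\<close>
  define lam where "lam = max N1 N2"
  have "14 / 10 \<le> 1 + \<nu> lam" using win[OF N1, of lam] \<nu>(2)[of lam] by (simp add: lam_def)
  moreover have "\<bar>\<nu> lam\<bar> \<le> 1 / 1000" by (rule N2) (simp add: lam_def)
  ultimately show False by simp
qed

end
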